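(* Let $X_{4,0}$ be a general element of $Z(4,0)$, i.e. a general disjoint union of $4$ double lines in $\mathbb{P}^3$. Then $h^0(\mathcal{I}_{X_{4,0}}(6))=10$ and $h^1(\mathcal{I}_{X_{4,0}}(6))=2$.
   Context: We work over an algebraically closed field of characteristic $0$. For a line $L\subset\mathbb{P}^3$, the double line $2L$ is the closed subscheme of $\mathbb{P}^3$ with ideal sheaf $(\mathcal{I}_L)^2$. For $(a,b)\in\mathbb{N}^2\setminus\{(0,0)\}$, $Z(a,b)$ denotes the set of all closed subschemes $X\subset\mathbb{P}^3$ with exactly $a+b$ connected components, $a$ of them being double lines and $b$ of them being lines. It is an irreducible quasi-projective subset of the Hilbert scheme of $\mathbb{P}^3$; a statement about a general element of $Z(a,b)$ means that it holds for all elements of some non-empty Zariski open subset of $Z(a,b)$. *)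

theory Defs
  imports
    "HOL-Analysis.Analysis"
    "HOL-Computational_Algebra.Computational_Algebra"
    "HOL-Library.Poly_Mapping"
    "HOL-Library.FuncSet"
begin

text \<open>
  Polynomials in variables \<open>'v\<close> are finitely supported functions on the monomials
  \<open>'v \<Rightarrow>\<^sub>0 nat\<close>; the multiplication of \<^theory>\<open>HOL-Library.Poly_Mapping\<close> is the convolution product.
  With \<open>int\<close> in place of \<open>nat\<close> one obtains Laurent polynomials.  The index type \<open>4\<close> has the
  elements \<open>0 < 1 < 2 < 3\<close>, so \<open>'k hpoly\<close> is the homogeneous coordinate ring
  \<open>k[x0,x1,x2,x3]\<close> of projective 3-space.
\<close>

type_synonym ('v, 'k) mpoly = "('v \<Rightarrow>\<^sub>0 nat) \<Rightarrow>\<^sub>0 'k"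
type_synonym 'k hpoly = "(4, 'k) mpoly"
type_synonym 'k laurent = "(4 \<Rightarrow>\<^sub>0 int) \<Rightarrow>\<^sub>0 'k"

definition eval_mpoly :: "('v \<Rightarrow> 'k) \<Rightarrow> ('v, 'k::comm_ring_1) mpoly \<Rightarrow> 'k" where
  "eval_mpoly t p =
     (\<Sum>m\<in>Poly_Mapping.keys p.
        Poly_Mapping.lookup p m * (\<Prod>v\<in>Poly_Mapping.keys m. t v ^ Poly_Mapping.lookup m v))"

definition vars_mpoly :: "('v, 'k::zero) mpoly \<Rightarrow> 'v set" where
  "vars_mpoly p = (\<Union>m\<in>Poly_Mapping.keys p. Poly_Mapping.keys m)"

section \<open>Lines, double lines and their disjoint unions\<close>

text \<open>A line in projective 3-space is given by its cone, a plane through the origin of \<open>k\<^sup>4\<close>.\<close>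

definition is_line :: "('k::field ^ 4) set \<Rightarrow> bool" where
  "is_line V \<longleftrightarrow> vec.subspace V \<and> vec.dim V = 2"

definition disjoint_lines :: "nat \<Rightarrow> (nat \<Rightarrow> ('k::field ^ 4) set) \<Rightarrow> bool" where
  "disjoint_lines n V \<longleftrightarrow>
     (\<forall>i<n. is_line (V i)) \<and> (\<forall>i<n. \<forall>j<n. i \<noteq> j \<longrightarrow> V i \<inter> V j = {0})"

definition vanishing_ideal :: "('k::field ^ 4) set \<Rightarrow> 'k hpoly set" where
  "vanishing_ideal V = {p. \<forall>x\<in>V. eval_mpoly (\<lambda>i. x $ i) p = 0}"

definition ideal_mult :: "'r::comm_ring_1 set \<Rightarrow> 'r set \<Rightarrow> 'r set" where
  "ideal_mult I J = module.span (*) {p * q |p q. p \<in> I \<and> q \<in> J}"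

text \<open>
  A closed subscheme of projective 3-space is represented by its saturated homogeneous ideal.
  The double line on \<open>L\<close> has ideal \<open>I\<^sub>L\<^sup>2\<close>; this ideal is already saturated, because \<open>I\<^sub>L\<close> is
  generated by two independent linear forms.  A disjoint union corresponds to the
  intersection of the ideals.  Here the lines with index below \<open>a\<close> are doubled.
\<close>

definition union_ideal :: "nat \<Rightarrow> nat \<Rightarrow> (nat \<Rightarrow> ('k::field ^ 4) set) \<Rightarrow> 'k hpoly set" where
  "union_ideal a b V =
     (\<Inter>i\<in>{..<a}. ideal_mult (vanishing_ideal (V i)) (vanishing_ideal (V i)))
     \<inter> (\<Inter>i\<in>{a..<a + b}. vanishing_ideal (V i))"

definition Zset :: "nat \<Rightarrow> nat \<Rightarrow> 'k::field hpoly set set" where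
  "Zset a b = {union_ideal a b V |V. disjoint_lines (a + b) V}"

section \<open>The Zariski topology on \<open>Zset a b\<close>, and general elements\<close>

definition affine_space :: "'v set \<Rightarrow> ('v \<Rightarrow> 'k) set" where
  "affine_space A = (A \<rightarrow>\<^sub>E UNIV)"

definition zariski_open :: "'v set \<Rightarrow> ('v \<Rightarrow> 'k::field) set \<Rightarrow> bool" where
  "zariski_open A U \<longleftrightarrow>
     (\<exists>F. (\<forall>p\<in>F. vars_mpoly p \<subseteq> A) \<and> U = {t \<in> affine_space A. \<exists>p\<in>F. eval_mpoly t p \<noteq> 0})"

text \<open>
  A family of lines is parametrised by spanning vectors: the \<open>i\<close>-th line is spanned by the
  points with coordinates \<open>t (i, 0, \<cdot>)\<close> and \<open>t (i, 1, \<cdot>)\<close>.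
\<close>

definition spanned_line :: "(nat \<times> 2 \<times> 4 \<Rightarrow> 'k::field) \<Rightarrow> nat \<Rightarrow> ('k ^ 4) set" where
  "spanned_line t i = vec.span {(\<chi> m. t (i, 0, m)), (\<chi> m. t (i, 1, m))}"

text \<open>
  The topology is the quotient topology along the surjection \<open>t \<mapsto> union_ideal a b (spanned_line t)\<close>
  from the Zariski open set of those \<open>t\<close> for which the lines are honest and disjoint.  This surjection
  is the composite of the quotient onto tuples of disjoint lines in the product of Grassmannians,
  the quotient by the permutations in \<open>S\<^sub>a \<times> S\<^sub>b\<close>, and the homeomorphism of the result with the
  locally closed subset of the Hilbert scheme.
\<close>

definition Zset_open :: "nat \<Rightarrow> nat \<Rightarrow> 'k::field hpoly set set \<Rightarrow> bool" where
  "Zset_open a b U \<longleftrightarrow> U \<subseteq> Zset a b \<and>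
     zariski_open ({..<a + b} \<times> UNIV)
       {t \<in> affine_space ({..<a + b} \<times> UNIV).
          disjoint_lines (a + b) (spanned_line t) \<and> union_ideal a b (spanned_line t) \<in> U}"

definition holds_for_general :: "nat \<Rightarrow> nat \<Rightarrow> ('k::field hpoly set \<Rightarrow> bool) \<Rightarrow> bool" where
  "holds_for_general a b P \<longleftrightarrow> (\<exists>U. Zset_open a b U \<and> U \<noteq> {} \<and> (\<forall>X\<in>U. P X))"

section \<open>Cohomology of twisted ideal sheaves\<close>

definition to_laurent :: "'k::comm_ring_1 hpoly \<Rightarrow> 'k laurent" where
  "to_laurent p =
     (\<Sum>m\<in>Poly_Mapping.keys p. Poly_Mapping.single (Poly_Mapping.map int m) (Poly_Mapping.lookup p m))"

definition homogeneous_laurent :: "int \<Rightarrow> 'k::zero laurent \<Rightarrow> bool" where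
  "homogeneous_laurent d f \<longleftrightarrow>
     (\<forall>m\<in>Poly_Mapping.keys f. (\<Sum>i\<in>UNIV. Poly_Mapping.lookup m i) = d)"

definition xprod :: "4 set \<Rightarrow> 'k::comm_ring_1 laurent" where
  "xprod \<sigma> = (\<Prod>i\<in>\<sigma>. Poly_Mapping.single (Poly_Mapping.single i 1) 1)"

text \<open>
  Sections over \<open>D\<^sub>+(\<Prod>i\<in>\<sigma>. x\<^sub>i)\<close>, for nonempty \<open>\<sigma>\<close>, of the \<open>d\<close>-th twist of the ideal sheaf
  associated with the homogeneous ideal \<open>J\<close>: the degree \<open>d\<close> part of the localisation of \<open>J\<close> at
  \<open>\<Prod>i\<in>\<sigma>. x\<^sub>i\<close>.  All these localisations lie in the Laurent polynomial ring, where the restriction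
  maps are inclusions.
\<close>

definition ideal_sections :: "'k::field hpoly set \<Rightarrow> int \<Rightarrow> 4 set \<Rightarrow> 'k laurent set" where
  "ideal_sections J d \<sigma> =
     {f. homogeneous_laurent d f \<and> (\<exists>n. xprod \<sigma> ^ n * f \<in> to_laurent ` J)}"

text \<open>
  The Cech complex for the affine cover \<open>D\<^sub>+(x\<^sub>0), \<dots>, D\<^sub>+(x\<^sub>3)\<close>.  A \<open>p\<close>-cochain assigns a section
  to each \<open>(p + 1)\<close>-element set of indices (taken in increasing order), and is \<open>0\<close> elsewhere.
\<close>

definition cech_cochains :: "'k::field hpoly set \<Rightarrow> int \<Rightarrow> nat \<Rightarrow> ('k laurent ^ (4 set)) set" where
  "cech_cochains J d p =
     {c. \<forall>\<sigma>. if card \<sigma> = p + 1 then c $ \<sigma> \<in> ideal_sections J d \<sigma> else c $ \<sigma> = 0}"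

definition cech_d :: "'k::field laurent ^ (4 set) \<Rightarrow> 'k laurent ^ (4 set)" where
  "cech_d c = (\<chi> \<sigma>. \<Sum>i\<in>\<sigma>. (- 1) ^ card {j\<in>\<sigma>. j < i} * c $ (\<sigma> - {i}))"

definition cech_cocycles :: "'k::field hpoly set \<Rightarrow> int \<Rightarrow> nat \<Rightarrow> ('k laurent ^ (4 set)) set" where
  "cech_cocycles J d p = {c \<in> cech_cochains J d p. cech_d c = 0}"

definition cech_coboundaries :: "'k::field hpoly set \<Rightarrow> int \<Rightarrow> nat \<Rightarrow> ('k laurent ^ (4 set)) set" where
  "cech_coboundaries J d p = (case p of 0 \<Rightarrow> {0} | Suc q \<Rightarrow> cech_d ` cech_cochains J d q)"

definition cochain_scale :: "'k::field \<Rightarrow> 'k laurent ^ (4 set) \<Rightarrow> 'k laurent ^ (4 set)" where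
  "cochain_scale r c = Poly_Mapping.single 0 r *s c"

text \<open>
  \<open>Z / B\<close> has dimension \<open>n\<close>: the classes of some \<open>n\<close> elements of \<open>Z\<close> form a basis.  A relation is
  used so that an infinite-dimensional quotient has no dimension, instead of the
  conventional value \<open>0\<close>.
\<close>

definition has_quotient_dim ::
    "('k::field \<Rightarrow> 'm::ab_group_add \<Rightarrow> 'm) \<Rightarrow> 'm set \<Rightarrow> 'm set \<Rightarrow> nat \<Rightarrow> bool" where
  "has_quotient_dim smul Z B n \<longleftrightarrow>
     (\<exists>E. finite E \<and> card E = n \<and> E \<subseteq> Z \<and>
        (\<forall>r. (\<Sum>e\<in>E. smul (r e) e) \<in> B \<longrightarrow> (\<forall>e\<in>E. r e = 0)) \<and>
        (\<forall>z\<in>Z. \<exists>r. z - (\<Sum>e\<in>E. smul (r e) e) \<in> B))"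

text \<open>\<open>has_h p J d n\<close> says that \<open>h\<^sup>p(\<I>\<^sub>X(d)) = n\<close> for the closed subscheme \<open>X\<close> with ideal \<open>J\<close>.\<close>

definition has_h :: "nat \<Rightarrow> 'k::field hpoly set \<Rightarrow> int \<Rightarrow> nat \<Rightarrow> bool" where
  "has_h p J d n \<longleftrightarrow>
     has_quotient_dim cochain_scale (cech_cocycles J d p) (cech_coboundaries J d p) n"

end

(*
A double line 2L has ideal I_L^2, so H^0 of its ideal sheaf is read off from forms that are singular
along L. Since the Cech H^1 of O(d) vanishes, H^1 of the ideal sheaf of a disjoint union X of double
lines is the cokernel of the evaluation of forms of degree d on X. For d = 6 and four double lines it
has dimension h^0 - 84 + 4 * 19 = h^0 - 8, so everything reduces to h^0 = 10.

Four general lines have two distinct transversals, and these span k^4. In coordinates x_0, x_2 on one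
transversal and x_1, x_3 on the other, the ideals of the lines are bihomogeneous. The condition on a
form splits into its parts of bidegree (P, 6 - P), which are curves on P^1 x P^1 singular at four
points; the parts with P = 2, 3, 4 contribute 3 + 4 + 3 = 10 and the others vanish. The generic
condition is that the cross ratios of the four points on the two transversals differ, which is the
nonvanishing of a polynomial in the Pluecker coordinates of the lines.
*)

theory Submission
  imports Defs "HOL-Library.Function_Algebras"
begin

no_notation fps_nth (infixl "$" 75)

text \<open>No transversal is constructed geometrically. The third and fourth line are graphs of
  isomorphisms from the first to the second; each eigenvector of the quotient of these isomorphisms
  spans a transversal together with its image, \<alpha> and \<beta> are the eigenvalues, and the
  discriminant of the characteristic polynomial is the generic condition. The number 10 is squeezed.
  From below, 28 monomials in the three middle bidegrees face 3 * 2 * 3 = 18 conditions at two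
  singular points. From above, ten further linear conditions leave only the zero form, and \<alpha>
  \<noteq> \<beta> is what makes this work. Points of \<open>Zset\<close> are ideals, not tuples of
  spanning vectors. An open set therefore needs a condition that depends on the ideal alone: the
  lines are recovered from the zero set of the ideal, and the discriminant changes only by a nonzero
  factor under change of spanning vectors and not at all under permutation. The Cech cover is fixed
  while the lines are arbitrary. The link is that on each line some two coordinates x_a and x_b have
  no common zero, and x_a is regular modulo the square of its ideal, so two of the four charts
  decide everything.\<close>

abbreviation "lookup \<equiv> Poly_Mapping.lookup"
abbreviation "single \<equiv> Poly_Mapping.single"
abbreviation "keys \<equiv> Poly_Mapping.keys"

section \<open>Evaluation homomorphisms\<close>

lemma poly_mapping_sum_single:
  fixes p :: "'a \<Rightarrow>\<^sub>0 'b::comm_monoid_add"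
  assumes "finite A" "keys p \<subseteq> A"
  shows "p = (\<Sum>m\<in>A. single m (lookup p m))"
proof (rule poly_mapping_eqI)
  fix k
  have "lookup (\<Sum>m\<in>A. single m (lookup p m)) k = (\<Sum>m\<in>A. lookup p m when m = k)"
    by (simp add: lookup_sum lookup_single)
  also have "\<dots> = (\<Sum>m\<in>A. if k = m then lookup p m else 0)"
    by (rule sum.cong) (auto simp: when_def)
  also have "\<dots> = lookup p k"
    using assms by (auto simp: in_keys_iff subset_iff)
  finally show "lookup p k = lookup (\<Sum>m\<in>A. single m (lookup p m)) k" by simp
qed

text \<open>Both sides are additive in \<open>p\<close> and in \<open>q\<close>, and every element
  is a finite sum of single terms. Evaluation and the embedding into Laurent polynomials both use
  this.\<close>

lemma multiplicative_if_on_singles: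
  fixes h :: "('a::comm_monoid_add \<Rightarrow>\<^sub>0 'b::comm_ring_1) \<Rightarrow> 'r::comm_ring_1"
  assumes add: "\<And>p q. h (p + q) = h p + h q"
    and sg: "\<And>m n a b. h (single m a * single n b) = h (single m a) * h (single n b)"
  shows "h (p * q) = h p * h q"
proof -
  have h0: "h 0 = 0" using add[of 0 0] by simp
  have hsum: "h (sum f A) = (\<Sum>x\<in>A. h (f x))" for f :: "'c \<Rightarrow> _" and A
    by (induction A rule: infinite_finite_induct) (auto simp: h0 add)
  have p: "p = (\<Sum>m\<in>keys p. single m (lookup p m))" for p :: "'a \<Rightarrow>\<^sub>0 'b"
    by (rule poly_mapping_sum_single) auto
  have "h (p * q) = h ((\<Sum>m\<in>keys p. single m (lookup p m)) * (\<Sum>n\<in>keys q. single n (lookup q n)))"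
    using p[of p] p[of q] by simp
  also have "\<dots> = (\<Sum>m\<in>keys p. h (single m (lookup p m))) * (\<Sum>n\<in>keys q. h (single n (lookup q n)))"
    by (simp add: sum_product hsum sg)
  also have "\<dots> = h p * h q"
    using p[of p] p[of q] by (simp flip: hsum)
  finally show ?thesis .
qed

definition mon_eval :: "('v \<Rightarrow> 'r::comm_ring_1) \<Rightarrow> ('v \<Rightarrow>\<^sub>0 nat) \<Rightarrow> 'r" where
  "mon_eval t m = (\<Prod>v\<in>keys m. t v ^ lookup m v)"

lemma mon_eval_superset:
  assumes "finite A" "keys m \<subseteq> A"
  shows "mon_eval t m = (\<Prod>v\<in>A. t v ^ lookup m v)"
  unfolding mon_eval_def using assms
  by (intro prod.mono_neutral_left) (auto simp: in_keys_iff)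

lemma mon_eval_UNIV:
  fixes m :: "'v::finite \<Rightarrow>\<^sub>0 nat"
  shows "mon_eval t m = (\<Prod>v\<in>UNIV. t v ^ lookup m v)"
  by (rule mon_eval_superset) auto

lemma mon_eval_add: "mon_eval t (m + n) = mon_eval t m * mon_eval t n"
proof -
  have "keys (m + n) \<subseteq> keys m \<union> keys n" by (rule keys_add)
  then show ?thesis
    by (subst (1 2 3) mon_eval_superset[of "keys m \<union> keys n"])
       (auto simp: lookup_add power_add prod.distrib)
qed

lemma mon_eval_0 [simp]: "mon_eval t 0 = 1"
  by (simp add: mon_eval_def)

lemma mon_eval_single [simp]: "mon_eval t (single v n) = t v ^ n"
  by (cases "n = 0") (auto simp: mon_eval_def)

text \<open>Coefficients pass through \<open>C\<close> so that evaluation at a point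
  (\<open>C\<close> the identity) and substitution of linear forms (\<open>C\<close> the embedding
  of constants) share one proof of the homomorphism laws.\<close>

definition hom_eval ::
  "('k::comm_ring_1 \<Rightarrow> 'r::comm_ring_1) \<Rightarrow> ('v \<Rightarrow> 'r) \<Rightarrow> ('v, 'k) mpoly \<Rightarrow> 'r" where
  "hom_eval C t p = (\<Sum>m\<in>keys p. C (lookup p m) * mon_eval t m)"

lemma eval_mpoly_eq_hom_eval: "eval_mpoly t = hom_eval (\<lambda>c. c) t"
  by (simp add: fun_eq_iff eval_mpoly_def hom_eval_def mon_eval_def)

locale coeff_hom =
  fixes C :: "'k::comm_ring_1 \<Rightarrow> 'r::comm_ring_1"
  assumes C_add: "C (a + b) = C a + C b"
    and C_mult: "C (a * b) = C a * C b"
    and C_1: "C 1 = 1"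
begin

lemma C_0: "C 0 = 0" using C_add[of 0 0] by simp

lemma hom_eval_superset:
  assumes "finite A" "keys p \<subseteq> A"
  shows "hom_eval C t p = (\<Sum>m\<in>A. C (lookup p m) * mon_eval t m)"
  unfolding hom_eval_def using assms
  by (intro sum.mono_neutral_left) (auto simp: in_keys_iff C_0)

lemma hom_eval_add: "hom_eval C t (p + q) = hom_eval C t p + hom_eval C t q"
proof -
  have "keys (p + q) \<subseteq> keys p \<union> keys q" by (rule keys_add)
  then show ?thesis
    by (subst (1 2 3) hom_eval_superset[of "keys p \<union> keys q"])
       (auto simp: lookup_add C_add algebra_simps sum.distrib)
qed

lemma hom_eval_single: "hom_eval C t (single m a) = C a * mon_eval t m"
  by (subst hom_eval_superset[of "{m}"]) auto

lemma hom_eval_0: "hom_eval C t 0 = 0"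
  by (simp add: hom_eval_def)

lemma hom_eval_1: "hom_eval C t 1 = 1"
  using hom_eval_single[of t 0 1] by (simp add: C_1)

lemma hom_eval_mult: "hom_eval C t (p * q) = hom_eval C t p * hom_eval C t q"
  by (rule multiplicative_if_on_singles)
     (auto simp: hom_eval_add hom_eval_single mult_single mon_eval_add C_mult algebra_simps)

lemma hom_eval_uminus: "hom_eval C t (- p) = - hom_eval C t p"
  using hom_eval_add[of t p "- p"] by (simp add: hom_eval_0 eq_neg_iff_add_eq_0 add.commute)

lemma hom_eval_diff: "hom_eval C t (p - q) = hom_eval C t p - hom_eval C t q"
  using hom_eval_add[of t p "- q"] by (simp add: hom_eval_uminus)

lemma hom_eval_sum: "hom_eval C t (sum f A) = (\<Sum>x\<in>A. hom_eval C t (f x))"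
  by (induction A rule: infinite_finite_induct) (auto simp: hom_eval_0 hom_eval_add)

lemma hom_eval_power: "hom_eval C t (p ^ n) = hom_eval C t p ^ n"
  by (induction n) (auto simp: hom_eval_1 hom_eval_mult)

lemma hom_eval_prod: "hom_eval C t (prod f A) = (\<Prod>x\<in>A. hom_eval C t (f x))"
  by (induction A rule: infinite_finite_induct) (auto simp: hom_eval_1 hom_eval_mult)

lemma hom_eval_var: "hom_eval C t (single (single v 1) 1) = t v"
  by (simp add: hom_eval_single C_1)

end

interpretation id_hom: coeff_hom "\<lambda>c :: 'k::comm_ring_1. c"
  by unfold_locales auto

interpretation const_hom: coeff_hom "single 0 :: 'k::comm_ring_1 \<Rightarrow> 'a::comm_monoid_add \<Rightarrow>\<^sub>0 'k"
  by unfold_locales (auto simp: single_add mult_single)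

lemmas eval_mpoly_simps =
  id_hom.hom_eval_add[folded eval_mpoly_eq_hom_eval]
  id_hom.hom_eval_mult[folded eval_mpoly_eq_hom_eval]
  id_hom.hom_eval_0[folded eval_mpoly_eq_hom_eval]
  id_hom.hom_eval_1[folded eval_mpoly_eq_hom_eval]
  id_hom.hom_eval_uminus[folded eval_mpoly_eq_hom_eval]
  id_hom.hom_eval_diff[folded eval_mpoly_eq_hom_eval]
  id_hom.hom_eval_sum[folded eval_mpoly_eq_hom_eval]
  id_hom.hom_eval_prod[folded eval_mpoly_eq_hom_eval]
  id_hom.hom_eval_power[folded eval_mpoly_eq_hom_eval]
  id_hom.hom_eval_single[folded eval_mpoly_eq_hom_eval]

section \<open>Polynomials in four variables\<close>

lemma UNIV_four: "(UNIV :: 4 set) = {0, 1, 2, 3}"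
proof -
  have "(4::4) = 0" by simp
  then show ?thesis using UNIV_4 by auto
qed

lemma exhaust_four: "(i::4) = 0 \<or> i = 1 \<or> i = 2 \<or> i = 3"
  using UNIV_four by blast

lemma all_four: "(\<forall>i::4. P i) \<longleftrightarrow> P 0 \<and> P 1 \<and> P 2 \<and> P 3"
  by (metis exhaust_four)

lemma sum_four: "(\<Sum>i\<in>(UNIV::4 set). f i) = f 0 + f 1 + f 2 + f 3"
  unfolding UNIV_four by (simp add: ac_simps)

lemma prod_four: "(\<Prod>i\<in>(UNIV::4 set). f i) = f 0 * f 1 * f 2 * f 3"
  unfolding UNIV_four by (simp add: ac_simps)

lemma mon_eqI:
  fixes m n :: "4 \<Rightarrow>\<^sub>0 'a::zero"
  assumes "lookup m 0 = lookup n 0" "lookup m 1 = lookup n 1" "lookup m 2 = lookup n 2"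
    "lookup m 3 = lookup n 3"
  shows "m = n"
proof (rule poly_mapping_eqI)
  fix k :: 4 show "lookup m k = lookup n k" using assms exhaust_four[of k] by auto
qed

definition mon :: "nat \<Rightarrow> nat \<Rightarrow> nat \<Rightarrow> nat \<Rightarrow> 4 \<Rightarrow>\<^sub>0 nat" where
  "mon i j k l = single 0 i + single 1 j + single 2 k + single 3 l"

lemma lookup_mon [simp]:
  "lookup (mon i j k l) 0 = i" "lookup (mon i j k l) 1 = j"
  "lookup (mon i j k l) 2 = k" "lookup (mon i j k l) 3 = l"
  by (simp_all add: mon_def lookup_add lookup_single when_def)

lemma mon_lookup: "mon (lookup m 0) (lookup m 1) (lookup m 2) (lookup m 3) = m"
  by (rule mon_eqI) simp_all

lemma mon_eq_iff: "mon i j k l = m \<longleftrightarrow>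
    i = lookup m 0 \<and> j = lookup m 1 \<and> k = lookup m 2 \<and> l = lookup m 3"
  using mon_lookup[of m] by (metis lookup_mon)

lemma eval_mpoly_four:
  "eval_mpoly (\<lambda>i. x $ i) p =
     (\<Sum>m\<in>keys p. lookup p m * (x$0 ^ lookup m 0 * x$1 ^ lookup m 1 * x$2 ^ lookup m 2 * x$3 ^ lookup m 3))"
  for p :: "'k::comm_ring_1 hpoly"
  by (simp add: eval_mpoly_eq_hom_eval hom_eval_def mon_eval_UNIV prod_four)

text \<open>Uniqueness of digits in base \<open>N\<close>; it keeps distinct monomials apart under
  the Kronecker substitution.\<close>

lemma base_expansion_inj:
  fixes N :: nat
  assumes "a0 < N" "a1 < N" "a2 < N" "b0 < N" "b1 < N" "b2 < N"
    and "a0 + N * (a1 + N * (a2 + N * a3)) = b0 + N * (b1 + N * (b2 + N * b3))"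
  shows "a0 = b0 \<and> a1 = b1 \<and> a2 = b2 \<and> a3 = b3"
proof -
  have step: "x = y \<and> u = v" if "x < N" "y < N" "x + N * u = y + N * v" for x y u v
  proof -
    have "x = (x + N * u) mod N" "y = (y + N * v) mod N" using that(1,2) by simp_all
    then have "x = y" using that(3) by simp
    then have "N * u = N * v" using that(3) by simp
    with \<open>x = y\<close> that(1) show ?thesis by simp
  qed
  show ?thesis using step assms by metis
qed

text \<open>The Kronecker substitution \<open>x\<^sub>i = c\<^bsup>N^i\<^esup>\<close> reduces this to polynomials in one variable.\<close>

lemma hpoly_eq_0_if_eval_0:
  fixes p :: "'k::field_char_0 hpoly"
  assumes "\<And>x :: 'k ^ 4. eval_mpoly (\<lambda>i. x $ i) p = 0"
  shows "p = 0"
proof -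
  obtain N where N: "\<And>m i. m \<in> keys p \<Longrightarrow> lookup m i < N"
  proof
    let ?S = "(\<lambda>(m, i). lookup m i) ` (keys p \<times> UNIV)"
    fix m i assume "m \<in> keys p"
    then have "lookup m i \<in> ?S" by force
    then have "lookup m i \<le> Max ?S" by (intro Max_ge) auto
    then show "lookup m i < Suc (Max ?S)" by simp
  qed
  define \<phi> where "\<phi> m = lookup m 0 + N * (lookup m 1 + N * (lookup m 2 + N * lookup m 3))"
    for m :: "4 \<Rightarrow>\<^sub>0 nat"
  have inj: "inj_on \<phi> (keys p)"
    by (rule inj_onI, rule mon_eqI)
       (use base_expansion_inj N in \<open>unfold \<phi>_def; metis\<close>)+
  define q where "q = (\<Sum>m\<in>keys p. Polynomial.monom (lookup p m) (\<phi> m))"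
  have "poly q c = 0" for c
  proof -
    define x :: "'k ^ 4" where
      "x = (\<chi> i. if i = 0 then c else if i = 1 then c ^ N else if i = 2 then c ^ (N*N) else c ^ (N*N*N))"
    have "poly q c = (\<Sum>m\<in>keys p. lookup p m * c ^ \<phi> m)"
      by (simp add: q_def poly_sum poly_monom)
    also have "\<dots> = eval_mpoly (\<lambda>i. x $ i) p"
      unfolding eval_mpoly_four
      by (rule sum.cong)
         (simp_all add: x_def \<phi>_def algebra_simps power_add flip: power_mult)
    finally show ?thesis using assms by simp
  qed
  then have "q = 0" using poly_all_0_iff_0 by blast
  have "lookup p m = 0" for m
  proof (rule ccontr)
    assume "lookup p m \<noteq> 0"
    then have m: "m \<in> keys p" by (simp add: in_keys_iff)
    have "Polynomial.coeff q (\<phi> m) = (\<Sum>n\<in>keys p. if n = m then lookup p n else 0)"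
      unfolding q_def Polynomial.coeff_sum Polynomial.coeff_monom
      by (rule sum.cong) (use inj m in \<open>auto simp: inj_on_def\<close>)
    also have "\<dots> = lookup p m" using m by simp
    finally show False using \<open>q = 0\<close> \<open>lookup p m \<noteq> 0\<close> by simp
  qed
  then show ?thesis by (intro poly_mapping_eqI) simp
qed

lemma hpoly_eqI_eval:
  fixes p q :: "'k::field_char_0 hpoly"
  assumes "\<And>x :: 'k ^ 4. eval_mpoly (\<lambda>i. x $ i) p = eval_mpoly (\<lambda>i. x $ i) q"
  shows "p = q"
  using hpoly_eq_0_if_eval_0[of "p - q"] assms by (simp add: eval_mpoly_simps)

definition var :: "4 \<Rightarrow> 'k::comm_ring_1 hpoly" where
  "var i = single (single i 1) 1"

definition lin :: "'k ^ 4 \<Rightarrow> 'k::comm_ring_1 hpoly" where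
  "lin r = (\<Sum>j\<in>UNIV. single 0 (r $ j) * var j)"

lemma eval_var [simp]: "eval_mpoly t (var i) = t i"
  by (simp add: var_def eval_mpoly_simps)

lemma eval_const [simp]: "eval_mpoly t (single 0 c) = c"
  by (simp add: eval_mpoly_simps)

lemma eval_lin: "eval_mpoly t (lin r) = (\<Sum>j\<in>UNIV. r $ j * t j)"
  by (simp add: lin_def eval_mpoly_simps var_def)

lemma var_power: "var i ^ n = single (single i n) 1"
  by (induction n) (auto simp: var_def mult_single simp flip: single_add)

lemma single_mon: "single m c =
    single 0 c * var 0 ^ lookup m 0 * var 1 ^ lookup m 1 * var 2 ^ lookup m 2 * var 3 ^ lookup m 3"
  using mon_lookup[of m] by (simp add: var_power mult_single mon_def ac_simps)

definition homog :: "nat \<Rightarrow> 'k::zero hpoly \<Rightarrow> bool" where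
  "homog d p \<longleftrightarrow> (\<forall>m\<in>keys p. (\<Sum>i\<in>UNIV. lookup m i) = d)"

lemma homog_0 [simp]: "homog d 0"
  by (simp add: homog_def)

lemma homog_add: "homog d p \<Longrightarrow> homog d q \<Longrightarrow> homog d (p + q)"
  using keys_add[of p q] by (auto simp: homog_def)

lemma homog_uminus: "homog d p \<Longrightarrow> homog d (- p)" for p :: "'k::ab_group_add hpoly"
  by (auto simp: homog_def in_keys_iff)

lemma homog_diff: "homog d p \<Longrightarrow> homog d q \<Longrightarrow> homog d (p - q)" for p :: "'k::ab_group_add hpoly"
  using homog_add[of d p "- q"] by (auto simp: homog_uminus)

lemma homog_sum: "(\<And>x. x \<in> A \<Longrightarrow> homog d (f x)) \<Longrightarrow> homog d (sum f A)"
  for f :: "'a \<Rightarrow> 'k::comm_monoid_add hpoly"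
  by (induction A rule: infinite_finite_induct) (auto simp: homog_add)

lemma homog_mult: "homog d p \<Longrightarrow> homog e q \<Longrightarrow> homog (d + e) (p * q)"
  for p q :: "'k::comm_ring_1 hpoly"
  using keys_mult[of p q] by (fastforce simp: homog_def lookup_add sum.distrib)

lemma homog_const [simp]: "homog 0 (single 0 c)"
  by (auto simp: homog_def)

lemma homog_1 [simp]: "homog 0 (1 :: 'k::comm_ring_1 hpoly)"
  by (auto simp: homog_def)

lemma homog_power: "homog d p \<Longrightarrow> homog (n * d) (p ^ n)" for p :: "'k::comm_ring_1 hpoly"
  by (induction n) (auto intro: homog_mult)

lemma homog_prod:
  "(\<And>x. x \<in> A \<Longrightarrow> homog (d x) (f x)) \<Longrightarrow> homog (sum d A) (prod f A)"
  for f :: "'a \<Rightarrow> 'k::comm_ring_1 hpoly"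
  by (induction A rule: infinite_finite_induct) (auto intro: homog_mult)

lemma homog_scale: "homog d p \<Longrightarrow> homog d (single 0 c * p)" for p :: "'k::comm_ring_1 hpoly"
  using homog_mult[of 0 "single 0 c" d p] by simp

lemma homog_var: "homog 1 (var i :: 'k::comm_ring_1 hpoly)"
  by (auto simp: homog_def var_def lookup_single when_def)

lemma homog_lin: "homog 1 (lin r :: 'k::comm_ring_1 hpoly)"
  unfolding lin_def by (intro homog_sum homog_scale homog_var)

section \<open>Linear substitutions\<close>

text \<open>Row \<open>i\<close> of \<open>A\<close> is the linear form that replaces x_i, so this
  is the pull-back of functions along the map x to \<open>A *v x\<close>. Conditions on the image of
  \<open>V\<close> under \<open>A\<close> become conditions on \<open>V\<close>.\<close>

definition subst :: "'k ^ 4 ^ 4 \<Rightarrow> 'k::comm_ring_1 hpoly \<Rightarrow> 'k hpoly" where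
  "subst A = hom_eval (single 0) (\<lambda>i. lin (A $ i))"

lemma subst_simps:
  "subst A (p + q) = subst A p + subst A q"
  "subst A (p * q) = subst A p * subst A q"
  "subst A 0 = 0" "subst A 1 = 1" "subst A (- p) = - subst A p"
  "subst A (p - q) = subst A p - subst A q"
  "subst A (sum f X) = (\<Sum>x\<in>X. subst A (f x))"
  "subst A (p ^ n) = subst A p ^ n"
  unfolding subst_def
  by (rule const_hom.hom_eval_add const_hom.hom_eval_mult const_hom.hom_eval_0 const_hom.hom_eval_1
      const_hom.hom_eval_uminus const_hom.hom_eval_diff const_hom.hom_eval_sum const_hom.hom_eval_power)+

lemma subst_single: "subst A (single m c) = single 0 c * mon_eval (\<lambda>i. lin (A $ i)) m"
  unfolding subst_def by (rule const_hom.hom_eval_single)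

lemma subst_const [simp]: "subst A (single 0 c) = single 0 c"
  by (simp add: subst_single)

lemma subst_var: "subst A (var i) = lin (A $ i)"
  unfolding subst_def var_def by (rule const_hom.hom_eval_var)

lemma eval_subst:
  fixes A :: "'k::comm_ring_1 ^ 4 ^ 4"
  shows "eval_mpoly (\<lambda>i. x $ i) (subst A p) = eval_mpoly (\<lambda>i. (A *v x) $ i) p"
proof -
  have "eval_mpoly (vec_nth x) (mon_eval (\<lambda>i. lin (A $ i)) m) = mon_eval (\<lambda>i. (A *v x) $ i) m" for m
    by (simp add: mon_eval_UNIV eval_mpoly_simps eval_lin matrix_vector_mult_def)
  then show ?thesis
    by (simp add: subst_def hom_eval_def eval_mpoly_simps(1-9))
       (simp add: eval_mpoly_eq_hom_eval hom_eval_def)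
qed

text \<open>In characteristic 0 a polynomial is determined by its values, so this is associativity
  of the matrix action; pull-back reverses the order of the factors.\<close>

lemma subst_subst:
  fixes A B :: "'k::field_char_0 ^ 4 ^ 4"
  shows "subst A (subst B p) = subst (B ** A) p"
  by (rule hpoly_eqI_eval) (simp add: eval_subst matrix_vector_mul_assoc)

lemma subst_mat_1 [simp]: "subst (mat 1) p = p" for p :: "'k::field_char_0 hpoly"
  by (rule hpoly_eqI_eval) (simp add: eval_subst)

lemma homog_subst:
  fixes p :: "'k::comm_ring_1 hpoly"
  assumes "homog d p"
  shows "homog d (subst A p)"
  unfolding subst_def hom_eval_def
proof (intro homog_sum homog_scale)
  fix m assume m: "m \<in> keys p"
  have "homog (\<Sum>i\<in>UNIV. lookup m i * 1) (mon_eval (\<lambda>i. lin (A $ i)) m)"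
    unfolding mon_eval_UNIV by (intro homog_prod homog_power homog_lin)
  then show "homog d (mon_eval (\<lambda>i. lin (A $ i)) m)"
    using m assms by (simp add: homog_def)
qed

lemma homog_subst_iff:
  fixes p :: "'k::field_char_0 hpoly"
  assumes "A ** B = mat 1" "B ** A = mat 1"
  shows "homog d (subst A p) \<longleftrightarrow> homog d p"
  using homog_subst[of d "subst A p" B] homog_subst[of d p A] assms by (auto simp: subst_subst)

lemma single_mult_sum:
  fixes f :: "'a::comm_monoid_add \<Rightarrow>\<^sub>0 'k::comm_ring_1"
  shows "single a c * f = (\<Sum>m\<in>keys f. single (a + m) (c * lookup f m))"
  by (subst poly_mapping_sum_single[of "keys f" f]) (simp_all add: sum_distrib_left mult_single)

lemma lookup_single_mult:
  fixes f :: "'a::cancel_comm_monoid_add \<Rightarrow>\<^sub>0 'k::comm_ring_1"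
  shows "lookup (single a c * f) (a + k) = c * lookup f k"
proof -
  have "lookup (single a c * f) (a + k) = (\<Sum>m\<in>keys f. if m = k then c * lookup f m else 0)"
    unfolding single_mult_sum lookup_sum
    by (rule sum.cong) (auto simp: lookup_single when_def)
  also have "\<dots> = c * lookup f k" by (auto simp: in_keys_iff)
  finally show ?thesis .
qed

lemma keys_single_mult:
  fixes f :: "'a::cancel_comm_monoid_add \<Rightarrow>\<^sub>0 'k::comm_ring_1"
  shows "keys (single a 1 * f) = (+) a ` keys f"
proof
  show "keys (single a 1 * f) \<subseteq> (+) a ` keys f"
    using keys_mult[of "single a 1" f] by auto
  show "(+) a ` keys f \<subseteq> keys (single a 1 * f)"
    by (auto simp: in_keys_iff lookup_single_mult)
qed

lemma lookup_const_mult: "lookup (single 0 c * f) k = c * lookup f k"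
  for f :: "'a::cancel_comm_monoid_add \<Rightarrow>\<^sub>0 'k::comm_ring_1"
  using lookup_single_mult[of 0 c f k] by simp

section \<open>Ideals of lines and their squares\<close>

interpretation self: module "(*) :: 'r::comm_ring_1 \<Rightarrow> 'r \<Rightarrow> 'r"
  by unfold_locales (auto simp: algebra_simps)

abbreviation is_ideal :: "'r::comm_ring_1 set \<Rightarrow> bool" where
  "is_ideal \<equiv> self.subspace"

lemma ideal_mult_left: "is_ideal I \<Longrightarrow> p \<in> I \<Longrightarrow> q * p \<in> I"
  by (rule self.subspace_scale)

lemma ideal_mult_right: "is_ideal I \<Longrightarrow> p \<in> I \<Longrightarrow> p * q \<in> I"
  using ideal_mult_left[of I p q] by (simp add: mult.commute)

definition sq :: "('k::field ^ 4) set \<Rightarrow> 'k hpoly set" where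
  "sq V = ideal_mult (vanishing_ideal V) (vanishing_ideal V)"

lemma is_ideal_vanishing: "is_ideal (vanishing_ideal V)"
  by (auto simp: self.subspace_def vanishing_ideal_def eval_mpoly_simps)

lemma is_ideal_sq: "is_ideal (sq V)"
  unfolding sq_def ideal_mult_def by (rule self.subspace_span)

lemma mult_in_sq: "p \<in> vanishing_ideal V \<Longrightarrow> q \<in> vanishing_ideal V \<Longrightarrow> p * q \<in> sq V"
  unfolding sq_def ideal_mult_def by (rule self.span_base) auto

lemma sq_induct:
  assumes "p \<in> sq V" "is_ideal I"
    and "\<And>p q. p \<in> vanishing_ideal V \<Longrightarrow> q \<in> vanishing_ideal V \<Longrightarrow> p * q \<in> I"
  shows "p \<in> I"
proof -
  have "sq V \<subseteq> I"
    unfolding sq_def ideal_mult_def by (rule self.span_minimal) (use assms in auto)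
  then show ?thesis using assms by auto
qed

lemma sq_subset_vanishing: "sq V \<subseteq> vanishing_ideal V"
proof
  fix p assume "p \<in> sq V"
  then show "p \<in> vanishing_ideal V"
    by (rule sq_induct) (auto intro: is_ideal_vanishing ideal_mult_left)
qed

lemma subst_in_vanishing_iff:
  "subst A p \<in> vanishing_ideal V \<longleftrightarrow> p \<in> vanishing_ideal ((*v) A ` V)"
  by (simp add: vanishing_ideal_def eval_subst)

lemma subst_in_sq: "p \<in> sq ((*v) A ` V) \<Longrightarrow> subst A p \<in> sq V"
proof -
  assume p: "p \<in> sq ((*v) A ` V)"
  have "p \<in> {p. subst A p \<in> sq V}"
    by (rule sq_induct[OF p])
       (use is_ideal_sq[of V] in \<open>auto simp: self.subspace_def subst_simps subst_in_vanishing_iff intro!: mult_in_sq\<close>)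
  then show ?thesis by simp
qed

lemma subst_in_sq_iff:
  fixes A B :: "'k::field_char_0 ^ 4 ^ 4"
  assumes "A ** B = mat 1" "B ** A = mat 1"
  shows "subst A p \<in> sq V \<longleftrightarrow> p \<in> sq ((*v) A ` V)"
proof
  assume "subst A p \<in> sq V"
  moreover have "V = (*v) B ` (*v) A ` V"
    using assms by (simp add: image_image matrix_vector_mul_assoc)
  ultimately have "subst B (subst A p) \<in> sq ((*v) A ` V)"
    using subst_in_sq[of "subst A p" B "(*v) A ` V"] by simp
  then show "p \<in> sq ((*v) A ` V)" using assms by (simp add: subst_subst)
qed (rule subst_in_sq)

text \<open>The \<open>k\<close>-th power of the ideal \<open>(x\<^sub>2, x\<^sub>3)\<close>.\<close>

definition ord23 :: "nat \<Rightarrow> 'k::comm_ring_1 hpoly set" where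
  "ord23 k = {p. \<forall>m\<in>keys p. k \<le> lookup m 2 + lookup m 3}"

definition std_line :: "('k::field ^ 4) set" where
  "std_line = {x. x $ 2 = 0 \<and> x $ 3 = 0}"

lemma is_ideal_ord23: "is_ideal (ord23 k)"
  unfolding self.subspace_def
proof (intro conjI ballI allI)
  show "0 \<in> ord23 k" by (simp add: ord23_def)
next
  fix p q :: "'a hpoly" assume "p \<in> ord23 k" "q \<in> ord23 k"
  then show "p + q \<in> ord23 k" using keys_add[of p q] by (auto simp: ord23_def)
next
  fix p q :: "'a hpoly" assume "q \<in> ord23 k"
  then show "p * q \<in> ord23 k" using keys_mult[of p q]
    by (fastforce simp: ord23_def lookup_add)
qed

lemma ord23_mult: "p \<in> ord23 1 \<Longrightarrow> q \<in> ord23 1 \<Longrightarrow> p * q \<in> ord23 2"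
  using keys_mult[of p q] by (fastforce simp: ord23_def lookup_add)

text \<open>The part \<open>p0\<close> of \<open>p\<close> that is free of x_2 and x_3 has at every
  point the value of \<open>p\<close> at the projection of that point to the line, so it vanishes
  identically.\<close>

lemma vanishing_std_line: "vanishing_ideal std_line = (ord23 1 :: 'k::field_char_0 hpoly set)"
proof (intro set_eqI iffI)
  fix p :: "'k hpoly" assume p: "p \<in> vanishing_ideal std_line"
  define p0 where "p0 = (\<Sum>m\<in>{m\<in>keys p. lookup m 2 + lookup m 3 = 0}. single m (lookup p m))"
  have lk: "lookup p0 n = (if lookup n 2 + lookup n 3 = 0 then lookup p n else 0)" for n
  proof -
    have "lookup p0 n = (\<Sum>m\<in>{m\<in>keys p. lookup m 2 + lookup m 3 = 0}. if m = n then lookup p m else 0)"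
      unfolding p0_def lookup_sum by (rule sum.cong) (auto simp: lookup_single when_def)
    then show ?thesis by (auto simp: in_keys_iff)
  qed
  have "p0 = 0"
  proof (rule hpoly_eq_0_if_eval_0)
    fix x :: "'k ^ 4"
    define y :: "'k ^ 4" where "y = (\<chi> i. if i = 2 \<or> i = 3 then 0 else x $ i)"
    have sub: "keys p0 \<subseteq> keys p" by (auto simp: in_keys_iff lk split: if_splits)
    have "eval_mpoly (\<lambda>i. x $ i) p0 = (\<Sum>m\<in>keys p0. lookup p m *
        (y$0 ^ lookup m 0 * y$1 ^ lookup m 1 * y$2 ^ lookup m 2 * y$3 ^ lookup m 3))"
      unfolding eval_mpoly_four
      by (rule sum.cong) (auto simp: in_keys_iff lk y_def split: if_splits)
    also have "\<dots> = eval_mpoly (\<lambda>i. y $ i) p"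
      unfolding eval_mpoly_four
      by (rule sum.mono_neutral_left) (use sub in \<open>auto simp: in_keys_iff lk y_def split: if_splits\<close>)
    also have "y \<in> std_line" by (simp add: std_line_def y_def)
    then have "eval_mpoly (\<lambda>i. y $ i) p = 0" using p by (simp add: vanishing_ideal_def)
    finally show "eval_mpoly (\<lambda>i. x $ i) p0 = 0" .
  qed
  show "p \<in> ord23 1"
    unfolding ord23_def
  proof (clarsimp)
    fix m assume "m \<in> keys p"
    moreover have "lookup p0 m = 0" using \<open>p0 = 0\<close> by simp
    ultimately show "Suc 0 \<le> lookup m 2 + lookup m 3"
      by (auto simp: lk in_keys_iff split: if_splits)
  qed
next
  fix p :: "'k hpoly" assume p: "p \<in> ord23 1"
  show "p \<in> vanishing_ideal std_line"
    unfolding vanishing_ideal_def eval_mpoly_four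
    by (use p in \<open>fastforce simp: std_line_def ord23_def power_0_left intro!: sum.neutral\<close>)
qed

text \<open>A monomial of degree at least two in x_2, x_3 is one of these variables times a monomial
  of degree at least one in them, hence a product of two members of the ideal of the line.\<close>

lemma sq_std_line: "sq std_line = (ord23 2 :: 'k::field_char_0 hpoly set)"
proof (intro set_eqI iffI)
  fix p :: "'k hpoly" assume "p \<in> sq std_line"
  then show "p \<in> ord23 2"
    by (rule sq_induct[OF _ is_ideal_ord23]) (auto simp: vanishing_std_line intro: ord23_mult)
next
  fix p :: "'k hpoly" assume p: "p \<in> ord23 2"
  have "single m c \<in> sq std_line" if "2 \<le> lookup m 2 + lookup m 3" for m and c :: 'k
  proof -
    have key: "single m c \<in> sq std_line" if i: "i \<in> {2, 3}" "m = single i 1 + n"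
      "1 \<le> lookup n 2 + lookup n 3" for i n
    proof -
      have "single m c = single (single i 1) 1 * single n c" using i by (simp add: mult_single)
      also have "\<dots> \<in> sq std_line"
        by (rule mult_in_sq)
           (use i in \<open>auto simp: vanishing_std_line ord23_def lookup_single when_def\<close>)
      finally show ?thesis .
    qed
    show ?thesis
    proof (cases "lookup m 2 = 0")
      case False
      show ?thesis
        by (rule key[of 2 "mon (lookup m 0) (lookup m 1) (lookup m 2 - 1) (lookup m 3)"])
           (use False that in \<open>auto intro!: mon_eqI simp: lookup_add lookup_single when_def\<close>)
    next
      case True
      show ?thesis
        by (rule key[of 3 "mon (lookup m 0) (lookup m 1) (lookup m 2) (lookup m 3 - 1)"])
           (use True that in \<open>auto intro!: mon_eqI simp: lookup_add lookup_single when_def\<close>)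
    qed
  qed
  then have "(\<Sum>m\<in>keys p. single m (lookup p m)) \<in> sq std_line"
    using p by (intro self.subspace_sum[OF is_ideal_sq]) (auto simp: ord23_def)
  then show "p \<in> sq std_line"
    using poly_mapping_sum_single[of "keys p" p] by simp
qed

lemma var_power_mult_ord23:
  assumes "i \<noteq> 2" "i \<noteq> 3"
  shows "var i ^ n * p \<in> ord23 k \<longleftrightarrow> p \<in> ord23 k"
  using assms by (auto simp: ord23_def var_power keys_single_mult lookup_add lookup_single when_def)

text \<open>Modulo \<open>ord23 2\<close> every polynomial has a normal form without monomials of degree at least
  two in \<open>x\<^sub>2, x\<^sub>3\<close>; on normal forms, gluing sections over \<open>x\<^sub>0 \<noteq> 0\<close> and \<open>x\<^sub>1 \<noteq> 0\<close>
  is monomial bookkeeping.\<close>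

lemma ord23_glue:
  fixes p q :: "'k::comm_ring_1 hpoly"
  assumes "homog (d + n) p" and pq: "var 1 ^ n * p - var 0 ^ n * q \<in> ord23 2"
  obtains g where "homog d g" "p - var 0 ^ n * g \<in> ord23 2"
proof -
  define S where "S = {m. single 0 n + m \<in> keys p}"
  have inj: "inj ((+) (single 0 n :: 4 \<Rightarrow>\<^sub>0 nat))" by (auto intro: injI)
  have "finite S"
    unfolding S_def using finite_vimageI[OF finite_keys inj, of p] by (simp add: vimage_def)
  \<comment> \<open>The monomials of \<open>p\<close> divisible by \<open>x\<^sub>0\<^sup>n\<close>,
    divided by it; all others are dropped.\<close>
  define g where "g = (\<Sum>m\<in>S. single m (lookup p (single 0 n + m)))"
  have lk: "lookup g k = lookup p (single 0 n + k)" for k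
  proof -
    have "lookup g k = (\<Sum>m\<in>S. if m = k then lookup p (single 0 n + m) else 0)"
      unfolding g_def lookup_sum by (rule sum.cong) (auto simp: lookup_single when_def)
    then show ?thesis using \<open>finite S\<close> by (auto simp: in_keys_iff S_def)
  qed
  show ?thesis
  proof (rule that[of g])
    show "homog d g"
    proof (unfold homog_def, rule ballI)
      fix m assume "m \<in> keys g"
      then have "single 0 n + m \<in> keys p" by (simp add: in_keys_iff lk)
      then have "(\<Sum>i\<in>UNIV. lookup (single 0 n + m) i) = d + n"
        using assms(1) by (simp add: homog_def)
      then show "(\<Sum>i\<in>UNIV. lookup m i) = d"
        by (simp add: sum_four lookup_add lookup_single when_def)
    qed
    show "p - var 0 ^ n * g \<in> ord23 2"
    proof (unfold ord23_def, clarify)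
      fix m assume m: "m \<in> keys (p - var 0 ^ n * g)"
      show "2 \<le> lookup m 2 + lookup m 3"
      proof (rule ccontr)
        assume small: "\<not> 2 \<le> lookup m 2 + lookup m 3"
        show False
        proof (cases "n \<le> lookup m 0")
          case True
          define k where "k = mon (lookup m 0 - n) (lookup m 1) (lookup m 2) (lookup m 3)"
          have mk: "m = single 0 n + k"
            by (rule mon_eqI) (use True in \<open>auto simp: k_def lookup_add lookup_single when_def\<close>)
          have "lookup (p - var 0 ^ n * g) m = 0"
            unfolding mk lookup_minus var_power lookup_single_mult by (simp add: lk)
          then show False using m by (simp add: in_keys_iff)
        next
          \<comment> \<open>If \<open>m\<close> is not divisible by
            \<open>x\<^sub>0\<^sup>n\<close>, then neither is \<open>single 1 n + m\<close>, so
            \<open>var 0 ^ n * q\<close> cannot cancel that term of \<open>var 1 ^ n * p\<close>.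
            Its degree in x_2, x_3 is at most one, so the hypothesis forces the coefficient of
            \<open>m\<close> in \<open>p\<close> to vanish.\<close>
          case False
          have z: "lookup (single (single 0 n) 1 * h) (a + m) = 0" if "lookup a 0 = 0"
            for h :: "'k hpoly" and a
          proof -
            have "a + m \<notin> keys (single (single 0 n) 1 * h)"
            proof
              assume "a + m \<in> keys (single (single 0 n) 1 * h)"
              then obtain k where "a + m = single 0 n + k" by (auto simp: keys_single_mult)
              then have "lookup (a + m) 0 = lookup (single 0 n + k) 0" by simp
              then show False using False that by (simp add: lookup_add)
            qed
            then show ?thesis by (simp add: in_keys_iff)
          qed
          have "single 1 n + m \<notin> keys (var 1 ^ n * p - var 0 ^ n * q)"
            using pq small by (force simp: ord23_def lookup_add lookup_single when_def)
          then have "lookup p m = 0"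
            by (simp add: in_keys_iff lookup_minus var_power lookup_single_mult z lookup_single)
          then show False using m z[of 0 g]
            by (simp add: in_keys_iff lookup_minus var_power)
        qed
      qed
    qed
  qed
qed

section \<open>Coordinates adapted to lines\<close>

definition frame :: "'k ^ 4 \<Rightarrow> 'k ^ 4 \<Rightarrow> 'k ^ 4 \<Rightarrow> 'k ^ 4 \<Rightarrow> 'k::field ^ 4 ^ 4" where
  "frame a b c d = (\<chi> i j. if j = 0 then a $ i else if j = 1 then b $ i else if j = 2 then c $ i else d $ i)"

lemma frame_mult:
  "frame a b c d *v x = x $ 0 *s a + x $ 1 *s b + x $ 2 *s c + x $ 3 *s d"
  by (simp add: vec_eq_iff frame_def matrix_vector_mult_def sum_four mult.commute)

definition vec4 :: "'k \<Rightarrow> 'k \<Rightarrow> 'k \<Rightarrow> 'k \<Rightarrow> 'k::field ^ 4" where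
  "vec4 a b c d = (\<chi> j. if j = 0 then a else if j = 1 then b else if j = 2 then c else d)"

lemma vec4_nth [simp]:
  "vec4 a b c d $ 0 = a" "vec4 a b c d $ 1 = b" "vec4 a b c d $ 2 = c" "vec4 a b c d $ 3 = d"
  by (simp_all add: vec4_def)

lemma vec_eq_four: "x = y \<longleftrightarrow> x $ 0 = y $ 0 \<and> x $ 1 = y $ 1 \<and> x $ 2 = y $ 2 \<and> x $ 3 = y $ 3"
  for x y :: "'k ^ 4"
  by (simp add: vec_eq_iff all_four)

lemma frame_invertible:
  assumes "\<And>x0 x1 x2 x3. x0 *s a + x1 *s b + x2 *s c + x3 *s d = 0 \<Longrightarrow> x0 = 0 \<and> x1 = 0 \<and> x2 = 0 \<and> x3 = 0"
  obtains B where "frame a b c d ** B = mat 1" "B ** frame a b c d = mat 1"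
proof -
  have "\<forall>x. frame a b c d *v x = 0 \<longrightarrow> x = 0"
  proof (intro allI impI)
    fix x assume "frame a b c d *v x = 0"
    then show "x = 0"
      using assms[of "x $ 0" "x $ 1" "x $ 2" "x $ 3"] by (simp add: frame_mult vec_eq_four[of x])
  qed
  then show ?thesis
    using matrix_left_invertible_ker[of "frame a b c d"] matrix_left_right_inverse that by metis
qed

lemma span_pair: "vec.span {v, w} = {s *s v + t *s w |s t. True}" for v w :: "'k::field ^ 'n"
proof (intro set_eqI)
  fix x
  have "x \<in> vec.span {v, w} \<longleftrightarrow> (\<exists>s. x - s *s v \<in> vec.span {w})"
    by (rule vec.span_breakdown_eq)
  also have "\<dots> \<longleftrightarrow> (\<exists>s t. x - s *s v = t *s w)"
    by (auto simp: vec.span_singleton)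
  finally show "x \<in> vec.span {v, w} \<longleftrightarrow> x \<in> {s *s v + t *s w |s t. True}"
    by (auto simp: algebra_simps)
qed

definition indep2 :: "'k::field ^ 4 \<Rightarrow> 'k ^ 4 \<Rightarrow> bool" where
  "indep2 v w \<longleftrightarrow> (\<forall>s t. s *s v + t *s w = 0 \<longrightarrow> s = 0 \<and> t = 0)"

lemma indep2_iff: "indep2 v w \<longleftrightarrow> v \<noteq> w \<and> vec.independent {v, w}"
proof
  assume i: "indep2 v w"
  have "v \<noteq> w"
  proof
    assume "v = w"
    then have "1 *s v + (- 1) *s w = 0" by simp
    then show False using i unfolding indep2_def by (metis zero_neq_one)
  qed
  moreover have "w \<noteq> 0"
  proof
    assume "w = 0"
    then have "0 *s v + 1 *s w = 0" by simp
    then show False using i unfolding indep2_def by (metis zero_neq_one)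
  qed
  moreover have "v \<notin> vec.span {w}"
  proof
    assume "v \<in> vec.span {w}"
    then obtain t where "v = t *s w" by (auto simp: vec.span_singleton)
    then have "1 *s v + (- t) *s w = 0" by simp
    then show False using i unfolding indep2_def by (metis zero_neq_one)
  qed
  ultimately show "v \<noteq> w \<and> vec.independent {v, w}"
    by (simp add: vec.independent_insert)
next
  assume a: "v \<noteq> w \<and> vec.independent {v, w}"
  then have n: "v \<notin> vec.span {w}" "w \<noteq> 0" by (auto simp: vec.independent_insert)
  show "indep2 v w"
    unfolding indep2_def
  proof (intro allI impI)
    fix s t assume e: "s *s v + t *s w = 0"
    have "s = 0"
    proof (rule ccontr)
      assume "s \<noteq> 0"
      have "s *s v = (- t) *s w" using e by (simp add: eq_neg_iff_add_eq_0)
      then have "inverse s *s (s *s v) = inverse s *s ((- t) *s w)" by simp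
      then have "v = (inverse s * (- t)) *s w" using \<open>s \<noteq> 0\<close> by simp
      then have "v \<in> range (\<lambda>k. k *s w)" by (rule range_eqI)
      then show False using n by (simp add: vec.span_singleton)
    qed
    with e n show "s = 0 \<and> t = 0" by simp
  qed
qed

lemma is_line_span_pair: "is_line (vec.span {v, w}) \<longleftrightarrow> indep2 v w"
proof
  assume "indep2 v w"
  then show "is_line (vec.span {v, w})"
    unfolding is_line_def indep2_iff using vec.dim_eq_card_independent[of "{v, w}"]
    by (simp add: vec.dim_eq_card_independent)
next
  assume "is_line (vec.span {v, w})"
  then have d: "vec.dim {v, w} = 2" by (simp add: is_line_def)
  have "v \<noteq> w"
  proof
    assume "v = w"
    then show False using d vec.dim_le_card[of "{v, w}" "{v}"] by (simp add: vec.span_base)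
  qed
  then show "indep2 v w"
    unfolding indep2_iff using d vec.card_le_dim_spanning[of "{v,w}" "vec.span {v, w}"]
    by (simp add: vec.span_superset)
qed

lemma is_lineE:
  assumes "is_line V"
  obtains v w where "V = vec.span {v, w}" "indep2 v w"
proof -
  obtain B where B: "B \<subseteq> V" "vec.independent B" "V \<subseteq> vec.span B" "card B = vec.dim V"
    using vec.basis_exists by blast
  then have "card B = 2" using assms by (simp add: is_line_def)
  then obtain v w where vw: "B = {v, w}" "v \<noteq> w" by (meson card_2_iff)
  have "vec.span B = V"
    using B assms vec.span_minimal[of B V] by (auto simp: is_line_def)
  then show ?thesis using that[of v w] B vw by (simp add: indep2_iff)
qed

lemma frame_image_std_line: "(*v) (frame a b c d) ` std_line = vec.span {a, b}"
proof -
  have "s *s a + t *s b = frame a b c d *v vec4 s t 0 0" for s t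
    by (simp add: frame_mult)
  then show ?thesis
    unfolding span_pair by (fastforce simp: std_line_def frame_mult)
qed

text \<open>If all 2x2 minors vanish, the vectors satisfy the relation with coefficients
  \<open>w $ a\<close> and \<open>- v $ a\<close>, which is nontrivial when \<open>v $ a\<close> is
  nonzero.\<close>

lemma independent_minor:
  fixes v w :: "'k::field ^ 4"
  assumes "indep2 v w"
  obtains a b where "v $ a * w $ b - v $ b * w $ a \<noteq> 0"
proof (rule ccontr)
  assume "\<not> thesis"
  then have z: "v $ a * w $ b - v $ b * w $ a = 0" for a b using that by blast
  have "v \<noteq> 0"
  proof
    assume "v = 0"
    then have "1 *s v + 0 *s w = 0" by simp
    then show False using assms unfolding indep2_def by (metis zero_neq_one)
  qed
  then obtain a where a: "v $ a \<noteq> 0" by (auto simp: vec_eq_iff)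
  have "(w $ a) *s v + (- v $ a) *s w = 0"
    using z[of a] by (simp add: vec_eq_iff algebra_simps)
  then show False using assms a unfolding indep2_def by fastforce
qed

lemma complementary_indices:
  fixes a b :: 4 assumes "a \<noteq> b"
  obtains c d where "c \<noteq> d" "a \<noteq> c" "a \<noteq> d" "b \<noteq> c" "b \<noteq> d" "UNIV = {a, b, c, d}"
proof -
  have "card (UNIV - {a, b}) = 2" using assms by (simp add: card_Diff_subset)
  then obtain c d where "UNIV - {a, b} = {c, d}" "c \<noteq> d" by (meson card_2_iff)
  then show ?thesis by (intro that[of c d]) auto
qed

text \<open>A reduced basis of the line with respect to a nonzero Pluecker minor in the coordinates
  \<open>a\<close>, \<open>b\<close>, completed by unit vectors. In these coordinates x_a and x_b
  become x_0 and x_1, so the two charts of the fixed cover where they are nonzero already cover the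
  line.\<close>

lemma pivot_frame:
  assumes "is_line V"
  obtains A B a b where "A ** B = mat 1" "B ** A = mat 1" "V = (*v) A ` std_line" "a \<noteq> b"
    "subst A (var a) = var 0" "subst A (var b) = var 1"
proof -
  obtain v w where V: "V = vec.span {v, w}" and vw: "indep2 v w" using is_lineE[OF assms] .
  obtain a b where D: "v $ a * w $ b - v $ b * w $ a \<noteq> 0" using independent_minor[OF vw] .
  define D where "D = v $ a * w $ b - v $ b * w $ a"
  have [simp]: "D \<noteq> 0" using D by (simp add: D_def)
  have "a \<noteq> b" using D by auto
  obtain c d where cd: "c \<noteq> d" "a \<noteq> c" "a \<noteq> d" "b \<noteq> c" "b \<noteq> d" "UNIV = {a, b, c, d}"
    using complementary_indices[OF \<open>a \<noteq> b\<close>] .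
  \<comment> \<open>Cramer's rule: the 2x2 block of \<open>v\<close>, \<open>w\<close> in the
    coordinates \<open>a\<close>, \<open>b\<close> is inverted.\<close>
  define v' where "v' = (w $ b / D) *s v + (- v $ b / D) *s w"
  define w' where "w' = (- w $ a / D) *s v + (v $ a / D) *s w"
  have piv: "v' $ a = 1" "v' $ b = 0" "w' $ a = 0" "w' $ b = 1"
  proof -
    have "v' $ a = (v $ a * w $ b - v $ b * w $ a) / D" "w' $ b = (v $ a * w $ b - v $ b * w $ a) / D"
      by (simp_all add: v'_def w'_def diff_divide_distrib mult.commute)
    then show "v' $ a = 1" "w' $ b = 1" by (simp_all flip: D_def)
    show "v' $ b = 0" "w' $ a = 0" by (simp_all add: v'_def w'_def mult.commute)
  qed
  have vv: "v = (v $ a) *s v' + (v $ b) *s w'" "w = (w $ a) *s v' + (w $ b) *s w'"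
  proof -
    have "(v $ a * w $ b - v $ b * w $ a) / D = 1" by (simp add: D_def[symmetric])
    then have e: "v $ a * (w $ b / D) + v $ b * (- w $ a / D) = 1" by (simp add: diff_divide_distrib)
    have "(v $ a) *s v' + (v $ b) *s w'
        = (v $ a * (w $ b / D) + v $ b * (- w $ a / D)) *s v + 0 *s w"
      by (simp add: v'_def w'_def vec_eq_iff algebra_simps)
    then show "v = (v $ a) *s v' + (v $ b) *s w'" unfolding e by simp
    have "(w $ a) *s v' + (w $ b) *s w'
        = (v $ a * (w $ b / D) + v $ b * (- w $ a / D)) *s w + 0 *s v"
      by (simp add: v'_def w'_def vec_eq_iff algebra_simps)
    then show "w = (w $ a) *s v' + (w $ b) *s w'" unfolding e by simp
  qed
  have V': "V = vec.span {v', w'}"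
  proof
    have "{v', w'} \<subseteq> V" unfolding V span_pair v'_def w'_def by blast
    then show "vec.span {v', w'} \<subseteq> V" unfolding V by (metis vec.span_minimal vec.subspace_span)
    have "{v, w} \<subseteq> vec.span {v', w'}" unfolding span_pair using vv by blast
    then show "V \<subseteq> vec.span {v', w'}" unfolding V by (metis vec.span_minimal vec.subspace_span)
  qed
  define A where "A = frame v' w' (axis c 1) (axis d 1)"
  obtain B where B: "A ** B = mat 1" "B ** A = mat 1"
    unfolding A_def
  proof (rule frame_invertible)
    fix x0 x1 x2 x3 assume e: "x0 *s v' + x1 *s w' + x2 *s axis c 1 + x3 *s axis d 1 = 0"
    have "(x0 *s v' + x1 *s w' + x2 *s axis c 1 + x3 *s axis d 1) $ i = 0" for i
      unfolding e by simp
    from this[of a] this[of b] this[of c] this[of d]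
    show "x0 = 0 \<and> x1 = 0 \<and> x2 = 0 \<and> x3 = 0"
      using piv cd by (auto simp: axis_def split: if_splits)
  qed
  have "A $ a = axis 0 1" "A $ b = axis 1 1"
    using piv cd by (auto simp: A_def frame_def axis_def vec_eq_four)
  moreover have "lin (axis i 1 :: 'a ^ 4) = var i" for i
    using exhaust_four[of i] by (auto simp: lin_def axis_def sum_four)
  ultimately have "subst A (var a) = var 0" "subst A (var b) = var 1"
    by (simp_all add: subst_var)
  then show ?thesis
    using that[OF B _ \<open>a \<noteq> b\<close>] V' by (simp add: A_def frame_image_std_line)
qed

definition opp_line :: "('k::field ^ 4) set" where
  "opp_line = {x. x $ 0 = 0 \<and> x $ 1 = 0}"

lemma frame_image_opp_line: "(*v) (frame a b c d) ` opp_line = vec.span {c, d}"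
proof -
  have "s *s c + t *s d = frame a b c d *v vec4 0 0 s t" for s t
    by (simp add: frame_mult)
  then show ?thesis
    unfolding span_pair by (fastforce simp: opp_line_def frame_mult)
qed

lemma disjoint_spans_independent:
  assumes "indep2 a b" "indep2 c d" "vec.span {a, b} \<inter> vec.span {c, d} = {0}"
    and e: "x0 *s a + x1 *s b + x2 *s c + x3 *s d = 0"
  shows "x0 = 0 \<and> x1 = 0 \<and> x2 = 0 \<and> x3 = 0"
proof -
  have "x0 *s a + x1 *s b = (- x2) *s c + (- x3) *s d"
    using e by (simp add: eq_neg_iff_add_eq_0 algebra_simps)
  then have "x0 *s a + x1 *s b \<in> vec.span {a, b} \<inter> vec.span {c, d}"
    unfolding span_pair by blast
  then have "x0 *s a + x1 *s b = 0" using assms(3) by blast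
  moreover from this have "x2 *s c + x3 *s d = 0" using e by (simp add: add.assoc)
  ultimately show ?thesis using assms(1,2) unfolding indep2_def by blast
qed

lemma disjoint_lines_frame:
  assumes "is_line V" "is_line W" "V \<inter> W = {0}"
  obtains A B where "A ** B = mat 1" "B ** A = mat 1"
    "V = (*v) A ` std_line" "W = (*v) A ` opp_line"
proof -
  obtain a b where ab: "V = vec.span {a, b}" "indep2 a b" using is_lineE[OF assms(1)] .
  obtain c d where cd: "W = vec.span {c, d}" "indep2 c d" using is_lineE[OF assms(2)] .
  obtain B where "frame a b c d ** B = mat 1" "B ** frame a b c d = mat 1"
    using frame_invertible[of a b c d] disjoint_spans_independent[OF ab(2) cd(2)] assms(3) ab cd by metis
  then show ?thesis using that ab cd frame_image_std_line frame_image_opp_line by metis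
qed

text \<open>\<open>x\<^sub>i\<close> is a sum \<open>l + l'\<close> of linear forms vanishing on \<open>V\<close> and on \<open>W\<close>, and
  \<open>(l + l')\<^sup>3\<close> is the sum of \<open>l\<^sup>2 (l + 3 l')\<close> and \<open>l'\<^sup>2 (l' + 3 l)\<close>.\<close>

lemma var_cube_split:
  fixes V W :: "('k::field_char_0 ^ 4) set"
  assumes "is_line V" "is_line W" "V \<inter> W = {0}"
  obtains p q where "homog 3 p" "homog 3 q" "p \<in> sq V" "q \<in> sq W" "var i ^ 3 = p + q"
proof -
  obtain A B :: "'k ^ 4 ^ 4" where AB: "A ** B = mat 1" "B ** A = mat 1"
    and V: "V = (*v) A ` std_line" and W: "W = (*v) A ` opp_line"
    using disjoint_lines_frame[OF assms] .
  define r where "r = A $ i"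
  define l where "l = subst B (lin (vec4 0 0 (r$2) (r$3)))"
  define l' where "l' = subst B (lin (vec4 (r$0) (r$1) 0 0))"
  have pull: "subst A l = lin (vec4 0 0 (r$2) (r$3))" "subst A l' = lin (vec4 (r$0) (r$1) 0 0)"
    using AB by (simp_all add: l_def l'_def subst_subst)
  have "l \<in> vanishing_ideal V"
    unfolding V subst_in_vanishing_iff[symmetric] pull
    by (simp add: vanishing_ideal_def eval_lin sum_four std_line_def)
  have "l' \<in> vanishing_ideal W"
    unfolding W subst_in_vanishing_iff[symmetric] pull
    by (simp add: vanishing_ideal_def eval_lin sum_four opp_line_def)
  have "subst A (var i) = subst A (l + l')"
    unfolding subst_simps pull subst_var r_def[symmetric]
    by (simp add: lin_def sum_four)
  then have "subst B (subst A (var i)) = subst B (subst A (l + l'))" by simp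
  then have var_i: "var i = l + l'" using AB by (simp add: subst_subst)
  have hl: "homog 1 l" "homog 1 l'" unfolding l_def l'_def by (intro homog_subst homog_lin)+
  have h3: "homog 1 (x + y + y + y)" if "homog 1 x" "homog 1 y" for x y :: "'k hpoly"
    by (intro homog_add that)
  have h: "homog 3 ((x * x) * (x + y + y + y))" if "homog 1 x" "homog 1 y" for x y :: "'k hpoly"
  proof -
    have "(1::nat) + 1 + 1 = 3" by simp
    then show ?thesis using homog_mult[OF homog_mult[OF that(1) that(1)] h3[OF that]] by (simp only:)
  qed
  show ?thesis
  proof (rule that[of "(l * l) * (l + l' + l' + l')" "(l' * l') * (l' + l + l + l)"])
    show "l * l * (l + l' + l' + l') \<in> sq V" "l' * l' * (l' + l + l + l) \<in> sq W"
      by (intro ideal_mult_right[OF is_ideal_sq] mult_in_sq; fact)+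
    show "var i ^ 3 = l * l * (l + l' + l' + l') + l' * l' * (l' + l + l + l)"
    proof -
      have "(x + y) ^ 3 = x * x * (x + y + y + y) + y * y * (y + x + x + x)" for x y :: "'r::comm_ring_1"
        by (simp only: power3_eq_cube distrib_left distrib_right ac_simps)
      then show ?thesis unfolding var_i .
    qed
    show "homog 3 (l * l * (l + l' + l' + l'))" by (rule h[OF hl])
    show "homog 3 (l' * l' * (l' + l + l + l))" by (rule h[OF hl(2,1)])
  qed
qed

section \<open>Recovering the lines from the ideal of their union\<close>

lemma vanishing_separates:
  fixes V :: "('k::field_char_0 ^ 4) set"
  assumes "is_line V" "x \<notin> V"
  obtains p where "p \<in> vanishing_ideal V" "eval_mpoly (\<lambda>i. x $ i) p \<noteq> 0"
proof -
  obtain A B :: "'k ^ 4 ^ 4" where AB: "A ** B = mat 1" "B ** A = mat 1" and V: "V = (*v) A ` std_line"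
    using pivot_frame[OF assms(1)] .
  have x: "x = A *v (B *v x)" using AB by (simp add: matrix_vector_mul_assoc)
  then have "B *v x \<notin> std_line" using assms(2) V by blast
  then obtain j where j: "j = 2 \<or> j = 3" "(B *v x) $ j \<noteq> 0" by (auto simp: std_line_def)
  show ?thesis
  proof (rule that[of "subst B (var j)"])
    show "subst B (var j) \<in> vanishing_ideal V"
      unfolding V subst_in_vanishing_iff[symmetric]
      using AB j(1) by (auto simp: subst_subst vanishing_ideal_def std_line_def)
    show "eval_mpoly (\<lambda>i. x $ i) (subst B (var j)) \<noteq> 0"
      using j(2) by (simp add: eval_subst)
  qed
qed

text \<open>For a point off all the lines, choose for each line a polynomial that vanishes on the
  line but not at the point. The product of the squares of these lies in every
  \<open>sq (V i)\<close> and is nonzero at the point.\<close>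

lemma zeros_Inter_sq:
  fixes V :: "nat \<Rightarrow> ('k::field_char_0 ^ 4) set"
  assumes "\<And>i. i < n \<Longrightarrow> is_line (V i)" "0 < n"
  shows "{x. \<forall>p\<in>(\<Inter>i<n. sq (V i)). eval_mpoly (\<lambda>i. x $ i) p = 0} = (\<Union>i<n. V i)"
proof (intro set_eqI iffI)
  fix x assume "x \<in> (\<Union>i<n. V i)"
  then show "x \<in> {x. \<forall>p\<in>(\<Inter>i<n. sq (V i)). eval_mpoly (\<lambda>i. x $ i) p = 0}"
    using sq_subset_vanishing by (fastforce simp: vanishing_ideal_def)
next
  fix x assume x: "x \<in> {x. \<forall>p\<in>(\<Inter>i<n. sq (V i)). eval_mpoly (\<lambda>i. x $ i) p = 0}"
  show "x \<in> (\<Union>i<n. V i)"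
  proof (rule ccontr)
    assume "x \<notin> (\<Union>i<n. V i)"
    then have "\<exists>p. p \<in> vanishing_ideal (V i) \<and> eval_mpoly (\<lambda>i. x $ i) p \<noteq> 0" if "i < n" for i
      using vanishing_separates[OF assms(1)[OF that], of x] that by blast
    then obtain p where p: "\<And>i. i < n \<Longrightarrow> p i \<in> vanishing_ideal (V i)"
      "\<And>i. i < n \<Longrightarrow> eval_mpoly (\<lambda>i. x $ i) (p i) \<noteq> 0" by metis
    have "(\<Prod>i<n. p i * p i) \<in> sq (V j)" if "j < n" for j
    proof -
      have "(\<Prod>i<n. p i * p i) = (p j * p j) * (\<Prod>i\<in>{..<n} - {j}. p i * p i)"
        using that by (intro prod.remove) auto
      then show ?thesis using p(1)[OF that] by (simp add: ideal_mult_right is_ideal_sq mult_in_sq)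
    qed
    then have "eval_mpoly (\<lambda>i. x $ i) (\<Prod>i<n. p i * p i) = 0" using x by blast
    then show False using p(2) by (simp add: eval_mpoly_simps)
  qed
qed

text \<open>Of the n + 1 points \<open>v + c w\<close> with c = 0, ..., n, two lie in the same
  \<open>W j\<close>. Their difference is a nonzero multiple of \<open>w\<close> because the
  characteristic is 0, so that subspace contains \<open>w\<close> and then \<open>v\<close>.\<close>

lemma line_in_union:
  fixes V :: "('k::field_char_0 ^ 4) set"
  assumes "is_line V" "V \<subseteq> (\<Union>j<(n::nat). W j)" "\<And>j. j < n \<Longrightarrow> vec.subspace (W j)"
  obtains j where "j < n" "V \<subseteq> W j"
proof -
  obtain v w where V: "V = vec.span {v, w}" using is_lineE[OF assms(1)] .
  have "v + of_nat c *s w \<in> V" for c :: nat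
    unfolding V span_pair using vector_smult_lid[of v] by (metis (mono_tags, lifting) mem_Collect_eq)
  then have "\<exists>j. j < n \<and> v + of_nat c *s w \<in> W j" for c :: nat using assms(2) by blast
  then obtain f where f: "\<And>c. f c < n" "\<And>c::nat. v + of_nat c *s w \<in> W (f c)" by metis
  have "f ` {..n} \<subseteq> {..<n}" using f(1) by auto
  then have "card (f ` {..n}) \<le> n" using card_mono[of "{..<n}"] by simp
  then have "\<not> inj_on f {..n}" by (intro pigeonhole) simp
  then obtain c d where cd: "c \<noteq> d" "f c = f d" by (auto simp: inj_on_def)
  have sub: "vec.subspace (W (f c))" using assms(3) f(1) by blast
  have "(v + of_nat c *s w) - (v + of_nat d *s w) \<in> W (f c)"
    using vec.subspace_diff[OF sub f(2)[of c], of "v + of_nat d *s w"] f(2)[of d] cd(2) by metis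
  then have "(of_nat c - of_nat d :: 'k) *s w \<in> W (f c)"
    by (simp add: vector_sub_rdistrib)
  then have "inverse (of_nat c - of_nat d :: 'k) *s ((of_nat c - of_nat d) *s w) \<in> W (f c)"
    by (rule vec.subspace_scale[OF sub])
  moreover have "of_nat c - of_nat d \<noteq> (0 :: 'k)" using cd(1) by simp
  ultimately have w: "w \<in> W (f c)"
    by (simp only: vector_smult_assoc left_inverse vector_smult_lid not_False_eq_True)
  have "(v + of_nat c *s w) - of_nat c *s w \<in> W (f c)"
    by (intro vec.subspace_diff[OF sub] f(2) vec.subspace_scale[OF sub] w)
  then have "v \<in> W (f c)" by simp
  with w have "V \<subseteq> W (f c)" unfolding V by (intro vec.span_minimal[OF _ sub]) auto
  then show ?thesis using that f(1) by blast
qed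

lemma line_subset_eq:
  assumes "is_line V" "is_line W" "V \<subseteq> W"
  shows "V = W"
  using assms vec.subspace_dim_equal[of V W] by (simp add: is_line_def)

lemma line_not_trivial: "is_line V \<Longrightarrow> V \<noteq> {0}"
  by (auto simp: is_line_def)

lemma union_ideal_doubled: "union_ideal a 0 V = (\<Inter>i<a. sq (V i))"
  by (auto simp: union_ideal_def sq_def)

text \<open>The zero set of the ideal is the union of the lines, and each line in a finite union of
  lines is one of them. This is what lets a property of families of lines descend to a property of
  ideals.\<close>

lemma union_ideal_lines_unique:
  fixes V W :: "nat \<Rightarrow> ('k::field_char_0 ^ 4) set"
  assumes V: "disjoint_lines n V" and W: "disjoint_lines n W"
    and eq: "union_ideal n 0 V = union_ideal n 0 W"
  obtains \<pi> where "inj_on \<pi> {..<n}" "\<pi> ` {..<n} \<subseteq> {..<n}" "\<And>i. i < n \<Longrightarrow> V i = W (\<pi> i)"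
proof (cases "n = 0")
  case True
  then show ?thesis using that[of id] by simp
next
  case False
  have l: "\<And>i. i < n \<Longrightarrow> is_line (V i)" "\<And>i. i < n \<Longrightarrow> is_line (W i)"
    using V W by (auto simp: disjoint_lines_def)
  have U: "(\<Union>i<n. V i) = (\<Union>i<n. W i)"
    using zeros_Inter_sq[of n V] zeros_Inter_sq[of n W] l eq False
    by (simp add: union_ideal_doubled)
  have "\<exists>j. j < n \<and> V i = W j" if i: "i < n" for i
  proof -
    have "V i \<subseteq> (\<Union>j<n. W j)" using U i by blast
    then obtain j where "j < n" "V i \<subseteq> W j"
      using line_in_union[OF l(1)[OF i], of W n] l(2) by (auto simp: is_line_def)
    then show ?thesis using line_subset_eq l i by blast
  qed
  then obtain \<pi> where \<pi>: "\<And>i. i < n \<Longrightarrow> \<pi> i < n" "\<And>i. i < n \<Longrightarrow> V i = W (\<pi> i)" by metis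
  have "inj_on \<pi> {..<n}"
  proof (rule inj_onI)
    fix i j assume ij: "i \<in> {..<n}" "j \<in> {..<n}" "\<pi> i = \<pi> j"
    then have "V i = V j" using \<pi>(2) by simp
    show "i = j"
    proof (rule ccontr)
      assume "i \<noteq> j"
      then have "V i \<inter> V j = {0}" using V ij by (simp add: disjoint_lines_def)
      then show False using \<open>V i = V j\<close> line_not_trivial[OF l(1)] ij by simp
    qed
  qed
  then show ?thesis using that[of \<pi>] \<pi> by auto
qed

text \<open>The ideal \<open>sq V\<close> seen through a coordinate \<open>x\<^sub>a\<close> that does not vanish on \<open>V\<close>.\<close>

lemma sq_pivot:
  fixes V :: "('k::field_char_0 ^ 4) set"
  assumes "is_line V"
  obtains a b where "a \<noteq> b" "\<And>n p. var a ^ n * p \<in> sq V \<Longrightarrow> p \<in> sq V"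
    "\<And>d n p q. homog (d + n) p \<Longrightarrow> var b ^ n * p - var a ^ n * q \<in> sq V \<Longrightarrow>
        \<exists>g. homog d g \<and> p - var a ^ n * g \<in> sq V"
proof -
  obtain A B a b where AB: "A ** B = mat 1" "B ** A = mat 1" and V: "V = (*v) A ` std_line"
    and ab: "a \<noteq> b" and s: "subst A (var a) = var 0" "subst A (var b) = var 1"
    using pivot_frame[OF assms] .
  have sqV: "p \<in> sq V \<longleftrightarrow> subst A p \<in> ord23 2" for p
    using subst_in_sq_iff[OF AB, of p std_line] V by (simp add: sq_std_line)
  show ?thesis
  proof (rule that[OF ab])
    fix n p assume "var a ^ n * p \<in> sq V"
    then show "p \<in> sq V" by (simp add: sqV subst_simps s var_power_mult_ord23)
  next
    fix d n p q assume "homog (d + n) p" "var b ^ n * p - var a ^ n * q \<in> sq V"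
    then have "homog (d + n) (subst A p)" "var 1 ^ n * subst A p - var 0 ^ n * subst A q \<in> ord23 2"
      by (simp_all add: sqV subst_simps s homog_subst)
    then obtain g where g: "homog d g" "subst A p - var 0 ^ n * g \<in> ord23 2"
      using ord23_glue by blast
    then have "p - var a ^ n * subst B g \<in> sq V" "homog d (subst B g)"
      using AB by (simp_all add: sqV subst_simps s homog_subst subst_subst)
    then show "\<exists>g. homog d g \<and> p - var a ^ n * g \<in> sq V" by blast
  qed
qed

section \<open>Localisations in the Laurent polynomial ring\<close>

abbreviation int_mon :: "(4 \<Rightarrow>\<^sub>0 nat) \<Rightarrow> (4 \<Rightarrow>\<^sub>0 int)" where
  "int_mon \<equiv> Poly_Mapping.map int"

lemma lookup_int_mon [simp]: "lookup (int_mon m) i = int (lookup m i)"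
  by (simp add: Poly_Mapping.map.rep_eq when_def)

lemma int_mon_eq_iff [simp]: "int_mon m = int_mon n \<longleftrightarrow> m = n"
  by (auto simp: poly_mapping_eq_iff fun_eq_iff dest: spec)

lemma int_mon_add: "int_mon (m + n) = int_mon m + int_mon n"
  by (rule poly_mapping_eqI) (simp add: lookup_add)

lemma int_mon_ex: "(\<And>i. 0 \<le> lookup m i) \<Longrightarrow> \<exists>n. m = int_mon n"
  by (rule exI[of _ "mon (nat (lookup m 0)) (nat (lookup m 1)) (nat (lookup m 2)) (nat (lookup m 3))"])
     (rule mon_eqI, simp_all)

lemma lookup_to_laurent: "lookup (to_laurent p) (int_mon m) = lookup p m"
proof -
  have "lookup (to_laurent p) (int_mon m) = (\<Sum>n\<in>keys p. if n = m then lookup p n else 0)"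
    unfolding to_laurent_def lookup_sum by (rule sum.cong) (auto simp: lookup_single when_def)
  then show ?thesis by (simp add: in_keys_iff)
qed

lemma keys_to_laurent: "keys (to_laurent p) = int_mon ` keys p"
proof
  show "keys (to_laurent p) \<subseteq> int_mon ` keys p"
    unfolding to_laurent_def
    using keys_sum[of "\<lambda>m. single (int_mon m) (lookup p m)" "keys p"] by (auto split: if_splits)
  show "int_mon ` keys p \<subseteq> keys (to_laurent p)"
    by (auto simp: in_keys_iff lookup_to_laurent)
qed

lemma lookup_to_laurent_neg: "m \<notin> range int_mon \<Longrightarrow> lookup (to_laurent p) m = 0"
  using keys_to_laurent[of p] by (auto simp flip: not_in_keys_iff_lookup_eq_zero)

lemma to_laurent_add: "to_laurent (p + q) = to_laurent p + to_laurent q"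
proof (rule poly_mapping_eqI)
  fix m show "lookup (to_laurent (p + q)) m = lookup (to_laurent p + to_laurent q) m"
    by (cases "m \<in> range int_mon") (auto simp: lookup_to_laurent lookup_add lookup_to_laurent_neg)
qed

lemma to_laurent_single: "to_laurent (single m c) = single (int_mon m) c"
  by (cases "c = 0") (simp_all add: to_laurent_def)

lemma to_laurent_mult: "to_laurent (p * q) = to_laurent p * to_laurent q"
  by (rule multiplicative_if_on_singles)
     (simp_all add: to_laurent_add mult_single to_laurent_single int_mon_add)

lemma int_mon_0 [simp]: "int_mon 0 = 0"
  by (rule poly_mapping_eqI) simp

lemma to_laurent_0 [simp]: "to_laurent 0 = 0"
  by (simp add: to_laurent_def)

lemma to_laurent_1 [simp]: "to_laurent 1 = 1"
  using to_laurent_single[of 0 1] by simp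

lemma to_laurent_uminus: "to_laurent (- p) = - to_laurent p"
  using to_laurent_add[of p "- p"] by (simp add: eq_neg_iff_add_eq_0 add.commute)

lemma to_laurent_diff: "to_laurent (p - q) = to_laurent p - to_laurent q"
  using to_laurent_add[of p "- q"] by (simp add: to_laurent_uminus)

lemma to_laurent_sum: "to_laurent (sum f A) = (\<Sum>x\<in>A. to_laurent (f x))"
  by (induction A rule: infinite_finite_induct) (auto simp: to_laurent_add)

lemma to_laurent_power: "to_laurent (p ^ n) = to_laurent p ^ n"
  by (induction n) (auto simp: to_laurent_mult)

lemma to_laurent_prod: "to_laurent (prod f A) = (\<Prod>x\<in>A. to_laurent (f x))"
  by (induction A rule: infinite_finite_induct) (auto simp: to_laurent_mult)

lemma to_laurent_eq_iff [simp]: "to_laurent p = to_laurent q \<longleftrightarrow> p = q"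
proof
  assume "to_laurent p = to_laurent q"
  then have "lookup (to_laurent p) (int_mon m) = lookup (to_laurent q) (int_mon m)" for m by simp
  then show "p = q" by (intro poly_mapping_eqI) (simp add: lookup_to_laurent)
qed simp

lemma to_laurent_const: "to_laurent (single 0 c) = single 0 c"
  by (simp add: to_laurent_single)

lemma in_range_to_laurent_iff:
  "f \<in> range to_laurent \<longleftrightarrow> (\<forall>m\<in>keys f. \<forall>i. 0 \<le> lookup m i)"
proof
  assume "f \<in> range to_laurent"
  then show "\<forall>m\<in>keys f. \<forall>i. 0 \<le> lookup m i" by (auto simp: keys_to_laurent)
next
  assume "\<forall>m\<in>keys f. \<forall>i. 0 \<le> lookup m i"
  then have "\<forall>m\<in>keys f. \<exists>n. m = int_mon n" using int_mon_ex by blast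
  then obtain h where h: "\<And>m. m \<in> keys f \<Longrightarrow> m = int_mon (h m)" by metis
  have "f = (\<Sum>m\<in>keys f. single m (lookup f m))" by (rule poly_mapping_sum_single) auto
  also have "\<dots> = to_laurent (\<Sum>m\<in>keys f. single (h m) (lookup f m))"
    unfolding to_laurent_sum to_laurent_single by (rule sum.cong) (use h in auto)
  finally show "f \<in> range to_laurent" by blast
qed

lemma lookup_sum_single_1: "lookup (\<Sum>i\<in>\<sigma>. single i (n::'a::comm_monoid_add)) k = (if k \<in> \<sigma> then n else 0)"
  for \<sigma> :: "4 set"
proof -
  have "lookup (\<Sum>i\<in>\<sigma>. single i n) k = (\<Sum>i\<in>\<sigma>. if i = k then n else 0)"
    unfolding lookup_sum by (rule sum.cong) (auto simp: lookup_single when_def)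
  then show ?thesis by simp
qed

lemma prod_single: "(\<Prod>i\<in>A. single (a i) 1) = single (\<Sum>i\<in>A. a i) (1::'k::comm_ring_1)"
  by (induction A rule: infinite_finite_induct) (auto simp: mult_single)

lemma single_power: "single a (1::'k::comm_ring_1) ^ n = single (\<Sum>i<n. a) 1"
  by (induction n) (auto simp: mult_single add.commute)

lemma xprod_power: "xprod \<sigma> ^ n = single (\<Sum>i\<in>\<sigma>. single i (int n)) 1"
proof -
  have "(\<Sum>j<n. \<Sum>i\<in>\<sigma>. single i 1) = (\<Sum>i\<in>\<sigma>. single i (int n))"
    by (rule poly_mapping_eqI) (simp only: lookup_sum lookup_single, simp add: when_def)
  then show ?thesis by (simp add: xprod_def prod_single single_power)
qed

lemma xprod_power_divide:
  obtains g where "xprod \<sigma> ^ n * g = f"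
proof
  show "xprod \<sigma> ^ n * (single (- (\<Sum>i\<in>\<sigma>. single i (int n))) 1 * f) = f"
    by (simp add: xprod_power mult_single flip: mult.assoc)
qed

lemma xprod_to_laurent: "xprod \<sigma> = to_laurent (\<Prod>i\<in>\<sigma>. var i)"
proof -
  have "int_mon (single i 1) = single i 1" for i
    by (rule poly_mapping_eqI) (auto simp: lookup_single when_def)
  then show ?thesis by (simp add: xprod_def to_laurent_prod var_def to_laurent_single)
qed

lemma xprod_single: "xprod {a} = to_laurent (var a)"
  by (simp add: xprod_to_laurent)

lemma xprod_insert: "a \<notin> \<sigma> \<Longrightarrow> xprod (insert a \<sigma>) = to_laurent (var a) * xprod \<sigma>"
  by (simp add: xprod_to_laurent to_laurent_mult)

lemma xprod_empty [simp]: "xprod {} = 1"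
  by (simp add: xprod_def)

text \<open>The localisation without a condition on degrees. For \<open>\<sigma> = {}\<close> it is
  the image of \<open>I\<close> itself, so removing the last inverted variable gives membership in
  the ideal.\<close>

definition loc :: "'k::field hpoly set \<Rightarrow> 4 set \<Rightarrow> 'k laurent set" where
  "loc I \<sigma> = {f. \<exists>n. xprod \<sigma> ^ n * f \<in> to_laurent ` I}"

lemma ideal_sections_eq: "f \<in> ideal_sections J d \<sigma> \<longleftrightarrow> homogeneous_laurent d f \<and> f \<in> loc J \<sigma>"
  by (simp add: ideal_sections_def loc_def)

lemma to_laurent_ideal_mult:
  "is_ideal I \<Longrightarrow> f \<in> to_laurent ` I \<Longrightarrow> to_laurent p * f \<in> to_laurent ` I"
  using ideal_mult_left[of I _ p] by (auto simp flip: to_laurent_mult)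

lemma xprod_power_mult_ideal:
  "is_ideal I \<Longrightarrow> f \<in> to_laurent ` I \<Longrightarrow> xprod \<sigma> ^ n * f \<in> to_laurent ` I"
  using to_laurent_ideal_mult[of I f "(\<Prod>i\<in>\<sigma>. var i) ^ n"]
  by (simp add: xprod_to_laurent to_laurent_power)

lemma loc_ge:
  assumes "is_ideal I" "f \<in> loc I \<sigma>"
  obtains N where "\<And>n. n \<ge> N \<Longrightarrow> xprod \<sigma> ^ n * f \<in> to_laurent ` I"
proof -
  obtain N where N: "xprod \<sigma> ^ N * f \<in> to_laurent ` I" using assms by (auto simp: loc_def)
  show ?thesis
  proof (rule that[of N])
    fix n assume "N \<le> n"
    then have "xprod \<sigma> ^ n * f = xprod \<sigma> ^ (n - N) * (xprod \<sigma> ^ N * f)"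
      by (simp flip: mult.assoc power_add)
    then show "xprod \<sigma> ^ n * f \<in> to_laurent ` I"
      using xprod_power_mult_ideal[OF assms(1) N, of \<sigma> "n - N"] by metis
  qed
qed

lemma loc_add:
  assumes I: "is_ideal I" and "f \<in> loc I \<sigma>" "g \<in> loc I \<sigma>"
  shows "f + g \<in> loc I \<sigma>"
proof -
  obtain N where N: "\<And>n. n \<ge> N \<Longrightarrow> xprod \<sigma> ^ n * f \<in> to_laurent ` I" using loc_ge assms by blast
  obtain M where M: "\<And>n. n \<ge> M \<Longrightarrow> xprod \<sigma> ^ n * g \<in> to_laurent ` I" using loc_ge assms by blast
  obtain p q where "p \<in> I" "q \<in> I" "xprod \<sigma> ^ max N M * f = to_laurent p"
    "xprod \<sigma> ^ max N M * g = to_laurent q"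
    using N[of "max N M"] M[of "max N M"] by auto
  then have "xprod \<sigma> ^ max N M * (f + g) = to_laurent (p + q)" "p + q \<in> I"
    using self.subspace_add[OF I] by (simp_all add: distrib_left to_laurent_add)
  then show ?thesis unfolding loc_def by blast
qed

lemma loc_mult:
  assumes "is_ideal I" "f \<in> loc I \<sigma>"
  shows "to_laurent p * f \<in> loc I \<sigma>"
proof -
  obtain n where "xprod \<sigma> ^ n * f \<in> to_laurent ` I" using assms by (auto simp: loc_def)
  then have "to_laurent p * (xprod \<sigma> ^ n * f) \<in> to_laurent ` I" by (rule to_laurent_ideal_mult[OF assms(1)])
  moreover have "to_laurent p * (xprod \<sigma> ^ n * f) = xprod \<sigma> ^ n * (to_laurent p * f)"
    by (rule mult.left_commute)
  ultimately show ?thesis unfolding loc_def mem_Collect_eq by metis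
qed

lemma loc_uminus: "is_ideal I \<Longrightarrow> f \<in> loc I \<sigma> \<Longrightarrow> - f \<in> loc I \<sigma>"
  using loc_mult[of I f \<sigma> "- 1"] by (simp add: to_laurent_uminus)

lemma loc_diff: "is_ideal I \<Longrightarrow> f \<in> loc I \<sigma> \<Longrightarrow> g \<in> loc I \<sigma> \<Longrightarrow> f - g \<in> loc I \<sigma>"
  using loc_add[of I f \<sigma> "- g"] loc_uminus[of I g \<sigma>] by simp

lemma loc_scale: "is_ideal I \<Longrightarrow> f \<in> loc I \<sigma> \<Longrightarrow> single 0 c * f \<in> loc I \<sigma>"
  using loc_mult[of I f \<sigma> "single 0 c"] by (simp add: to_laurent_const)

lemma loc_to_laurent: "p \<in> I \<Longrightarrow> to_laurent p \<in> loc I \<sigma>"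
  unfolding loc_def by (auto intro!: exI[of _ 0])

lemma loc_subset_UNIV: "loc I \<sigma> \<subseteq> loc UNIV \<sigma>"
  by (auto simp: loc_def)

lemma loc_0: "is_ideal I \<Longrightarrow> 0 \<in> loc I \<sigma>"
  using loc_to_laurent[of 0 I \<sigma>] self.subspace_0[of I] by simp

lemma is_ideal_UNIV: "is_ideal UNIV"
  by (simp add: self.subspace_def)

lemma loc_mono:
  assumes I: "is_ideal I" and "\<sigma> \<subseteq> \<tau>"
  shows "loc I \<sigma> \<subseteq> loc I \<tau>"
proof
  fix f assume "f \<in> loc I \<sigma>"
  then obtain n where n: "xprod \<sigma> ^ n * f \<in> to_laurent ` I" by (auto simp: loc_def)
  have "xprod \<tau> = xprod (\<tau> - \<sigma>) * xprod \<sigma>"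
    unfolding xprod_def by (rule prod.subset_diff) (use assms in auto)
  then have "xprod \<tau> ^ n * f = xprod (\<tau> - \<sigma>) ^ n * (xprod \<sigma> ^ n * f)"
    by (metis power_mult_distrib mult.assoc)
  then show "f \<in> loc I \<tau>" using xprod_power_mult_ideal[OF I n] unfolding loc_def mem_Collect_eq by metis
qed

text \<open>Finitely many exponents have a common bound, and one exponent that clears the
  denominators for all \<open>I l\<close> yields the same polynomial for each
  \<open>l\<close>.\<close>

lemma loc_Inter:
  assumes I: "\<And>l. l < n \<Longrightarrow> is_ideal (I l)" and "0 < (n::nat)"
    and f: "\<And>l. l < n \<Longrightarrow> f \<in> loc (I l) \<sigma>"
  shows "f \<in> loc (\<Inter>l<n. I l) \<sigma>"
proof -
  have "\<exists>N. \<forall>k\<ge>N. xprod \<sigma> ^ k * f \<in> to_laurent ` I l" if "l < n" for l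
    using loc_ge[OF I[OF that] f[OF that]] by metis
  then obtain N where N: "\<And>l k. l < n \<Longrightarrow> N l \<le> k \<Longrightarrow> xprod \<sigma> ^ k * f \<in> to_laurent ` I l" by metis
  define M where "M = Max (N ` {..<n})"
  have M: "N l \<le> M" if "l < n" for l using that unfolding M_def by (intro Max_ge) auto
  obtain p where p: "xprod \<sigma> ^ M * f = to_laurent p" using N[OF assms(2) M[OF assms(2)]] by auto
  have "p \<in> I l" if "l < n" for l using N[OF that M[OF that]] unfolding p by auto
  then show ?thesis unfolding loc_def using p by blast
qed

text \<open>After multiplication by a power of the variables in \<sigma>, \<open>f\<close> is a
  polynomial \<open>p\<close> with \<open>var a ^ k * p\<close> in \<open>I\<close>; regularity of
  x_a modulo \<open>I\<close> cancels the power of x_a.\<close>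

lemma loc_regular:
  assumes I: "is_ideal I" and reg: "\<And>n p. var a ^ n * p \<in> I \<Longrightarrow> p \<in> I"
    and f: "f \<in> loc I (insert a \<sigma>)" "f \<in> loc UNIV \<sigma>"
  shows "f \<in> loc I \<sigma>"
proof (cases "a \<in> \<sigma>")
  case True
  then show ?thesis using f by (simp add: insert_absorb)
next
  case False
  obtain N where N: "\<And>n. n \<ge> N \<Longrightarrow> xprod (insert a \<sigma>) ^ n * f \<in> to_laurent ` I"
    using loc_ge[OF I f(1)] by blast
  obtain M where M: "\<And>n. n \<ge> M \<Longrightarrow> xprod \<sigma> ^ n * f \<in> to_laurent ` UNIV"
    using loc_ge[OF is_ideal_UNIV f(2)] by blast
  define k where "k = max N M"
  obtain p where p: "xprod \<sigma> ^ k * f = to_laurent p" using M[of k] by (auto simp: k_def)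
  have "xprod (insert a \<sigma>) ^ k * f = to_laurent (var a ^ k * p)"
    by (simp add: xprod_insert False power_mult_distrib mult.assoc p to_laurent_mult to_laurent_power)
  then have "var a ^ k * p \<in> I" using N[of k] by (auto simp: k_def)
  then have "p \<in> I" by (rule reg)
  then show ?thesis using p unfolding loc_def by auto
qed

lemma loc_regular_global:
  assumes "is_ideal I" "\<And>n p. var a ^ n * p \<in> I \<Longrightarrow> p \<in> I" "to_laurent p \<in> loc I {a}"
  shows "p \<in> I"
proof -
  have "to_laurent p \<in> loc I {}"
    by (rule loc_regular[OF assms(1,2)]) (use assms(3) loc_to_laurent in auto)
  then show ?thesis by (auto simp: loc_def)
qed

lemma loc_UNIV_iff: "f \<in> loc UNIV \<sigma> \<longleftrightarrow> (\<forall>m\<in>keys f. \<forall>i. i \<notin> \<sigma> \<longrightarrow> 0 \<le> lookup m i)"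
proof
  assume "f \<in> loc UNIV \<sigma>"
  then obtain n where "xprod \<sigma> ^ n * f \<in> range to_laurent" by (auto simp: loc_def)
  then have nonneg: "0 \<le> lookup ((\<Sum>i\<in>\<sigma>. single i (int n)) + m) i" if "m \<in> keys f" for m i
    using that by (simp add: in_range_to_laurent_iff xprod_power keys_single_mult)
  have "0 \<le> lookup m i" if "m \<in> keys f" "i \<notin> \<sigma>" for m i
    using nonneg[OF that(1), of i] that(2) by (simp add: lookup_add lookup_sum_single_1)
  then show "\<forall>m\<in>keys f. \<forall>i. i \<notin> \<sigma> \<longrightarrow> 0 \<le> lookup m i" by blast
next
  assume f: "\<forall>m\<in>keys f. \<forall>i. i \<notin> \<sigma> \<longrightarrow> 0 \<le> lookup m i"
  define n where "n = Max (insert 0 ((\<lambda>(m, i). nat (- lookup m i)) ` (keys f \<times> UNIV)))"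
  have n: "nat (- lookup m i) \<le> n" if "m \<in> keys f" for m i
    unfolding n_def using that by (intro Max_ge) (auto intro!: rev_image_eqI[of "(m, i)"])
  have "0 \<le> lookup ((\<Sum>i\<in>\<sigma>. single i (int n)) + m) i" if "m \<in> keys f" for m i
    using n[OF that, of i] f that by (auto simp: lookup_add lookup_sum_single_1)
  then have "xprod \<sigma> ^ n * f \<in> range to_laurent"
    by (auto simp: in_range_to_laurent_iff xprod_power keys_single_mult)
  then show "f \<in> loc UNIV \<sigma>" by (auto simp: loc_def)
qed

text \<open>A negative exponent would have to belong to an index in both \<sigma> and
  \<tau>.\<close>

lemma loc_UNIV_Int:
  assumes "f \<in> loc UNIV \<sigma>" "f \<in> loc UNIV \<tau>" "\<sigma> \<inter> \<tau> = {}"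
  obtains p where "f = to_laurent p"
proof -
  have "f \<in> range to_laurent"
    unfolding in_range_to_laurent_iff using assms unfolding loc_UNIV_iff by blast
  then show ?thesis using that by auto
qed

lemma homogeneous_to_laurent: "homogeneous_laurent (int d) (to_laurent p) \<longleftrightarrow> homog d p"
  by (auto simp: homogeneous_laurent_def homog_def keys_to_laurent simp flip: of_nat_sum)

lemma homogeneous_laurent_0: "homogeneous_laurent d 0"
  by (simp add: homogeneous_laurent_def)

lemma homogeneous_laurent_add:
  "homogeneous_laurent d f \<Longrightarrow> homogeneous_laurent d g \<Longrightarrow> homogeneous_laurent d (f + g)"
  using keys_add[of f g] by (auto simp: homogeneous_laurent_def)

lemma homogeneous_laurent_uminus: "homogeneous_laurent d f \<Longrightarrow> homogeneous_laurent d (- f)"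
  for f :: "'k::ab_group_add laurent"
  by (auto simp: homogeneous_laurent_def in_keys_iff)

lemma homogeneous_laurent_diff:
  "homogeneous_laurent d f \<Longrightarrow> homogeneous_laurent d g \<Longrightarrow> homogeneous_laurent d (f - g)"
  for f :: "'k::ab_group_add laurent"
  using homogeneous_laurent_add[of d f "- g"] by (auto simp: homogeneous_laurent_uminus)

lemma homogeneous_laurent_scale: "homogeneous_laurent d f \<Longrightarrow> homogeneous_laurent d (single 0 c * f)"
  for f :: "'k::comm_ring_1 laurent"
  by (auto simp: homogeneous_laurent_def in_keys_iff lookup_const_mult)

lemma homogeneous_laurent_xprod_mult:
  "homogeneous_laurent (d + int (n * card \<sigma>)) (xprod \<sigma> ^ n * f) \<longleftrightarrow> homogeneous_laurent d f"
proof -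
  have "(\<Sum>i\<in>UNIV. lookup (\<Sum>i\<in>\<sigma>. single i (int n)) i) = int (n * card \<sigma>)"
    by (simp add: lookup_sum_single_1 sum.If_cases)
  then show ?thesis
    by (auto simp: homogeneous_laurent_def xprod_power keys_single_mult lookup_add sum.distrib)
qed

text \<open>Sections of the structure sheaf of the double line over \<open>x\<^sub>a \<noteq> 0\<close> and \<open>x\<^sub>b \<noteq> 0\<close> that
  agree on the overlap come from a form; the other charts then follow because \<open>x\<^sub>a\<close> is
  regular modulo \<open>sq V\<close>.\<close>

lemma double_line_glue:
  fixes V :: "('k::field_char_0 ^ 4) set"
  assumes V: "is_line V"
    and f: "\<And>i. f i \<in> ideal_sections UNIV (int d) {i}"
    and ff: "\<And>i j. f i - f j \<in> loc (sq V) {i, j}"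
  obtains g where "homog d g" "\<And>i. f i - to_laurent g \<in> loc (sq V) {i}"
proof -
  obtain a b where ab: "a \<noteq> b" and reg: "\<And>n p. var a ^ n * p \<in> sq V \<Longrightarrow> p \<in> sq V"
    and glue: "\<And>d n p q. homog (d + n) p \<Longrightarrow> var b ^ n * p - var a ^ n * q \<in> sq V \<Longrightarrow>
        \<exists>g. homog d g \<and> p - var a ^ n * g \<in> sq V"
    using sq_pivot[OF V] by blast
  have fl: "f i \<in> loc UNIV {i}" and fh: "homogeneous_laurent (int d) (f i)" for i
    using f[of i] by (auto simp: ideal_sections_eq)
  obtain N where N: "\<And>n. n \<ge> N \<Longrightarrow> xprod {a} ^ n * f a \<in> range to_laurent"
    using loc_ge[OF is_ideal_UNIV fl] by blast
  obtain M where M: "\<And>n. n \<ge> M \<Longrightarrow> xprod {b} ^ n * f b \<in> range to_laurent"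
    using loc_ge[OF is_ideal_UNIV fl] by blast
  obtain K where K: "\<And>n. n \<ge> K \<Longrightarrow> xprod {a, b} ^ n * (f a - f b) \<in> to_laurent ` sq V"
    using loc_ge[OF is_ideal_sq ff] by blast
  define n where "n = max N (max M K)"
  have n: "N \<le> n" "M \<le> n" "K \<le> n" by (auto simp: n_def)
  obtain p where p: "xprod {a} ^ n * f a = to_laurent p" using N[OF n(1)] by auto
  obtain q where q: "xprod {b} ^ n * f b = to_laurent q" using M[OF n(2)] by auto
  \<comment> \<open>Clearing denominators with one common exponent turns agreement on the overlap of
    the two charts into a congruence between the numerators.\<close>
  have "xprod {a, b} ^ n * (f a - f b) = to_laurent (var b ^ n * p - var a ^ n * q)"
  proof -
    have split: "(x * y) ^ n * (u - v) = y ^ n * (x ^ n * u) - x ^ n * (y ^ n * v)"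
      for x y u v :: "'k laurent"
      by (simp only: power_mult_distrib right_diff_distrib left_diff_distrib mult_ac)
    have "xprod {a, b} = (xprod {a} * xprod {b} :: 'k laurent)" using ab by (simp add: xprod_def)
    then have "xprod {a, b} ^ n * (f a - f b) = xprod {b} ^ n * to_laurent p - xprod {a} ^ n * to_laurent q"
      unfolding p[symmetric] q[symmetric] by (simp only: split)
    then show ?thesis
      by (simp only: xprod_single to_laurent_diff to_laurent_mult to_laurent_power)
  qed
  then have "var b ^ n * p - var a ^ n * q \<in> sq V" using K[OF n(3)] by auto
  moreover have "homogeneous_laurent (int d + int (n * card {a})) (to_laurent p)"
    unfolding p[symmetric] homogeneous_laurent_xprod_mult by (rule fh)
  then have "homog (d + n) p" using homogeneous_to_laurent[of "d + n" p] by simp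
  ultimately obtain g where g: "homog d g" "p - var a ^ n * g \<in> sq V" using glue by blast
  have "xprod {a} ^ n * (f a - to_laurent g) = to_laurent (p - var a ^ n * g)"
    unfolding right_diff_distrib p
    by (simp add: to_laurent_diff to_laurent_mult to_laurent_power xprod_single)
  then have a: "f a - to_laurent g \<in> loc (sq V) {a}" using g(2) unfolding loc_def by blast
  show ?thesis
  proof (rule that[OF g(1)])
    fix i
    have "f i - to_laurent g = (f i - f a) + (f a - to_laurent g)" by simp
    moreover have "f i - f a \<in> loc (sq V) {a, i}" using ff[of i a] by (simp add: insert_commute)
    moreover have "f a - to_laurent g \<in> loc (sq V) {a, i}"
      using a loc_mono[OF is_ideal_sq, of "{a}" "{a, i}"] by blast
    ultimately have "f i - to_laurent g \<in> loc (sq V) (insert a {i})"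
      using loc_add[OF is_ideal_sq] by metis
    moreover have "f i - to_laurent g \<in> loc UNIV {i}"
      by (intro loc_diff is_ideal_UNIV fl loc_to_laurent) auto
    ultimately show "f i - to_laurent g \<in> loc (sq V) {i}"
      by (rule loc_regular[where a = a, OF is_ideal_sq, rotated]) (rule reg)
  qed
qed

text \<open>Disjointness makes prescribed forms on the double lines interpolable over each \<open>x\<^sub>i \<noteq> 0\<close>:
  with \<open>x\<^sub>i\<^sup>3 = A\<^bsub>l,l'\<^esub> + B\<^bsub>l,l'\<^esub>\<close>, the product of the \<open>B\<^bsub>l,l'\<^esub>\<close> over \<open>l' \<noteq> l\<close> is a
  power of \<open>x\<^sub>i\<close> on the line \<open>l\<close> and \<open>0\<close> on the others.\<close>

lemma disjoint_double_lines_interpolate: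
  fixes V :: "nat \<Rightarrow> ('k::field_char_0 ^ 4) set"
  assumes V: "disjoint_lines n V" and g: "\<And>l. l < n \<Longrightarrow> homog d (g l)"
  obtains f where "f \<in> ideal_sections UNIV (int d) {i}"
    "\<And>l. l < n \<Longrightarrow> f - to_laurent (g l) \<in> loc (sq (V l)) {i}"
proof -
  \<comment> \<open>Each of the n - 1 other lines contributes one cubic factor.\<close>
  define N where "N = 3 * (n - 1)"
  have "\<exists>q. homog 3 q \<and> q \<in> sq (V l') \<and> var i ^ 3 - q \<in> sq (V l)"
    if l: "l < n" "l' < n" "l \<noteq> l'" for l l'
  proof -
    obtain p q where "homog 3 p" "homog 3 q" "p \<in> sq (V l)" "q \<in> sq (V l')" "var i ^ 3 = p + q"
      using var_cube_split[of "V l" "V l'" i] V l by (auto simp: disjoint_lines_def)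
    then show ?thesis by (intro exI[of _ q]) simp
  qed
  then obtain B where B: "\<And>l l'. l < n \<Longrightarrow> l' < n \<Longrightarrow> l \<noteq> l' \<Longrightarrow>
      homog 3 (B l l') \<and> B l l' \<in> sq (V l') \<and> var i ^ 3 - B l l' \<in> sq (V l)" by metis
  define e where "e l = (\<Prod>l'\<in>{..<n} - {l}. B l l')" for l
  have e_homog: "homog N (e l)" if "l < n" for l
  proof -
    have "homog (\<Sum>l'\<in>{..<n} - {l}. 3) (e l)"
      unfolding e_def by (rule homog_prod) (use B that in auto)
    then show ?thesis using that by (simp add: N_def mult.commute)
  qed
  have e_other: "e l \<in> sq (V l')" if "l < n" "l' < n" "l \<noteq> l'" for l l'
  proof -
    have "e l = B l l' * (\<Prod>k\<in>{..<n} - {l} - {l'}. B l k)"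
      unfolding e_def by (rule prod.remove) (use that in auto)
    then show ?thesis using B[OF that] by (simp add: ideal_mult_right is_ideal_sq)
  qed
  have e_self: "var i ^ N - e l \<in> sq (V l)" if "l < n" for l
  proof -
    have prod: "var i ^ (3 * card S) - (\<Prod>k\<in>S. B l k) \<in> sq (V l)"
      if "finite S" "S \<subseteq> {..<n} - {l}" for S
      using that
    proof (induction S)
      case empty
      then show ?case by (simp add: self.subspace_0 is_ideal_sq)
    next
      case (insert k S)
      \<comment> \<open>The factors are exchanged for \<open>x\<^sub>i\<^sup>3\<close> one at a
        time, so the difference telescopes.\<close>
      have "var i ^ (3 * card (insert k S)) - (\<Prod>k\<in>insert k S. B l k)
          = var i ^ 3 * (var i ^ (3 * card S) - (\<Prod>k\<in>S. B l k)) + (\<Prod>k\<in>S. B l k) * (var i ^ 3 - B l k)"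
        using insert.hyps by (simp add: power_add algebra_simps)
      moreover have "k < n" "k \<noteq> l" using insert.prems by auto
      then have "var i ^ 3 - B l k \<in> sq (V l)" using B[of l k] \<open>l < n\<close> by auto
      ultimately show ?case
        using insert by (simp add: self.subspace_add ideal_mult_left is_ideal_sq)
    qed
    show ?thesis using prod[of "{..<n} - {l}"] that by (simp add: N_def e_def)
  qed
  define h where "h = (\<Sum>l<n. e l * g l)"
  obtain f where f: "xprod {i} ^ N * f = to_laurent h" using xprod_power_divide .
  show ?thesis
  proof (rule that[of f])
    have "homog (N + d) h" unfolding h_def by (intro homog_sum homog_mult e_homog g) auto
    then have "homogeneous_laurent (int d + int (N * card {i})) (xprod {i} ^ N * f)"
      unfolding f using homogeneous_to_laurent[of "N + d" h] by (simp add: add.commute)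
    then have "homogeneous_laurent (int d) f" unfolding homogeneous_laurent_xprod_mult .
    then show "f \<in> ideal_sections UNIV (int d) {i}"
      using f by (auto simp: ideal_sections_eq loc_def)
  next
    fix l assume l: "l < n"
    have "h = e l * g l + (\<Sum>k\<in>{..<n} - {l}. e k * g k)"
      unfolding h_def by (rule sum.remove) (use l in auto)
    \<comment> \<open>On the line \<open>l\<close> the other summands vanish to second order and
      \<open>e l\<close> is congruent to \<open>var i ^ N\<close>; hence \<open>h\<close> divided by
      that power restricts to \<open>g l\<close>.\<close>
    then have "h - var i ^ N * g l = (\<Sum>k\<in>{..<n} - {l}. e k * g k) - g l * (var i ^ N - e l)"
      by (simp add: algebra_simps)
    also have "\<dots> \<in> sq (V l)"
      using l by (intro self.subspace_diff self.subspace_sum is_ideal_sq ideal_mult_left e_self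
          ideal_mult_right e_other) auto
    finally have "to_laurent (h - var i ^ N * g l) \<in> to_laurent ` sq (V l)" by blast
    moreover have "to_laurent (h - var i ^ N * g l) = xprod {i} ^ N * (f - to_laurent (g l))"
      unfolding right_diff_distrib f
      by (simp add: to_laurent_diff to_laurent_mult to_laurent_power xprod_single)
    ultimately show "f - to_laurent (g l) \<in> loc (sq (V l)) {i}"
      unfolding loc_def by auto
  qed
qed

section \<open>The Cech complex\<close>

lemma card_2_four:
  fixes \<sigma> :: "4 set"
  assumes "card \<sigma> = 2"
  obtains i j where "i < j" "\<sigma> = {i, j}"
proof -
  obtain i j where "\<sigma> = {i, j}" "i \<noteq> j" using assms by (meson card_2_iff)
  then show ?thesis using that[of i j] that[of j i] by (cases i j rule: linorder_cases) (auto simp: insert_commute)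
qed

lemma card_3_four:
  fixes \<sigma> :: "4 set"
  assumes "card \<sigma> = 3"
  obtains i j k where "i < j" "j < k" "\<sigma> = {i, j, k}"
proof -
  have ne: "\<sigma> \<noteq> {}" "finite \<sigma>" using assms by auto
  define i where "i = Min \<sigma>"
  have i: "i \<in> \<sigma>" "\<And>x. x \<in> \<sigma> \<Longrightarrow> i \<le> x" using ne by (auto simp: i_def)
  then have "card (\<sigma> - {i}) = 2" using assms by simp
  then obtain j k where jk: "j < k" "\<sigma> - {i} = {j, k}" by (rule card_2_four)
  then have "j \<in> \<sigma> - {i}" by simp
  then have "i < j" using i(2)[of j] by auto
  moreover have "\<sigma> = {i, j, k}" using jk i(1) by blast
  ultimately show ?thesis using that jk(1) by blast
qed

lemma sign_no_smaller: "{l \<in> \<sigma>. l < i} = {} \<Longrightarrow> (- 1) ^ card {l \<in> \<sigma>. l < i} = (1 :: 'k::field laurent)"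
  by (simp only: card.empty power_0)

lemma cech_d_pair: "i < j \<Longrightarrow> cech_d c $ {i, j} = c $ {j} - c $ {i}"
  for c :: "'a::field laurent ^ (4 set)"
proof -
  assume ij: "i < j"
  then have "(- 1) ^ card {l \<in> {i, j}. l < i} = (1 :: 'a laurent)" by (intro sign_no_smaller) auto
  moreover have "{l \<in> {i, j}. l < j} = {i}" using ij by auto
  moreover have "{i, j} - {i} = {j}" "{i, j} - {j} = {i}" using ij by auto
  ultimately show ?thesis using ij by (simp add: cech_d_def)
qed

lemma cech_d_triple:
  fixes c :: "'a::field laurent ^ (4 set)"
  assumes "i < j" "j < k"
  shows "cech_d c $ {i, j, k} = c $ {j, k} - c $ {i, k} + c $ {i, j}"
proof -
  have "(- 1) ^ card {l \<in> {i, j, k}. l < i} = (1 :: 'a laurent)"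
    using assms by (intro sign_no_smaller) auto
  moreover have "{l \<in> {i, j, k}. l < j} = {i}" "{l \<in> {i, j, k}. l < k} = {i, j}"
    using assms by auto
  moreover have "{i, j, k} - {i} = {j, k}" "{i, j, k} - {j} = {i, k}" "{i, j, k} - {k} = {i, j}"
    using assms by auto
  moreover have "i \<noteq> j" "i \<noteq> k" "j \<noteq> k" using assms by auto
  ultimately show ?thesis by (simp add: cech_d_def)
qed

lemma cech_d_card:
  assumes "\<And>\<tau>. card \<tau> \<noteq> p + 1 \<Longrightarrow> c $ \<tau> = 0" "card \<sigma> \<noteq> p + 2"
  shows "cech_d c $ \<sigma> = 0"
proof -
  have "c $ (\<sigma> - {i}) = 0" if "i \<in> \<sigma>" for i
  proof -
    have "card \<sigma> \<noteq> 0" using that by (auto simp: card_eq_0_iff)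
    then have "card (\<sigma> - {i}) \<noteq> p + 1" using that assms(2) by simp
    then show ?thesis by (rule assms(1))
  qed
  then show ?thesis by (simp add: cech_d_def)
qed

lemma cech_d_add: "cech_d (b + c) = cech_d b + cech_d c"
  by (simp add: cech_d_def vec_eq_iff distrib_left sum.distrib)

lemma cech_d_diff: "cech_d (b - c) = cech_d b - cech_d c"
  by (simp add: cech_d_def vec_eq_iff right_diff_distrib sum_subtractf)

lemma cech_d_scale: "cech_d (cochain_scale r c) = cochain_scale r (cech_d c)"
  by (simp only: cech_d_def cochain_scale_def vec_eq_iff vec_lambda_beta vector_smult_component
      sum_distrib_left mult.left_commute) simp

definition cochain0 :: "(4 \<Rightarrow> 'k::field laurent) \<Rightarrow> 'k laurent ^ (4 set)" where
  "cochain0 f = (\<chi> \<sigma>. if card \<sigma> = 1 then f (the_elem \<sigma>) else 0)"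

lemma cochain0_single [simp]: "cochain0 f $ {i} = f i"
  by (simp add: cochain0_def)

lemma cochain0_card: "card \<sigma> \<noteq> 1 \<Longrightarrow> cochain0 f $ \<sigma> = 0"
  by (simp add: cochain0_def)

lemma cochain0_add: "cochain0 (\<lambda>i. f i + g i) = cochain0 f + cochain0 g"
  by (simp add: cochain0_def vec_eq_iff)

lemma cochain0_diff: "cochain0 (\<lambda>i. f i - g i) = cochain0 f - cochain0 g"
  by (simp add: cochain0_def vec_eq_iff)

lemma cochain0_scale: "cochain0 (\<lambda>i. single 0 r * f i) = cochain_scale r (cochain0 f)"
  by (simp add: cochain0_def cochain_scale_def vec_eq_iff)

lemma cochain0_eqI:
  assumes "\<And>\<sigma>. card \<sigma> \<noteq> 1 \<Longrightarrow> c $ \<sigma> = 0"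
  shows "c = cochain0 (\<lambda>i. c $ {i})"
proof -
  have "c $ \<sigma> = cochain0 (\<lambda>i. c $ {i}) $ \<sigma>" for \<sigma>
  proof (cases "card \<sigma> = 1")
    case True
    then obtain i where "\<sigma> = {i}" using card_1_singletonE by blast
    then show ?thesis by simp
  qed (simp add: assms cochain0_card)
  then show ?thesis unfolding vec_eq_iff by blast
qed

lemma cochain0_in_cochains:
  "cochain0 f \<in> cech_cochains J d 0 \<longleftrightarrow> (\<forall>i. f i \<in> ideal_sections J d {i})"
proof
  assume "cochain0 f \<in> cech_cochains J d 0"
  then have "cochain0 f $ {i} \<in> ideal_sections J d {i}" for i by (auto simp: cech_cochains_def dest: spec[of _ "{i}"])
  then show "\<forall>i. f i \<in> ideal_sections J d {i}" by simp
next
  assume "\<forall>i. f i \<in> ideal_sections J d {i}"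
  then show "cochain0 f \<in> cech_cochains J d 0"
    by (auto simp: cech_cochains_def cochain0_card card_1_singleton_iff)
qed

lemma cech_d_cochain0_card: "card \<sigma> \<noteq> 2 \<Longrightarrow> cech_d (cochain0 f) $ \<sigma> = 0"
  by (rule cech_d_card[of 0]) (simp_all add: cochain0_card)

lemma cech_d_cochain0_pair: "i < j \<Longrightarrow> cech_d (cochain0 f) $ {i, j} = f j - f i"
  by (simp add: cech_d_pair)

lemma cech_d_eq_cochain0I:
  assumes "\<And>\<sigma>. card \<sigma> \<noteq> 2 \<Longrightarrow> c $ \<sigma> = 0" "\<And>i j. i < j \<Longrightarrow> c $ {i, j} = f j - f i"
  shows "c = cech_d (cochain0 f)"
proof -
  have "c $ \<sigma> = cech_d (cochain0 f) $ \<sigma>" for \<sigma>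
  proof (cases "card \<sigma> = 2")
    case True
    then obtain i j where "i < j" "\<sigma> = {i, j}" by (rule card_2_four)
    then show ?thesis using assms(2) by (simp add: cech_d_cochain0_pair)
  qed (simp add: assms(1) cech_d_cochain0_card)
  then show ?thesis by (simp add: vec_eq_iff)
qed

lemma cech_d_cech_d_cochain0: "cech_d (cech_d (cochain0 f)) = 0"
proof -
  have "cech_d (cech_d (cochain0 f)) $ \<sigma> = 0" for \<sigma>
  proof (cases "card \<sigma> = 3")
    case True
    then obtain i j k where "i < j" "j < k" "\<sigma> = {i, j, k}" by (rule card_3_four)
    then show ?thesis using less_trans[of i j k] by (simp add: cech_d_triple cech_d_cochain0_pair)
  next
    case False
    show ?thesis
      by (rule cech_d_card[of 1]) (use False in \<open>simp_all add: cech_d_cochain0_card\<close>)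
  qed
  then show ?thesis by (simp add: vec_eq_iff)
qed

lemma cech_d_cochain0_eq_0_iff: "cech_d (cochain0 f) = 0 \<longleftrightarrow> (\<forall>i j. f i = f j)"
proof
  assume z: "cech_d (cochain0 f) = 0"
  have lt: "f i = f j" if "i < j" for i j
    using cech_d_cochain0_pair[OF that, of f] z by simp
  show "\<forall>i j. f i = f j"
  proof (intro allI)
    fix i j show "f i = f j" by (cases i j rule: linorder_cases) (auto simp: lt)
  qed
next
  assume "\<forall>i j. f i = f j"
  then have "\<And>i j. f i = f j" by blast
  then show "cech_d (cochain0 f) = 0"
    by (intro cech_d_eq_cochain0I[symmetric]) auto
qed

text \<open>The alternating extension of a 1-cochain to all ordered pairs of indices, for which the
  cocycle identity holds without any assumption on the order of the indices.\<close>

definition alt :: "'k::field laurent ^ (4 set) \<Rightarrow> 4 \<Rightarrow> 4 \<Rightarrow> 'k laurent" where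
  "alt c i j = (if i < j then c $ {i, j} else if j < i then - c $ {i, j} else 0)"

lemma alt_cocycle:
  assumes "cech_d c = 0"
  shows "alt c i j + alt c j k = alt c i k"
proof -
  have base: "c $ {a, b} + c $ {b, e} = c $ {a, e}" if "a < b" "b < e" for a b e
    using cech_d_triple[OF that, of c] assms by (simp add: algebra_simps)
  show ?thesis
    using base[of i j k] base[of i k j] base[of j i k] base[of j k i] base[of k i j] base[of k j i]
    by (cases i j rule: linorder_cases; cases j k rule: linorder_cases; cases i k rule: linorder_cases)
       (auto simp: alt_def insert_commute algebra_simps)
qed

text \<open>A contracting homotopy whose base index depends on the monomial. A monomial
  \<open>m\<close> of degree d \<ge> 0 has a nonnegative exponent, at \<open>nn m\<close> say, and
  its coefficient in \<open>f i\<close> is taken from \<open>alt c (nn m) i\<close>. There only the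
  exponents at \<open>nn m\<close> and at \<open>i\<close> could be negative, and the first is not,
  so \<open>f i\<close> is a section over the chart \<open>i\<close>. The cocycle identity on
  \<open>nn m\<close>, \<open>i\<close>, \<open>j\<close> then gives
  \<open>c $ {i, j} = f j - f i\<close> for \<open>i < j\<close>.\<close>

lemma cech_H1_UNIV:
  fixes c :: "'k::field laurent ^ (4 set)"
  assumes c: "c \<in> cech_cochains UNIV d 1" "cech_d c = 0" and "0 \<le> d"
  obtains f where "\<And>i. f i \<in> ideal_sections UNIV d {i}" "c = cech_d (cochain0 f)"
proof -
  have sec: "alt c i j \<in> ideal_sections UNIV d {i, j}" for i j
  proof (cases "i = j")
    case True
    then show ?thesis by (simp add: alt_def ideal_sections_eq homogeneous_laurent_0 loc_0 is_ideal_UNIV)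
  next
    case False
    then have "c $ {i, j} \<in> ideal_sections UNIV d {i, j}"
      using c(1) by (auto simp: cech_cochains_def dest: spec[of _ "{i, j}"])
    then show ?thesis
      by (auto simp: alt_def ideal_sections_eq homogeneous_laurent_0 loc_0 is_ideal_UNIV
          loc_uminus homogeneous_laurent_uminus)
  qed
  define nn where "nn m = (SOME i. 0 \<le> lookup m i)" for m :: "4 \<Rightarrow>\<^sub>0 int"
  have nn: "0 \<le> lookup m (nn m)" if "(\<Sum>i\<in>UNIV. lookup m i) = d" for m
  proof -
    have "\<exists>i. 0 \<le> lookup m i"
    proof (rule ccontr)
      assume "\<not> ?thesis"
      then have "\<And>i. lookup m i < 0" by (auto simp: not_le)
      then have "(\<Sum>i\<in>UNIV. lookup m i) < 0" using sum_strict_mono[of UNIV "lookup m" "\<lambda>_. 0"] by simp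
      then show False using that \<open>0 \<le> d\<close> by simp
    qed
    then show ?thesis unfolding nn_def by (rule someI_ex)
  qed
  define f where "f i = (\<Sum>j\<in>UNIV. \<Sum>m\<in>{m\<in>keys (alt c j i). nn m = j}. single m (lookup (alt c j i) m))" for i
  have lk: "lookup (f i) m = lookup (alt c (nn m) i) m" for i m
  proof -
    have "lookup (f i) m = (\<Sum>j\<in>UNIV. \<Sum>n\<in>{n\<in>keys (alt c j i). nn n = j}. if n = m then lookup (alt c j i) n else 0)"
      unfolding f_def lookup_sum by (intro sum.cong) (auto simp: lookup_single when_def)
    also have "\<dots> = (\<Sum>j\<in>UNIV. if j = nn m then lookup (alt c j i) m else 0)"
      by (intro sum.cong refl) (auto simp: in_keys_iff)
    also have "\<dots> = lookup (alt c (nn m) i) m" by simp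
    finally show ?thesis .
  qed
  show ?thesis
  proof (rule that[of f])
    fix i
    have hd: "(\<Sum>i\<in>UNIV. lookup m i) = d" if "m \<in> keys (f i)" for m
      using sec[of "nn m" i] that by (auto simp: ideal_sections_eq homogeneous_laurent_def in_keys_iff lk)
    moreover have "0 \<le> lookup m j" if "m \<in> keys (f i)" "j \<noteq> i" for m j
    proof (cases "j = nn m")
      case True
      then show ?thesis using nn hd that by blast
    next
      case False
      then show ?thesis using sec[of "nn m" i] that
        by (auto simp: ideal_sections_eq loc_UNIV_iff in_keys_iff lk)
    qed
    ultimately show "f i \<in> ideal_sections UNIV d {i}"
      by (auto simp: ideal_sections_eq homogeneous_laurent_def loc_UNIV_iff)
  next
    show "c = cech_d (cochain0 f)"
    proof (rule cech_d_eq_cochain0I)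
      fix \<sigma> :: "4 set" assume "card \<sigma> \<noteq> 2"
      then show "c $ \<sigma> = 0" using c(1) by (auto simp: cech_cochains_def dest: spec[of _ \<sigma>])
    next
      fix i j :: 4 assume ij: "i < j"
      have "lookup (c $ {i, j}) m = lookup (f j - f i) m" for m
      proof -
        have "alt c (nn m) j - alt c (nn m) i = alt c i j"
          using alt_cocycle[OF c(2), of "nn m" i j] by (simp add: algebra_simps)
        then have "lookup (alt c (nn m) j - alt c (nn m) i) m = lookup (alt c i j) m" by simp
        then show ?thesis using ij by (simp add: lookup_minus lk alt_def)
      qed
      then show "c $ {i, j} = f j - f i" by (rule poly_mapping_eqI)
    qed
  qed
qed

section \<open>Dimension of quotients\<close>

lemma vector_space_cochain: "vector_space cochain_scale"
  by unfold_locales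
     (simp_all add: cochain_scale_def vec_eq_iff algebra_simps single_add mult_single)

text \<open>\<open>R\<close> induces an isomorphism from Z modulo B to Z' modulo B'. A relation
  takes the place of a map because a class in \<open>H\<^sup>1\<close> and the jets belonging to it
  are linked only through choices, so that neither determines the other outside the
  quotients.\<close>

lemma has_quotient_dim_transfer:
  fixes R :: "'a::ab_group_add \<Rightarrow> 'b::ab_group_add \<Rightarrow> bool"
    and s :: "'k::field \<Rightarrow> 'a \<Rightarrow> 'a" and s' :: "'k \<Rightarrow> 'b \<Rightarrow> 'b"
  assumes s: "vector_space s" and s': "vector_space s'"
    and R0: "R 0 0"
    and R_add: "\<And>a b x y. R a x \<Longrightarrow> R b y \<Longrightarrow> R (a + b) (x + y)"
    and R_scale: "\<And>r a x. R a x \<Longrightarrow> R (s r a) (s' r x)"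
    and tot1: "\<And>a. a \<in> Z \<Longrightarrow> \<exists>x\<in>Z'. R a x"
    and tot2: "\<And>x. x \<in> Z' \<Longrightarrow> \<exists>a\<in>Z. R a x"
    and RB: "\<And>a x. R a x \<Longrightarrow> a \<in> B \<longleftrightarrow> x \<in> B'"
    and "0 \<in> B"
    and Z': "has_quotient_dim s' Z' B' n"
  shows "has_quotient_dim s Z B n"
proof -
  interpret s: vector_space s by fact
  interpret s': vector_space s' by fact
  from Z' obtain E where E: "finite E" "card E = n" "E \<subseteq> Z'"
    and indep: "\<forall>r. (\<Sum>e\<in>E. s' (r e) e) \<in> B' \<longrightarrow> (\<forall>e\<in>E. r e = 0)"
    and gen: "\<forall>z\<in>Z'. \<exists>r. z - (\<Sum>e\<in>E. s' (r e) e) \<in> B'"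
    unfolding has_quotient_dim_def by (elim exE conjE) (rule that)
  obtain a where a: "\<And>e. e \<in> E \<Longrightarrow> a e \<in> Z" "\<And>e. e \<in> E \<Longrightarrow> R (a e) e"
    using tot2 E(3) by (metis subsetD)
  have R_sum: "R (\<Sum>e\<in>E. s (r e) (a e)) (\<Sum>e\<in>E. s' (r e) e)" for r
  proof -
    have "R (\<Sum>e\<in>F. s (r e) (a e)) (\<Sum>e\<in>F. s' (r e) e)" if "finite F" "F \<subseteq> E" for F
      using that by (induction F) (auto simp: R0 intro!: R_add R_scale a)
    then show ?thesis using E(1) by blast
  qed
  have inj: "inj_on a E"
  proof (rule inj_onI, rule ccontr)
    fix x y assume xy: "x \<in> E" "y \<in> E" "a x = a y" "x \<noteq> y"
    \<comment> \<open>If two basis elements had the same lift, their difference would lie in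
      \<open>B'\<close>, contrary to independence.\<close>
    define r :: "'b \<Rightarrow> 'k" where "r e = (if e = x then 1 else if e = y then - 1 else 0)" for e
    have "(\<Sum>e\<in>E. s (r e) (a e)) = (\<Sum>e\<in>{x, y}. s (r e) (a e))"
      by (rule sum.mono_neutral_right) (use E(1) xy in \<open>auto simp: r_def\<close>)
    also have "\<dots> = 0" using xy by (simp add: r_def)
    finally have "(\<Sum>e\<in>E. s' (r e) e) \<in> B'" using RB[OF R_sum[of r]] \<open>0 \<in> B\<close> by simp
    then have "r x = 0" using indep[rule_format, of r x] xy(1) by simp
    then show False by (simp add: r_def)
  qed
  have sums: "(\<Sum>e\<in>a ` E. s (r e) e) = (\<Sum>e\<in>E. s (r (a e)) (a e))" for r
    by (simp add: sum.reindex[OF inj])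
  show ?thesis
    unfolding has_quotient_dim_def
  proof (intro exI[of _ "a ` E"] conjI allI impI ballI)
    show "card (a ` E) = n" using card_image[OF inj] E(2) by simp
    show "a ` E \<subseteq> Z" "finite (a ` E)" using a(1) E(1) by auto
    fix r e assume "(\<Sum>e\<in>a ` E. s (r e) e) \<in> B" "e \<in> a ` E"
    then show "r e = 0"
      using indep[rule_format, of "\<lambda>e. r (a e)"] RB[OF R_sum[of "\<lambda>e. r (a e)"]] by (auto simp: sums)
  next
    fix z assume "z \<in> Z"
    then obtain x where x: "x \<in> Z'" "R z x" using tot1 by blast
    obtain r where r: "x - (\<Sum>e\<in>E. s' (r e) e) \<in> B'" using gen x(1) by (elim ballE[of _ _ x] exE) auto
    have "R (z + s (- 1) (\<Sum>e\<in>E. s (r e) (a e))) (x + s' (- 1) (\<Sum>e\<in>E. s' (r e) e))"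
      by (intro R_add x(2) R_scale R_sum)
    then have "z - (\<Sum>e\<in>E. s (r e) (a e)) \<in> B" using RB r by simp
    moreover have "(\<Sum>e\<in>a ` E. s (r (inv_into E a e)) e) = (\<Sum>e\<in>E. s (r e) (a e))"
      unfolding sum.reindex[OF inj] by (rule sum.cong) (simp_all add: inv_into_f_f[OF inj])
    ultimately show "\<exists>r. z - (\<Sum>e\<in>a ` E. s (r e) e) \<in> B"
      by (intro exI[of _ "\<lambda>e. r (inv_into E a e)"]) simp
  qed
qed

context vector_space
begin

lemma nested_bases:
  assumes "subspace Z" "subspace B" "B \<subseteq> Z" "finite S" "Z \<subseteq> span S"
  obtains C D where "C \<subseteq> D" "finite D" "independent D" "span C = B" "span D = Z"
proof -
  obtain C where C: "C \<subseteq> B" "independent C" "B \<subseteq> span C" using basis_exists[of B] by metis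
  obtain D where D: "C \<subseteq> D" "D \<subseteq> Z" "independent D" "Z \<subseteq> span D"
    using maximal_independent_subset_extend[of C Z] C assms(3) by blast
  have "finite D" using independent_span_bound[OF assms(4) D(3)] D(2) assms(5) by blast
  moreover have "span C = B" "span D = Z"
    using span_minimal[OF C(1) assms(2)] span_minimal[OF D(2) assms(1)] C D by auto
  ultimately show ?thesis using that D by blast
qed

lemma independent_sum_0:
  assumes "finite D" "independent D" "(\<Sum>v\<in>D. scale (u v) v) = 0" "v \<in> D"
  shows "u v = 0"
  using assms independent_explicit_finite_subsets[of D] by blast

text \<open>A basis of \<open>B\<close> is extended to a basis of \<open>Z\<close>; the added
  vectors represent a basis of the quotient.\<close>

lemma has_quotient_dim_diff:
  assumes "subspace Z" "subspace B" "B \<subseteq> Z" "finite S" "Z \<subseteq> span S"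
  shows "has_quotient_dim scale Z B (dim Z - dim B)"
proof -
  obtain C D where CD: "C \<subseteq> D" "finite D" "independent D" "span C = B" "span D = Z"
    using nested_bases[OF assms] .
  have "finite C" "independent C" using CD finite_subset independent_mono by blast+
  have dims: "dim Z = card D" "dim B = card C"
    using dim_span_eq_card_independent[OF CD(3)] dim_span_eq_card_independent[OF \<open>independent C\<close>] CD by auto
  have split: "(\<Sum>v\<in>D. scale (u v) v) = (\<Sum>v\<in>D - C. scale (u v) v) + (\<Sum>v\<in>C. scale (u v) v)" for u
    by (rule sum.subset_diff) (use CD in auto)
  have B: "B = range (\<lambda>u. \<Sum>v\<in>C. scale (u v) v)"
    using span_finite[OF \<open>finite C\<close>] CD by simp
  show ?thesis
    unfolding has_quotient_dim_def
  proof (intro exI[of _ "D - C"] conjI allI impI ballI)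
    show "card (D - C) = dim Z - dim B" using CD \<open>finite C\<close> dims by (simp add: card_Diff_subset)
    show "D - C \<subseteq> Z" using CD span_superset by blast
    show "finite (D - C)" using CD by simp
  next
    fix r e assume r: "(\<Sum>e\<in>D - C. scale (r e) e) \<in> B" and e: "e \<in> D - C"
    obtain u where u: "(\<Sum>e\<in>D - C. scale (r e) e) = (\<Sum>v\<in>C. scale (u v) v)" using r B by auto
    define w where "w v = (if v \<in> C then - u v else r v)" for v
    have "(\<Sum>v\<in>D. scale (w v) v) = 0"
    proof -
      have "(\<Sum>v\<in>D - C. scale (w v) v) = (\<Sum>v\<in>D - C. scale (r v) v)"
        by (rule sum.cong) (auto simp: w_def)
      moreover have "(\<Sum>v\<in>C. scale (w v) v) = - (\<Sum>v\<in>C. scale (u v) v)"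
        unfolding sum_negf[symmetric] by (rule sum.cong) (auto simp: w_def)
      ultimately show ?thesis using split[of w] u by simp
    qed
    then have "w e = 0" using independent_sum_0[OF CD(2,3)] e by blast
    then show "r e = 0" using e by (simp add: w_def)
  next
    fix z assume "z \<in> Z"
    then obtain u where "z = (\<Sum>v\<in>D. scale (u v) v)" using span_finite[OF CD(2)] CD(5) by auto
    then have "z - (\<Sum>e\<in>D - C. scale (u e) e) = (\<Sum>v\<in>C. scale (u v) v)" using split[of u] by simp
    then show "\<exists>r. z - (\<Sum>e\<in>D - C. scale (r e) e) \<in> B" using B by auto
  qed
qed

lemma has_quotient_dim_trivial:
  assumes "subspace Z" "finite S" "Z \<subseteq> span S"
  shows "has_quotient_dim scale Z {0} (dim Z)"
proof -
  have "dim {0} = 0" using dim_unique[of "{}" "{0}" 0] by (simp add: independent_empty)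
  then show ?thesis
    using has_quotient_dim_diff[of Z "{0}" S] assms by (simp add: subspace_0 subspace_single_0)
qed

text \<open>Representatives of a basis of the quotient together with a basis of \<open>B\<close>
  form a basis of \<open>Z\<close>. Only \<open>B\<close> is assumed to be finite-dimensional; for
  \<open>Z\<close> this is a consequence.\<close>

lemma dim_eq_add_quotient_dim:
  assumes "subspace Z" "subspace B" "B \<subseteq> Z" "finite S" "B \<subseteq> span S"
    and q: "has_quotient_dim scale Z B n"
  shows "dim Z = dim B + n"
proof -
  from q obtain E where E: "finite E" "card E = n" "E \<subseteq> Z"
    and indep: "\<forall>r. (\<Sum>e\<in>E. scale (r e) e) \<in> B \<longrightarrow> (\<forall>e\<in>E. r e = 0)"
    and gen: "\<forall>z\<in>Z. \<exists>r. z - (\<Sum>e\<in>E. scale (r e) e) \<in> B"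
    unfolding has_quotient_dim_def by (elim exE conjE) (rule that)
  obtain C where C: "C \<subseteq> B" "independent C" "B \<subseteq> span C" "card C = dim B" using basis_exists[of B] by metis
  have "finite C" using independent_span_bound[OF assms(4) C(2)] C(1) assms(5) by blast
  have inB: "(\<Sum>v\<in>C. scale (u v) v) \<in> B" for u
    by (intro subspace_sum subspace_scale assms) (use C in auto)
  have "E \<inter> C = {}"
  proof (rule ccontr)
    assume "E \<inter> C \<noteq> {}"
    then obtain e where e: "e \<in> E" "e \<in> B" using C by blast
    have "(\<Sum>x\<in>E. scale (if x = e then 1 else 0) x) = (\<Sum>x\<in>E. if x = e then x else 0)"
      by (rule sum.cong) auto
    also have "\<dots> = e" using e E by simp
    finally have "(\<Sum>x\<in>E. scale (if x = e then 1 else 0) x) \<in> B" using e by simp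
    then show False using indep[rule_format, of "\<lambda>x. if x = e then 1 else 0" e] e by simp
  qed
  have split: "(\<Sum>v\<in>E \<union> C. scale (u v) v) = (\<Sum>v\<in>E. scale (u v) v) + (\<Sum>v\<in>C. scale (u v) v)" for u
    by (rule sum.union_disjoint) (use E \<open>finite C\<close> \<open>E \<inter> C = {}\<close> in auto)
  have "independent (E \<union> C)"
  proof (rule independent_if_scalars_zero)
    show "finite (E \<union> C)" using E \<open>finite C\<close> by simp
    fix u x assume z: "(\<Sum>v\<in>E \<union> C. scale (u v) v) = 0" and x: "x \<in> E \<union> C"
    have "(\<Sum>v\<in>E. scale (u v) v) = - (\<Sum>v\<in>C. scale (u v) v)" using z split[of u] by (simp add: eq_neg_iff_add_eq_0)
    also have "\<dots> \<in> B" by (intro subspace_neg assms inB)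
    finally have uE: "\<forall>e\<in>E. u e = 0" using indep by blast
    then have "(\<Sum>v\<in>C. scale (u v) v) = 0" using z split[of u] by simp
    then have "\<forall>v\<in>C. u v = 0" using independent_sum_0[OF \<open>finite C\<close> C(2)] by blast
    then show "u x = 0" using uE x by blast
  qed
  moreover have "Z \<subseteq> span (E \<union> C)"
  proof
    fix z assume "z \<in> Z"
    then obtain r where "z - (\<Sum>e\<in>E. scale (r e) e) \<in> B" using gen by blast
    then have "z - (\<Sum>e\<in>E. scale (r e) e) \<in> span (E \<union> C)" using C span_mono[of C "E \<union> C"] by blast
    moreover have "(\<Sum>e\<in>E. scale (r e) e) \<in> span (E \<union> C)"
      by (intro span_sum span_scale span_base) auto
    ultimately show "z \<in> span (E \<union> C)" by (metis diff_add_cancel span_add)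
  qed
  moreover have "E \<union> C \<subseteq> Z" using E C assms by blast
  moreover have "card (E \<union> C) = dim B + n"
    using card_Un_disjoint[OF E(1) \<open>finite C\<close> \<open>E \<inter> C = {}\<close>] E C by simp
  ultimately show ?thesis using dim_unique by blast
qed

end

text \<open>The graph of \<open>f\<close> over \<open>S\<close> transfers a basis of the image to a
  basis of \<open>S\<close> modulo the kernel.\<close>

lemma rank_nullity_on:
  fixes s1 :: "'k::field \<Rightarrow> 'a::ab_group_add \<Rightarrow> 'a" and s2 :: "'k \<Rightarrow> 'b::ab_group_add \<Rightarrow> 'b"
  assumes "Vector_Spaces.linear s1 s2 f" and S: "module.subspace s1 S" "finite B" "S \<subseteq> module.span s1 B"
  shows "vector_space.dim s1 S = vector_space.dim s1 {x\<in>S. f x = 0} + vector_space.dim s2 (f ` S)"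
proof -
  interpret Vector_Spaces.linear s1 s2 f by fact
  have im: "vs2.subspace (f ` S)" by (rule subspace_image[OF S(1)])
  have ker: "vs1.subspace {x\<in>S. f x = 0}"
    using S(1) by (auto simp: vs1.subspace_def add scale zero)
  have "f ` S \<subseteq> vs2.span (f ` B)" using S(3) span_image[of B] by blast
  then have q: "has_quotient_dim s2 (f ` S) {0} (vs2.dim (f ` S))"
    using vs2.has_quotient_dim_trivial[OF im, of "f ` B"] S(2) by simp
  have "has_quotient_dim s1 S {x\<in>S. f x = 0} (vs2.dim (f ` S))"
    by (rule has_quotient_dim_transfer[where R = "\<lambda>x y. x \<in> S \<and> y = f x", OF _ _ _ _ _ _ _ _ _ q])
       (use S(1) in \<open>auto simp: vs1.vector_space_axioms vs2.vector_space_axioms zero add scale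
          vs1.subspace_0 vs1.subspace_add vs1.subspace_scale\<close>)
  then show ?thesis
    by (intro vs1.dim_eq_add_quotient_dim[of S _ B]) (use S ker in auto)
qed

section \<open>Coordinate spaces and spaces of forms with prescribed monomials\<close>

definition hscale :: "'k::field \<Rightarrow> 'k hpoly \<Rightarrow> 'k hpoly" where
  "hscale c p = single 0 c * p"

definition fscale :: "'k::field \<Rightarrow> ('i \<Rightarrow> 'k) \<Rightarrow> 'i \<Rightarrow> 'k" where
  "fscale c y = (\<lambda>i. c * y i)"

interpretation hp: vector_space "hscale :: 'k::field \<Rightarrow> 'k hpoly \<Rightarrow> 'k hpoly"
  unfolding hscale_def
  by unfold_locales (simp_all only: distrib_left distrib_right single_add mult.assoc[symmetric]
      mult_single add_0 single_one mult_1_left)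

interpretation fn: vector_space "fscale :: 'k::field \<Rightarrow> ('i \<Rightarrow> 'k) \<Rightarrow> 'i \<Rightarrow> 'k"
proof
  fix a b :: 'k and x y :: "'i \<Rightarrow> 'k"
  show "fscale a (x + y) = fscale a x + fscale a y"
    by (rule ext) (simp add: fscale_def distrib_left)
  show "fscale (a + b) x = fscale a x + fscale b x"
    by (rule ext) (simp add: fscale_def distrib_right)
  show "fscale a (fscale b x) = fscale (a * b) x"
    unfolding fscale_def by (simp only: mult.assoc)
  show "fscale 1 x = x"
    unfolding fscale_def by (rule ext) (rule mult_1_left)
qed

lemma lookup_hscale [simp]: "lookup (hscale c p) m = c * lookup p m"
  by (simp add: hscale_def lookup_const_mult)

lemma sum_fun_apply: "(\<Sum>x\<in>A. f x) i = (\<Sum>x\<in>A. f x i)" for f :: "'a \<Rightarrow> 'b \<Rightarrow> 'c::ab_group_add"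
  by (induction A rule: infinite_finite_induct) auto

text \<open>The space of vectors with entries indexed by \<open>I\<close>, realised inside the
  functions on an index type that may be infinite.\<close>

definition coords :: "'i set \<Rightarrow> ('i \<Rightarrow> 'k::field) set" where
  "coords I = {y. \<forall>i. i \<notin> I \<longrightarrow> y i = 0}"

lemma subspace_coords: "fn.subspace (coords I)"
  by (auto simp: fn.subspace_def coords_def fscale_def)

lemma coords_basis:
  assumes "finite I"
  defines "e \<equiv> \<lambda>i j. if j = i then 1 else 0 :: 'k::field"
  shows "coords I \<subseteq> fn.span (e ` I)" "fn.dim (coords I :: ('i \<Rightarrow> 'k) set) = card I"
proof -
  have inj: "inj e" by (rule injI) (metis (full_types) e_def zero_neq_one)
  have expand: "(\<Sum>v\<in>e ` I. fscale (u v) v) i = (if i \<in> I then u (e i) else 0)" for u i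
  proof -
    have "(\<Sum>v\<in>e ` I. fscale (u v) v) i = (\<Sum>j\<in>I. u (e j) * e j i)"
      using inj by (subst sum.reindex) (auto simp: sum_fun_apply fscale_def inj_on_def)
    also have "\<dots> = (\<Sum>j\<in>I. if j = i then u (e i) else 0)"
      by (rule sum.cong) (auto simp: e_def)
    finally show ?thesis using assms by simp
  qed
  show sub: "coords I \<subseteq> fn.span (e ` I)"
  proof
    fix y :: "'i \<Rightarrow> 'k" assume y: "y \<in> coords I"
    have "y = (\<Sum>v\<in>e ` I. fscale (y (inv e v)) v)"
      using y inj by (simp add: fun_eq_iff expand coords_def)
    also have "\<dots> \<in> fn.span (e ` I)" by (intro fn.span_sum fn.span_scale fn.span_base)
    finally show "y \<in> fn.span (e ` I)" .
  qed
  show "fn.dim (coords I :: ('i \<Rightarrow> 'k) set) = card I"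
  proof (rule fn.dim_unique[OF _ sub])
    show "e ` I \<subseteq> coords I" by (auto simp: coords_def e_def)
    show "card (e ` I) = card I" using inj by (simp add: card_image inj_on_subset)
    show "fn.independent (e ` I)"
    proof (rule fn.independent_if_scalars_zero)
      fix u x assume "(\<Sum>v\<in>e ` I. fscale (u v) v) = 0" "x \<in> e ` I"
      then show "u x = 0" using expand[of u] by (auto simp: fun_eq_iff split: if_splits)
    qed (use assms in simp)
  qed
qed

definition supp_in :: "(4 \<Rightarrow>\<^sub>0 nat) set \<Rightarrow> 'k::field hpoly set" where
  "supp_in M = {p. keys p \<subseteq> M}"

lemma subspace_supp_in: "hp.subspace (supp_in M)"
  unfolding hp.subspace_def supp_in_def
proof (intro conjI ballI allI)
  fix p q :: "'a hpoly" assume "p \<in> {p. keys p \<subseteq> M}" "q \<in> {p. keys p \<subseteq> M}"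
  then show "p + q \<in> {p. keys p \<subseteq> M}" using keys_add[of p q] by auto
next
  fix c and p :: "'a hpoly" assume "p \<in> {p. keys p \<subseteq> M}"
  moreover have "keys (hscale c p) \<subseteq> keys p" by (auto simp: in_keys_iff)
  ultimately show "hscale c p \<in> {p. keys p \<subseteq> M}" by auto
qed simp

lemma supp_in_basis:
  assumes "finite M"
  shows "(supp_in M :: 'k::field hpoly set) \<subseteq> hp.span ((\<lambda>m. single m 1) ` M)" "hp.dim (supp_in M :: 'k::field hpoly set) = card M"
proof -
  show sub: "(supp_in M :: 'k hpoly set) \<subseteq> hp.span ((\<lambda>m. single m 1) ` M)"
  proof
    fix p :: "'k hpoly" assume "p \<in> supp_in M"
    then have "p = (\<Sum>m\<in>M. single m (lookup p m))"
      using assms by (intro poly_mapping_sum_single) (auto simp: supp_in_def)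
    also have "\<dots> = (\<Sum>m\<in>M. hscale (lookup p m) (single m 1))"
      by (simp add: hscale_def mult_single)
    finally have p: "p = (\<Sum>m\<in>M. hscale (lookup p m) (single m 1))" .
    have "(\<Sum>m\<in>M. hscale (lookup p m) (single m 1)) \<in> hp.span ((\<lambda>m. single m 1) ` M)"
      by (intro hp.span_sum hp.span_scale hp.span_base) auto
    then show "p \<in> hp.span ((\<lambda>m. single m 1) ` M)" using p by simp
  qed
  have coordsq: "has_quotient_dim fscale (coords M :: (_ \<Rightarrow> 'k) set) {0} (card M)"
    using fn.has_quotient_dim_trivial[OF subspace_coords _ coords_basis(1)[OF assms]] assms
    by (simp add: coords_basis(2))
  have "has_quotient_dim hscale (supp_in M :: 'k hpoly set) {0} (card M)"
  proof (rule has_quotient_dim_transfer[where R = "\<lambda>p y. p \<in> supp_in M \<and> y = lookup p", OF _ _ _ _ _ _ _ _ _ coordsq])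
    fix y :: "_ \<Rightarrow> 'k" assume y: "y \<in> coords M"
    define p where "p = (\<Sum>m\<in>M. single m (y m))"
    have lk: "lookup p = y"
    proof
      fix k
      have "lookup p k = (\<Sum>m\<in>M. if m = k then y m else 0)"
        unfolding p_def lookup_sum by (rule sum.cong) (auto simp: lookup_single when_def)
      then show "lookup p k = y k" using assms y by (simp add: coords_def)
    qed
    then have "p \<in> supp_in M" using y by (auto simp: supp_in_def coords_def in_keys_iff)
    then show "\<exists>p\<in>supp_in M. p \<in> supp_in M \<and> y = lookup p" using lk by blast
  next
    fix p q :: "'k hpoly" and x y
    assume "p \<in> supp_in M \<and> x = lookup p" "q \<in> supp_in M \<and> y = lookup q"
    then show "p + q \<in> supp_in M \<and> x + y = lookup (p + q)"
      using hp.subspace_add[OF subspace_supp_in, of p M q] by (auto simp: fun_eq_iff lookup_add)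
  next
    fix r and p :: "'k hpoly" and x
    assume "p \<in> supp_in M \<and> x = lookup p"
    then show "hscale r p \<in> supp_in M \<and> fscale r x = lookup (hscale r p)"
      using hp.subspace_scale[OF subspace_supp_in, of p M r] by (auto simp: fun_eq_iff fscale_def)
  next
    fix p :: "'k hpoly" assume p: "p \<in> supp_in M"
    then have "lookup p \<in> coords M" by (auto simp: supp_in_def coords_def simp flip: not_in_keys_iff_lookup_eq_zero)
    then show "\<exists>y\<in>coords M. p \<in> supp_in M \<and> y = lookup p" using p by blast
  qed (auto simp: hp.vector_space_axioms fn.vector_space_axioms hp.subspace_0[OF subspace_supp_in]
      fun_eq_iff intro: poly_mapping_eqI)
  moreover have "hp.dim {0 :: 'k hpoly} = 0" using hp.dim_unique[of "{}" "{0 :: 'k hpoly}" 0] by (simp add: hp.independent_empty)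
  ultimately show "hp.dim (supp_in M :: 'k hpoly set) = card M"
    using hp.dim_eq_add_quotient_dim[of "supp_in M :: 'k hpoly set" "{0}" "{}" "card M"]
      subspace_supp_in[of M] by (simp add: hp.subspace_single_0 hp.subspace_0)
qed

section \<open>Monomial counts\<close>

definition mons :: "nat \<Rightarrow> (4 \<Rightarrow>\<^sub>0 nat) set" where
  "mons d = {m. (\<Sum>i\<in>UNIV. lookup m i) = d}"

text \<open>The monomials that survive modulo the square of (x_2, x_3): a basis of the degree
  \<open>d\<close> forms on a double line in standard position.\<close>

definition small_mons :: "nat \<Rightarrow> (4 \<Rightarrow>\<^sub>0 nat) set" where
  "small_mons d = {m \<in> mons d. lookup m 2 + lookup m 3 \<le> 1}"

lemma homog_iff_supp: "homog d p \<longleftrightarrow> p \<in> supp_in (mons d)"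
  by (auto simp: homog_def supp_in_def mons_def)

lemma mons_eq_image:
  "mons d = (\<lambda>(k, l, j). mon (d - j - k - l) j k l) ` (SIGMA k:{..d}. SIGMA l:{..d - k}. {..d - k - l})"
  (is "_ = ?f ` ?S")
proof
  show "mons d \<subseteq> ?f ` ?S"
  proof
    fix m assume m: "m \<in> mons d"
    then have "m = ?f (lookup m 2, lookup m 3, lookup m 1)"
      by (auto intro!: mon_eqI simp: mons_def sum_four)
    moreover have "(lookup m 2, lookup m 3, lookup m 1) \<in> ?S"
      using m by (auto simp: mons_def sum_four)
    ultimately show "m \<in> ?f ` ?S" by blast
  qed
  show "?f ` ?S \<subseteq> mons d" by (auto simp: mons_def sum_four)
qed

lemma finite_mons: "finite (mons d)"
  unfolding mons_eq_image by auto

lemma card_mon_image: "card ((\<lambda>(k, l, j). mon (d - j - k - l) j k l) ` S) = card S"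
  by (rule card_image) (auto simp: inj_on_def mon_eq_iff)

lemma card_mons_6: "card (mons 6) = 84"
  unfolding mons_eq_image card_mon_image by (simp add: eval_nat_numeral)

text \<open>There are 7 monomials in x_0, x_1 alone and 6 for each of the single factors x_2 and
  x_3.\<close>

lemma card_small_mons_6: "card (small_mons 6) = 19"
proof -
  let ?S = "SIGMA k:{..1}. SIGMA l:{..1 - k}. {..6 - k - l}"
  have "small_mons 6 = (\<lambda>(k, l, j). mon (6 - j - k - l) j k l) ` ?S" (is "_ = ?f ` _")
  proof
    show "small_mons 6 \<subseteq> ?f ` ?S"
    proof
      fix m assume m: "m \<in> small_mons 6"
      then have "m = ?f (lookup m 2, lookup m 3, lookup m 1)"
        by (auto intro!: mon_eqI simp: small_mons_def mons_def sum_four)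
      moreover have "(lookup m 2, lookup m 3, lookup m 1) \<in> ?S"
        using m by (auto simp: small_mons_def mons_def sum_four)
      ultimately show "m \<in> ?f ` ?S" by blast
    qed
    show "?f ` ?S \<subseteq> small_mons 6" by (auto simp: small_mons_def mons_def sum_four)
  qed
  then show ?thesis by (simp only: card_mon_image) (simp add: eval_nat_numeral)
qed

lemma sq_regular:
  fixes V :: "('k::field_char_0 ^ 4) set"
  assumes "is_line V"
  shows "\<exists>a. \<forall>n p. var a ^ n * p \<in> sq V \<longrightarrow> p \<in> sq V"
proof (rule sq_pivot[OF assms])
  fix a assume "\<And>n p. var a ^ n * p \<in> sq V \<Longrightarrow> p \<in> sq V"
  then show ?thesis by blast
qed

lemma is_ideal_INT: "(\<And>l. l \<in> L \<Longrightarrow> is_ideal (I l)) \<Longrightarrow> is_ideal (\<Inter>l\<in>L. I l)"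
  by (auto simp: self.subspace_def)

lemma subspace_forms: "is_ideal I \<Longrightarrow> hp.subspace {p \<in> I. homog d p}"
  by (auto simp: hp.subspace_def hscale_def self.subspace_0 self.subspace_add ideal_mult_left
      homog_add homog_scale)

lemma ord23_2_iff:
  assumes "homog d q"
  shows "q \<in> ord23 2 \<longleftrightarrow> (\<forall>m\<in>small_mons d. lookup q m = 0)"
proof
  assume "q \<in> ord23 2"
  then show "\<forall>m\<in>small_mons d. lookup q m = 0"
    by (fastforce simp: ord23_def small_mons_def simp flip: not_in_keys_iff_lookup_eq_zero)
next
  assume q: "\<forall>m\<in>small_mons d. lookup q m = 0"
  show "q \<in> ord23 2"
    unfolding ord23_def
  proof (clarify, rule ccontr)
    fix m assume "m \<in> keys q" "\<not> 2 \<le> lookup m 2 + lookup m 3"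
    moreover from this have "m \<in> small_mons d" using assms by (auto simp: small_mons_def mons_def homog_def)
    ultimately show False using q by (simp add: in_keys_iff)
  qed
qed

lemma sq_iff_jet:
  fixes A B :: "'k::field_char_0 ^ 4 ^ 4"
  assumes "A ** B = mat 1" "B ** A = mat 1" "homog d p"
  shows "p \<in> sq ((*v) A ` std_line) \<longleftrightarrow> (\<forall>m\<in>small_mons d. lookup (subst A p) m = 0)"
  using subst_in_sq_iff[OF assms(1,2), of p std_line] ord23_2_iff[OF homog_subst[OF assms(3)], of A]
  by (simp add: sq_std_line)

section \<open>Reduction of the cohomology to forms and jets\<close>

lemma cech_cochains_subset_UNIV: "cech_cochains J d p \<subseteq> cech_cochains UNIV d p"
proof
  fix c assume c: "c \<in> cech_cochains J d p"
  show "c \<in> cech_cochains UNIV d p"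
    unfolding cech_cochains_def mem_Collect_eq
  proof (intro allI)
    fix \<sigma> :: "4 set"
    show "if card \<sigma> = p + 1 then c $ \<sigma> \<in> ideal_sections UNIV d \<sigma> else c $ \<sigma> = 0"
      using c loc_subset_UNIV[of J \<sigma>] unfolding cech_cochains_def mem_Collect_eq
      by (auto simp: ideal_sections_eq dest!: spec[of _ \<sigma>] split: if_splits)
  qed
qed

text \<open>A 0-cocycle is a single Laurent polynomial that is a section on all four charts. It is a
  polynomial, and for each line the chart of a variable regular modulo \<open>sq (V l)\<close> shows
  that it lies in \<open>sq (V l)\<close>.\<close>

lemma has_h_0_if_forms:
  fixes V :: "nat \<Rightarrow> ('k::field_char_0 ^ 4) set"
  assumes V: "\<And>l. l < n \<Longrightarrow> is_line (V l)" and "0 < n"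
    and q: "has_quotient_dim hscale {p \<in> (\<Inter>l<n. sq (V l)). homog d p} {0} k"
  shows "has_h 0 (\<Inter>l<n. sq (V l)) (int d) k"
proof -
  define J where "J = (\<Inter>l<n. sq (V l))"
  have J: "is_ideal J"
    unfolding J_def by (intro is_ideal_INT is_ideal_sq)
  have glob: "p \<in> J" if "\<And>i. to_laurent p \<in> loc J {i}" for p
  proof -
    have "p \<in> sq (V l)" if l: "l < n" for l
    proof -
      obtain a where reg: "\<forall>n p. var a ^ n * p \<in> sq (V l) \<longrightarrow> p \<in> sq (V l)"
        using sq_regular[OF V[OF l]] ..
      have "loc J {a} \<subseteq> loc (sq (V l)) {a}" using l by (auto simp: J_def loc_def)
      then have "to_laurent p \<in> loc (sq (V l)) {a}" using \<open>\<And>i. to_laurent p \<in> loc J {i}\<close> by blast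
      then show ?thesis by (rule loc_regular_global[OF is_ideal_sq, rotated]) (rule reg[rule_format])
    qed
    then show ?thesis by (simp add: J_def)
  qed
  have "has_quotient_dim cochain_scale (cech_cocycles J (int d) 0) {0} k"
  proof (rule has_quotient_dim_transfer[where
        R = "\<lambda>c p. p \<in> J \<and> homog d p \<and> c = cochain0 (\<lambda>_. to_laurent p)", OF _ _ _ _ _ _ _ _ _ q[folded J_def]])
    fix c assume c: "c \<in> cech_cocycles J (int d) 0"
    define f where "f = (\<lambda>i. c $ {i})"
    have cf: "c = cochain0 f"
      unfolding f_def by (rule cochain0_eqI) (use c in \<open>auto simp: cech_cocycles_def cech_cochains_def dest: spec\<close>)
    have sec: "f i \<in> ideal_sections J (int d) {i}" for i
      using c cochain0_in_cochains[of f J "int d"] by (simp add: cf cech_cocycles_def)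
    have eq: "f i = f 0" for i
      using c cech_d_cochain0_eq_0_iff[of f] unfolding cf cech_cocycles_def by blast
    \<comment> \<open>Two charts suffice: on the first only x_0 may occur in a denominator, on the
      second only x_1.\<close>
    have "f 0 \<in> loc UNIV {0}" "f 0 \<in> loc UNIV {1}"
      using sec[of 0] sec[of 1] loc_subset_UNIV unfolding ideal_sections_eq eq[of 1] by blast+
    then obtain p where p: "f 0 = to_laurent p" by (rule loc_UNIV_Int) auto
    have "p \<in> J" by (rule glob) (use sec eq p in \<open>auto simp: ideal_sections_eq\<close>)
    moreover have "homog d p" using sec[of 0] p by (simp add: ideal_sections_eq homogeneous_to_laurent)
    moreover have "c = cochain0 (\<lambda>_. to_laurent p)" unfolding cf using eq p by metis
    ultimately show "\<exists>p\<in>{p \<in> J. homog d p}. p \<in> J \<and> homog d p \<and> c = cochain0 (\<lambda>_. to_laurent p)" by blast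
  next
    fix p assume p: "p \<in> {p \<in> J. homog d p}"
    then have "cochain0 (\<lambda>_. to_laurent p) \<in> cech_cocycles J (int d) 0"
      by (auto simp: cech_cocycles_def cochain0_in_cochains ideal_sections_eq homogeneous_to_laurent
          loc_to_laurent cech_d_cochain0_eq_0_iff)
    then show "\<exists>c\<in>cech_cocycles J (int d) 0. p \<in> J \<and> homog d p \<and> c = cochain0 (\<lambda>_. to_laurent p)"
      using p by blast
  next
    fix c p assume "p \<in> J \<and> homog d p \<and> c = cochain0 (\<lambda>_. to_laurent p)"
    moreover have "cochain0 (\<lambda>_. to_laurent p) = 0 \<longleftrightarrow> p = 0"
    proof
      assume "cochain0 (\<lambda>_. to_laurent p) = 0"
      then have "cochain0 (\<lambda>_. to_laurent p) $ {0} = 0" by simp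
      then show "p = 0" using to_laurent_eq_iff[of p 0] by simp
    qed (simp add: cochain0_def vec_eq_iff)
    ultimately show "c \<in> {0} \<longleftrightarrow> p \<in> {0}" by simp
  next
    fix a b x y
    assume "x \<in> J \<and> homog d x \<and> a = cochain0 (\<lambda>_. to_laurent x)"
      "y \<in> J \<and> homog d y \<and> b = cochain0 (\<lambda>_. to_laurent y)"
    then show "x + y \<in> J \<and> homog d (x + y) \<and> a + b = cochain0 (\<lambda>_. to_laurent (x + y))"
      by (simp add: self.subspace_add[OF J] homog_add to_laurent_add cochain0_add)
  next
    fix r a x
    assume "x \<in> J \<and> homog d x \<and> a = cochain0 (\<lambda>_. to_laurent x)"
    then show "hscale r x \<in> J \<and> homog d (hscale r x) \<and>
        cochain_scale r a = cochain0 (\<lambda>_. to_laurent (hscale r x))"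
      by (simp add: hscale_def ideal_mult_left[OF J] homog_scale to_laurent_mult to_laurent_const cochain0_scale)
  next
    show "0 \<in> J \<and> homog d 0 \<and> 0 = cochain0 (\<lambda>_. to_laurent 0)"
      by (simp add: self.subspace_0[OF J] cochain0_def vec_eq_iff)
  qed (simp_all add: vector_space_cochain hp.vector_space_axioms)
  then show ?thesis by (simp add: has_h_def cech_coboundaries_def J_def)
qed

text \<open>Each line carries its own form \<open>g l\<close>, because sections on a disjoint union
  are independent of each other; a constant family is the restriction of one global form. Entries
  outside the index range are 0, which places the result in \<open>coords\<close>.\<close>

definition jets ::
  "(nat \<Rightarrow> 'k::field ^ 4 ^ 4) \<Rightarrow> nat \<Rightarrow> nat \<Rightarrow> (nat \<Rightarrow> 'k hpoly) \<Rightarrow> (nat \<times> (4 \<Rightarrow>\<^sub>0 nat) \<Rightarrow> 'k)" where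
  "jets A n d g = (\<lambda>(l, m). if l < n \<and> m \<in> small_mons d then lookup (subst (A l) (g l)) m else 0)"

lemma jets_add: "jets A n d (\<lambda>l. g l + h l) = jets A n d g + jets A n d h"
  by (auto simp: jets_def fun_eq_iff subst_simps lookup_add)

lemma jets_scale: "jets A n d (\<lambda>l. hscale r (g l)) = fscale r (jets A n d g)"
  by (auto simp: jets_def fun_eq_iff fscale_def hscale_def subst_simps lookup_const_mult)

lemma jets_0: "jets A n d (\<lambda>_. 0) = 0"
  by (auto simp: jets_def fun_eq_iff subst_simps)

text \<open>\<open>H\<^sup>1\<close> of the ideal sheaf is the cokernel of the evaluation of forms on the double lines, where
  sections on the double line \<open>l\<close> are recorded by their jets in the coordinates \<open>A l\<close>.\<close>

lemma has_h_1_if_jets: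
  fixes V :: "nat \<Rightarrow> ('k::field_char_0 ^ 4) set"
  assumes V: "disjoint_lines n V" and n: "0 < n"
    and AB: "\<And>l. l < n \<Longrightarrow> A l ** B l = mat 1" "\<And>l. l < n \<Longrightarrow> B l ** A l = mat 1"
      "\<And>l. l < n \<Longrightarrow> V l = (*v) (A l) ` std_line"
    and q: "has_quotient_dim fscale (coords ({..<n} \<times> small_mons d))
      ((\<lambda>s. jets A n d (\<lambda>_. s)) ` {s. homog d s}) k"
  shows "has_h 1 (\<Inter>l<n. sq (V l)) (int d) k"
proof -
  define J where "J = (\<Inter>l<n. sq (V l))"
  have line: "is_line (V l)" if "l < n" for l using V that by (simp add: disjoint_lines_def)
  have sqV: "p \<in> sq (V l) \<longleftrightarrow> (\<forall>m\<in>small_mons d. lookup (subst (A l) p) m = 0)"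
    if "l < n" "homog d p" for l p
    using sq_iff_jet[OF AB(1,2) that(2)] AB(3) that(1) by simp
  have jets_eq: "jets A n d g = jets A n d h \<longleftrightarrow> (\<forall>l<n. g l - h l \<in> sq (V l))"
    if "\<And>l. l < n \<Longrightarrow> homog d (g l)" "\<And>l. l < n \<Longrightarrow> homog d (h l)" for g h
  proof -
    have "jets A n d g = jets A n d h \<longleftrightarrow>
        (\<forall>l<n. \<forall>m\<in>small_mons d. lookup (subst (A l) (g l - h l)) m = 0)"
      by (auto simp: jets_def fun_eq_iff subst_simps lookup_minus)
    then show ?thesis using that by (simp add: sqV homog_diff)
  qed
  \<comment> \<open>The connecting homomorphism from sections on the double lines to
    \<open>H\<^sup>1\<close>, as a relation: \<open>f\<close> lifts the sections \<open>g l\<close>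
    chart by chart to the structure sheaf of the whole space, and \<open>c\<close> is the coboundary
    of the lift.\<close>
  define R where "R c y \<longleftrightarrow> (\<exists>f g. (\<forall>i. f i \<in> ideal_sections UNIV (int d) {i}) \<and> c = cech_d (cochain0 f) \<and>
      (\<forall>l<n. homog d (g l) \<and> (\<forall>i. f i - to_laurent (g l) \<in> loc (sq (V l)) {i})) \<and> y = jets A n d g)" for c y
  have "has_quotient_dim cochain_scale (cech_cocycles J (int d) 1) (cech_d ` cech_cochains J (int d) 0) k"
  proof (rule has_quotient_dim_transfer[where R = R, OF _ _ _ _ _ _ _ _ _ q])
    show "R 0 0"
      unfolding R_def
      by (intro exI[of _ "\<lambda>_. 0"])
         (auto simp: ideal_sections_eq homogeneous_laurent_0 loc_0 is_ideal_UNIV is_ideal_sq jets_0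
           cech_d_cochain0_eq_0_iff)
  next
    fix a b x y assume "R a x" "R b y"
    then obtain f g f' g' where
      1: "\<forall>i. f i \<in> ideal_sections UNIV (int d) {i}" "a = cech_d (cochain0 f)"
        "\<forall>l<n. homog d (g l) \<and> (\<forall>i. f i - to_laurent (g l) \<in> loc (sq (V l)) {i})" "x = jets A n d g"
      and 2: "\<forall>i. f' i \<in> ideal_sections UNIV (int d) {i}" "b = cech_d (cochain0 f')"
        "\<forall>l<n. homog d (g' l) \<and> (\<forall>i. f' i - to_laurent (g' l) \<in> loc (sq (V l)) {i})" "y = jets A n d g'"
      unfolding R_def by blast
    have "(f i + f' i) - to_laurent (g l + g' l) \<in> loc (sq (V l)) {i}" if "l < n" for l i
      using loc_add[OF is_ideal_sq, of "f i - to_laurent (g l)" "V l" "{i}" "f' i - to_laurent (g' l)"] 1(3) 2(3) that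
      by (simp add: to_laurent_add algebra_simps)
    then show "R (a + b) (x + y)"
      unfolding R_def
      by (intro exI[of _ "\<lambda>i. f i + f' i"] exI[of _ "\<lambda>l. g l + g' l"])
         (use 1 2 in \<open>auto simp: ideal_sections_eq homogeneous_laurent_add loc_add is_ideal_UNIV homog_add
            cochain0_add cech_d_add jets_add\<close>)
  next
    fix r a x assume "R a x"
    then obtain f g where
      1: "\<forall>i. f i \<in> ideal_sections UNIV (int d) {i}" "a = cech_d (cochain0 f)"
        "\<forall>l<n. homog d (g l) \<and> (\<forall>i. f i - to_laurent (g l) \<in> loc (sq (V l)) {i})" "x = jets A n d g"
      unfolding R_def by blast
    have "single 0 r * f i - to_laurent (hscale r (g l)) \<in> loc (sq (V l)) {i}" if "l < n" for l i
      using loc_scale[OF is_ideal_sq, of "f i - to_laurent (g l)" "V l" "{i}" r] 1(3) that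
      by (simp add: hscale_def to_laurent_mult to_laurent_const right_diff_distrib)
    then show "R (cochain_scale r a) (fscale r x)"
      unfolding R_def
      by (intro exI[of _ "\<lambda>i. single 0 r * f i"] exI[of _ "\<lambda>l. hscale r (g l)"])
         (use 1 in \<open>auto simp: ideal_sections_eq homogeneous_laurent_scale loc_scale is_ideal_UNIV homog_scale
            cochain0_scale cech_d_scale jets_scale[unfolded hscale_def] hscale_def\<close>)
  next
    fix c assume c: "c \<in> cech_cocycles J (int d) 1"
    then have "c \<in> cech_cochains UNIV (int d) 1" "cech_d c = 0"
      using cech_cochains_subset_UNIV by (auto simp: cech_cocycles_def)
    then obtain f where f: "\<And>i. f i \<in> ideal_sections UNIV (int d) {i}" "c = cech_d (cochain0 f)"
      by (rule cech_H1_UNIV) auto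
    have "\<exists>g. homog d g \<and> (\<forall>i. f i - to_laurent g \<in> loc (sq (V l)) {i})" if l: "l < n" for l
    proof -
      have lt: "f j - f i \<in> loc (sq (V l)) {i, j}" if "i < j" for i j
      proof -
        have "c $ {i, j} \<in> ideal_sections J (int d) {i, j}"
          using c that by (auto simp: cech_cocycles_def cech_cochains_def dest: spec[of _ "{i, j}"])
        then have "f j - f i \<in> loc J {i, j}"
          using cech_d_cochain0_pair[OF that, of f] f(2) by (simp add: ideal_sections_eq)
        then show ?thesis using l by (auto simp: J_def loc_def)
      qed
      have "f i - f j \<in> loc (sq (V l)) {i, j}" for i j
      proof (cases i j rule: linorder_cases)
        case less
        then show ?thesis using loc_uminus[OF is_ideal_sq lt[OF less]] by simp
      next
        case equal
        then show ?thesis by (simp add: loc_0 is_ideal_sq)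
      next
        case greater
        then show ?thesis using lt[OF greater] by (simp add: insert_commute)
      qed
      from double_line_glue[where f = f, OF line[OF l] f(1) this]
      show ?thesis by metis
    qed
    then obtain g where "\<forall>l<n. homog d (g l) \<and> (\<forall>i. f i - to_laurent (g l) \<in> loc (sq (V l)) {i})" by metis
    then have "R c (jets A n d g)" unfolding R_def using f by blast
    moreover have "jets A n d g \<in> coords ({..<n} \<times> small_mons d)" by (auto simp: coords_def jets_def)
    ultimately show "\<exists>y\<in>coords ({..<n} \<times> small_mons d). R c y" by blast
  next
    fix y :: "nat \<times> (4 \<Rightarrow>\<^sub>0 nat) \<Rightarrow> 'k" assume y: "y \<in> coords ({..<n} \<times> small_mons d)"
    have fin: "finite (small_mons d)" using finite_mons[of d] by (simp add: small_mons_def)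
    \<comment> \<open>On each line the polynomial with the prescribed jet, carried back from the
      coordinates \<open>A l\<close>.\<close>
    define g where "g l = subst (B l) (\<Sum>m\<in>small_mons d. single m (y (l, m)))" for l
    have g: "homog d (g l)" if "l < n" for l
      unfolding g_def
      by (intro homog_subst homog_sum) (auto simp: small_mons_def mons_def homog_def)
    have "y = jets A n d g"
    proof (rule ext, clarify)
      fix l m
      show "y (l, m) = jets A n d g (l, m)"
      proof (cases "l < n \<and> m \<in> small_mons d")
        case True
        have "jets A n d g (l, m) = (\<Sum>k\<in>small_mons d. if k = m then y (l, k) else 0)"
          using True AB(1,2)[of l] unfolding jets_def g_def
          by (simp add: subst_subst lookup_sum) (auto intro!: sum.cong simp: lookup_single when_def)
        then show ?thesis using True fin by simp
      next
        case False
        then show ?thesis using y by (auto simp: jets_def coords_def)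
      qed
    qed
    have "\<exists>f. f \<in> ideal_sections UNIV (int d) {i} \<and> (\<forall>l<n. f - to_laurent (g l) \<in> loc (sq (V l)) {i})" for i
      using disjoint_double_lines_interpolate[OF V, of d g i] g by metis
    then obtain f where f: "\<And>i. f i \<in> ideal_sections UNIV (int d) {i}"
      "\<And>i l. l < n \<Longrightarrow> f i - to_laurent (g l) \<in> loc (sq (V l)) {i}" by metis
    have "cech_d (cochain0 f) \<in> cech_cochains J (int d) 1"
      unfolding cech_cochains_def mem_Collect_eq
    proof (intro allI)
      fix \<sigma> :: "4 set"
      show "if card \<sigma> = 1 + 1 then cech_d (cochain0 f) $ \<sigma> \<in> ideal_sections J (int d) \<sigma>
          else cech_d (cochain0 f) $ \<sigma> = 0"
      proof (cases "card \<sigma> = 2")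
        case True
        then obtain i j where ij: "i < j" "\<sigma> = {i, j}" by (rule card_2_four)
        have "f j - f i \<in> loc (sq (V l)) \<sigma>" if "l < n" for l
        proof -
          have "f i - to_laurent (g l) \<in> loc (sq (V l)) \<sigma>" "f j - to_laurent (g l) \<in> loc (sq (V l)) \<sigma>"
            using f(2)[OF that] loc_mono[OF is_ideal_sq, of "{i}" \<sigma>] loc_mono[OF is_ideal_sq, of "{j}" \<sigma>] ij
            by blast+
          then show ?thesis using loc_diff[OF is_ideal_sq, of "f j - to_laurent (g l)"] by fastforce
        qed
        then have "f j - f i \<in> loc J \<sigma>"
          unfolding J_def using n by (intro loc_Inter is_ideal_sq)
        moreover have "homogeneous_laurent (int d) (f j - f i)"
          using f(1) by (simp add: ideal_sections_eq homogeneous_laurent_diff)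
        ultimately show ?thesis using True ij by (simp add: cech_d_cochain0_pair ideal_sections_eq)
      qed (simp add: cech_d_cochain0_card)
    qed
    then have "cech_d (cochain0 f) \<in> cech_cocycles J (int d) 1"
      by (simp add: cech_cocycles_def cech_d_cech_d_cochain0)
    moreover have "R (cech_d (cochain0 f)) y"
      unfolding R_def using f g \<open>y = jets A n d g\<close> by blast
    ultimately show "\<exists>c\<in>cech_cocycles J (int d) 1. R c y" by blast
  next
    fix c y assume "R c y"
    then obtain f g where
      1: "\<And>i. f i \<in> ideal_sections UNIV (int d) {i}" "c = cech_d (cochain0 f)"
        "\<And>l. l < n \<Longrightarrow> homog d (g l)" "\<And>l i. l < n \<Longrightarrow> f i - to_laurent (g l) \<in> loc (sq (V l)) {i}"
        "y = jets A n d g"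
      unfolding R_def by blast
    show "c \<in> cech_d ` cech_cochains J (int d) 0 \<longleftrightarrow> y \<in> (\<lambda>s. jets A n d (\<lambda>_. s)) ` {s. homog d s}"
    proof
      assume "c \<in> cech_d ` cech_cochains J (int d) 0"
      then obtain b where b: "b \<in> cech_cochains J (int d) 0" "c = cech_d b" by blast
      define f' where "f' = (\<lambda>i. b $ {i})"
      have bf: "b = cochain0 f'"
        unfolding f'_def by (rule cochain0_eqI) (use b in \<open>auto simp: cech_cochains_def dest: spec\<close>)
      have f': "f' i \<in> ideal_sections J (int d) {i}" for i
        using b(1) cochain0_in_cochains[of f' J "int d"] by (simp add: bf)
      \<comment> \<open>The two lifts \<open>f\<close> and \<open>f'\<close> have the same
        coboundary, so their difference is one global form \<open>s\<close>. As \<open>f'\<close> is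
        a section of the ideal sheaf, \<open>s\<close> restricts to \<open>g l\<close> on every
        double line.\<close>
      define h where "h = (\<lambda>i. f i - f' i)"
      have "cech_d (cochain0 h) = 0"
        using b(2) 1(2) by (simp add: h_def cochain0_diff cech_d_diff bf)
      then have heq: "h i = h 0" for i unfolding cech_d_cochain0_eq_0_iff by blast
      have hU: "h i \<in> loc UNIV {i}" for i
        unfolding h_def using 1(1)[of i] f'[of i] loc_subset_UNIV
        by (intro loc_diff is_ideal_UNIV) (auto simp: ideal_sections_eq)
      have "h 0 \<in> loc UNIV {0}" "h 0 \<in> loc UNIV {1}" using hU[of 0] hU[of 1] heq[of 1] by simp_all
      then obtain s where s: "h 0 = to_laurent s" by (rule loc_UNIV_Int) auto
      have "homogeneous_laurent (int d) (h 0)"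
        using 1(1)[of 0] f'[of 0] by (simp add: h_def ideal_sections_eq homogeneous_laurent_diff)
      then have hs: "homog d s" by (simp add: s homogeneous_to_laurent)
      have "g l - s \<in> sq (V l)" if l: "l < n" for l
      proof -
        obtain a where reg: "\<forall>n p. var a ^ n * p \<in> sq (V l) \<longrightarrow> p \<in> sq (V l)"
          using sq_regular[OF line[OF l]] ..
        have "f' a \<in> loc (sq (V l)) {a}"
          using f'[of a] l by (auto simp: ideal_sections_eq J_def loc_def)
        then have "f' a - (f a - to_laurent (g l)) \<in> loc (sq (V l)) {a}"
          by (rule loc_diff[OF is_ideal_sq _ 1(4)[OF l]])
        moreover have "f' a - (f a - to_laurent (g l)) = to_laurent (g l - s)"
          using heq[of a] s by (simp add: h_def to_laurent_diff algebra_simps)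
        ultimately have "to_laurent (g l - s) \<in> loc (sq (V l)) {a}" by simp
        then show ?thesis by (rule loc_regular_global[OF is_ideal_sq, rotated]) (rule reg[rule_format])
      qed
      then have "jets A n d g = jets A n d (\<lambda>_. s)" using jets_eq[of g "\<lambda>_. s"] 1(3) hs by simp
      then show "y \<in> (\<lambda>s. jets A n d (\<lambda>_. s)) ` {s. homog d s}"
        unfolding 1(5) using hs by (intro image_eqI[of _ _ s]) simp_all
    next
      assume "y \<in> (\<lambda>s. jets A n d (\<lambda>_. s)) ` {s. homog d s}"
      then obtain s where s: "homog d s" "jets A n d g = jets A n d (\<lambda>_. s)"
        unfolding 1(5) by (elim imageE) simp
      then have gs: "g l - s \<in> sq (V l)" if "l < n" for l using jets_eq[of g "\<lambda>_. s"] 1(3) that by simp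
      \<comment> \<open>Conversely, subtracting a global form with the same jets moves the lift into
        the ideal sheaf without changing its coboundary.\<close>
      define f' where "f' = (\<lambda>i. f i - to_laurent s)"
      have "f' i \<in> ideal_sections J (int d) {i}" for i
      proof -
        have "f' i \<in> loc (sq (V l)) {i}" if "l < n" for l
          using loc_add[OF is_ideal_sq 1(4)[OF that] loc_to_laurent[OF gs[OF that]], of i]
          by (simp add: f'_def to_laurent_diff)
        then have "f' i \<in> loc J {i}" unfolding J_def using n by (intro loc_Inter is_ideal_sq)
        moreover have "homogeneous_laurent (int d) (f' i)"
          using 1(1)[of i] s(1) by (simp add: f'_def ideal_sections_eq homogeneous_laurent_diff homogeneous_to_laurent)
        ultimately show ?thesis by (simp add: ideal_sections_eq)
      qed
      then have "cochain0 f' \<in> cech_cochains J (int d) 0" by (simp add: cochain0_in_cochains)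
      moreover have "cech_d (cochain0 f') = c"
      proof -
        have "cech_d (cochain0 (\<lambda>_. to_laurent s)) = 0" by (simp add: cech_d_cochain0_eq_0_iff)
        then show ?thesis by (simp add: f'_def cochain0_diff cech_d_diff 1(2))
      qed
      ultimately show "c \<in> cech_d ` cech_cochains J (int d) 0" by blast
    qed
  next
    have "cochain0 (\<lambda>_. 0) \<in> cech_cochains J (int d) 0"
      by (auto simp: cochain0_in_cochains ideal_sections_eq homogeneous_laurent_0 J_def
          intro!: loc_0 is_ideal_INT is_ideal_sq)
    moreover have "cech_d (cochain0 (\<lambda>_. 0)) = 0" by (simp add: cech_d_cochain0_eq_0_iff)
    ultimately show "0 \<in> cech_d ` cech_cochains J (int d) 0" by (metis imageI)
  qed (simp_all add: vector_space_cochain fn.vector_space_axioms)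
  then show ?thesis by (simp add: has_h_def cech_coboundaries_def J_def)
qed

text \<open>By rank and nullity both dimensions follow from \<open>h\<^sup>0 = 10\<close>: forms of degree 6 have dimension
  84, jets on four double lines have dimension \<open>4 * 19 = 76\<close>.\<close>

lemma cohomology_if_dim_10:
  fixes V :: "nat \<Rightarrow> ('k::field_char_0 ^ 4) set"
  assumes V: "disjoint_lines 4 V"
    and dim: "hp.dim {p \<in> (\<Inter>l<4. sq (V l)). homog 6 p} = 10"
  shows "has_h 0 (\<Inter>l<4. sq (V l)) 6 10" "has_h 1 (\<Inter>l<4. sq (V l)) 6 2"
proof -
  let ?S = "supp_in (mons 6) :: 'k hpoly set"
  let ?J = "{p \<in> (\<Inter>l<4. sq (V l)). homog 6 p}"
  note basis = supp_in_basis[OF finite_mons, of 6]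
  have line: "is_line (V l)" if "l < 4" for l using V that by (simp add: disjoint_lines_def)
  have J: "hp.subspace ?J" by (rule subspace_forms) (intro is_ideal_INT is_ideal_sq)
  have JS: "?J \<subseteq> ?S" by (auto simp: homog_iff_supp)
  have "has_quotient_dim hscale ?J {0} 10"
    using hp.has_quotient_dim_trivial[OF J, of "(\<lambda>m. single m 1) ` mons 6"] JS basis(1) finite_mons dim
    by auto
  then show "has_h 0 (\<Inter>l<4. sq (V l)) 6 10"
    using has_h_0_if_forms[of 4 V 6 10] line by simp
  have "\<exists>A B. A ** B = mat 1 \<and> B ** A = mat 1 \<and> V l = (*v) A ` std_line" if "l < 4" for l
    using pivot_frame[OF line[OF that]] by metis
  then obtain A B where AB: "\<And>l. l < 4 \<Longrightarrow> A l ** B l = mat 1" "\<And>l. l < 4 \<Longrightarrow> B l ** A l = mat 1"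
    "\<And>l. l < 4 \<Longrightarrow> V l = (*v) (A l) ` std_line" by metis
  define T where "T = (\<lambda>s. jets A 4 6 (\<lambda>_. s))"
  have lin: "Vector_Spaces.linear hscale fscale T"
    by unfold_locales (simp_all add: T_def jets_add jets_scale)
  have "T s = 0 \<longleftrightarrow> s \<in> (\<Inter>l<4. sq (V l))" if "homog 6 s" for s
  proof -
    have "s \<in> sq (V l) \<longleftrightarrow> (\<forall>m\<in>small_mons 6. lookup (subst (A l) s) m = 0)" if "l < 4" for l
      using sq_iff_jet[OF AB(1,2)[OF that] \<open>homog 6 s\<close>] AB(3)[OF that] by simp
    then show ?thesis by (auto simp: T_def jets_def fun_eq_iff)
  qed
  then have ker: "{s \<in> ?S. T s = 0} = ?J" by (auto simp: homog_iff_supp)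
  have "hp.dim ?S = hp.dim {s \<in> ?S. T s = 0} + fn.dim (T ` ?S)"
    using rank_nullity_on[OF lin subspace_supp_in, of "(\<lambda>m. single m 1) ` mons 6" "mons 6"] basis(1) finite_mons
    by simp
  moreover have "hp.dim ?S = 84" using basis(2) card_mons_6 by simp
  \<comment> \<open>The image has dimension 84 - 10 = 74 in the jets of dimension 76; the cokernel
    has dimension 2.\<close>
  ultimately have "fn.dim (T ` ?S) = 74" using ker dim by simp
  moreover
  let ?I = "{..<4::nat} \<times> small_mons 6"
  have fin: "finite ?I" using finite_mons[of 6] by (simp add: small_mons_def)
  have "card ?I = 76" by (simp add: card_cartesian_product card_small_mons_6)
  moreover have "fn.subspace (T ` ?S)"
    using Vector_Spaces.linear.axioms(3)[OF lin] module_hom.subspace_image[OF _ subspace_supp_in] by blast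
  moreover have "T ` ?S \<subseteq> coords ?I" by (auto simp: T_def jets_def coords_def)
  ultimately have "has_quotient_dim fscale (coords ?I) (T ` ?S) 2"
    using fn.has_quotient_dim_diff[OF subspace_coords _ _ _ coords_basis(1)[OF fin], of "T ` ?S"] fin
    by (simp add: coords_basis(2)[OF fin])
  moreover have "T ` ?S = (\<lambda>s. jets A 4 6 (\<lambda>_. s)) ` {s. homog 6 s}"
    by (auto simp: T_def homog_iff_supp)
  ultimately show "has_h 1 (\<Inter>l<4. sq (V l)) 6 2"
    using has_h_1_if_jets[OF V _ AB, of 6 2] by simp
qed

section \<open>Forms in the normal form of four lines\<close>

text \<open>The graph of a diagonal map from the (x_0, x_1)-plane to the (x_2, x_3)-plane. It meets
  the transversals x_1 = x_3 = 0 and x_0 = x_2 = 0 in the points with ratios (1 : \<alpha>) and (1 :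
  \<beta>).\<close>

definition skew_line :: "'k \<Rightarrow> 'k \<Rightarrow> ('k::field ^ 4) set" where
  "skew_line \<alpha> \<beta> = {x. x $ 2 = \<alpha> * x $ 0 \<and> x $ 3 = \<beta> * x $ 1}"

definition skew_mat :: "'k \<Rightarrow> 'k \<Rightarrow> 'k::field ^ 4 ^ 4" where
  "skew_mat \<alpha> \<beta> = frame (vec4 1 0 \<alpha> 0) (vec4 0 1 0 \<beta>) (vec4 0 0 1 0) (vec4 0 0 0 1)"

lemma skew_mat_mult: "skew_mat \<alpha> \<beta> *v x = vec4 (x$0) (x$1) (x$2 + \<alpha> * x$0) (x$3 + \<beta> * x$1)"
  by (simp add: skew_mat_def frame_mult vec_eq_four algebra_simps)

lemma skew_mat_inverse: "skew_mat \<alpha> \<beta> ** skew_mat (- \<alpha>) (- \<beta>) = mat 1"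
  by (simp add: matrix_eq skew_mat_mult vec_eq_four flip: matrix_vector_mul_assoc)

lemma skew_mat_image: "(*v) (skew_mat \<alpha> \<beta>) ` std_line = skew_line \<alpha> \<beta>"
proof
  show "(*v) (skew_mat \<alpha> \<beta>) ` std_line \<subseteq> skew_line \<alpha> \<beta>"
    by (auto simp: std_line_def skew_line_def skew_mat_mult)
  show "skew_line \<alpha> \<beta> \<subseteq> (*v) (skew_mat \<alpha> \<beta>) ` std_line"
  proof
    fix x assume "x \<in> skew_line \<alpha> \<beta>"
    then have "x = skew_mat \<alpha> \<beta> *v vec4 (x$0) (x$1) 0 0" "vec4 (x$0) (x$1) 0 0 \<in> std_line"
      by (auto simp: std_line_def skew_line_def skew_mat_mult vec_eq_four)
    then show "x \<in> (*v) (skew_mat \<alpha> \<beta>) ` std_line" by blast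
  qed
qed

lemma skew_mat_rows:
  "lin (skew_mat \<alpha> \<beta> $ 0) = var 0" "lin (skew_mat \<alpha> \<beta> $ 1) = var 1"
  "lin (skew_mat \<alpha> \<beta> $ 2) = var 2 + single 0 \<alpha> * var 0"
  "lin (skew_mat \<alpha> \<beta> $ 3) = var 3 + single 0 \<beta> * var 1"
  by (simp_all add: lin_def sum_four skew_mat_def frame_def)

text \<open>Taylor expansion to first order in \<open>u\<close>. For \<open>n = 0\<close> the
  truncated exponent \<open>n - 1\<close> comes with the factor 0.\<close>

lemma binomial_mod_square:
  fixes u v :: "'r::comm_ring_1"
  assumes I: "is_ideal I" and uu: "u * u \<in> I"
  shows "(u + v) ^ n - (v ^ n + of_nat n * v ^ (n - 1) * u) \<in> I"
proof (induction n)
  case 0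
  then show ?case by (simp add: self.subspace_0[OF I])
next
  case (Suc n)
  define X where "X = of_nat n * v ^ (n - 1)"
  have X: "of_nat n * v ^ n = X * v"
  proof (cases n)
    case (Suc k)
    then show ?thesis by (simp only: X_def diff_Suc_1 power_Suc mult_ac)
  qed (simp add: X_def)
  define r where "r = (u + v) ^ n - (v ^ n + X * u)"
  have "(u + v) ^ n = r + (v ^ n + X * u)" by (simp add: r_def)
  then have "(u + v) ^ Suc n = (u + v) * r + (u + v) * (v ^ n + X * u)" by (simp add: distrib_left)
  also have "(u + v) * (v ^ n + X * u) = v ^ Suc n + (X * v + v ^ n) * u + X * (u * u)"
    by (simp only: distrib_left distrib_right mult_ac add_ac power_Suc)
  also have "X * v + v ^ n = of_nat (Suc n) * v ^ (Suc n - 1)" by (simp add: X[symmetric] distrib_right)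
  finally have "(u + v) ^ Suc n - (v ^ Suc n + of_nat (Suc n) * v ^ (Suc n - 1) * u) = (u + v) * r + X * (u * u)"
    by simp
  moreover have "r \<in> I" using Suc by (simp add: r_def X_def)
  then have "(u + v) * r + X * (u * u) \<in> I" by (intro self.subspace_add[OF I] ideal_mult_left[OF I] uu)
  ultimately show ?case by (simp only:)
qed

text \<open>The first-order expansion in x_2, x_3 of a monomial after x_2 is replaced by x_2 +
  \<alpha> x_0 and x_3 by x_3 + \<beta> x_1. Wherever a subtraction is truncated, the coefficient is
  0.\<close>

definition skew_nf :: "'k \<Rightarrow> 'k \<Rightarrow> (4 \<Rightarrow>\<^sub>0 nat) \<Rightarrow> 'k \<Rightarrow> 'k::field hpoly" where
  "skew_nf \<alpha> \<beta> m c =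
     single (mon (lookup m 0 + lookup m 2) (lookup m 1 + lookup m 3) 0 0)
       (\<alpha> ^ lookup m 2 * \<beta> ^ lookup m 3 * c) +
     single (mon (lookup m 0 + lookup m 2 - 1) (lookup m 1 + lookup m 3) 1 0)
       (of_nat (lookup m 2) * \<alpha> ^ (lookup m 2 - 1) * \<beta> ^ lookup m 3 * c) +
     single (mon (lookup m 0 + lookup m 2) (lookup m 1 + lookup m 3 - 1) 0 1)
       (of_nat (lookup m 3) * \<alpha> ^ lookup m 2 * \<beta> ^ (lookup m 3 - 1) * c)"

lemma const_var_power: "(single 0 \<alpha> * var i) ^ n = single (single i n) (\<alpha> ^ n)"
proof -
  have "single 0 \<alpha> ^ n = (single 0 (\<alpha> ^ n) :: 'a hpoly)"
    by (induction n) (simp_all add: mult_single)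
  then show ?thesis by (simp add: power_mult_distrib var_power mult_single)
qed

lemma of_nat_hpoly: "of_nat n = (single 0 (of_nat n) :: 'k::field hpoly)"
  by (simp add: single_of_nat)

lemma mult_mod_ideal:
  fixes a a' b b' :: "'r::comm_ring_1"
  assumes "is_ideal I" "a - a' \<in> I" "b - b' \<in> I"
  shows "a * b - a' * b' \<in> I"
proof -
  have "a * b - a' * b' = a * (b - b') + b' * (a - a')" by (simp add: algebra_simps)
  then show ?thesis by (simp add: assms self.subspace_add ideal_mult_left)
qed

lemma expand_mod_product:
  fixes w :: "'r::comm_ring_1"
  shows "w * ((x * y - (x0 + x1) * (y0 + y1)) + x1 * y1)
      = w * x * y - (w * (x0 * y0) + w * (x1 * y0) + w * (x0 * y1))"
  by (simp only: algebra_simps)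

text \<open>The powers of x_2 + \<alpha> x_0 and x_3 + \<beta> x_1 are expanded to first order
  separately; the product of the two linear terms contains x_2 x_3 and drops out.\<close>

lemma subst_skew_mod:
  fixes m :: "4 \<Rightarrow>\<^sub>0 nat" and c :: "'k::field"
  shows "subst (skew_mat \<alpha> \<beta>) (single m c) - skew_nf \<alpha> \<beta> m c \<in> ord23 2"
proof -
  note I = is_ideal_ord23[of 2]
  define h i j k where "h = lookup m 0" and "i = lookup m 1" and "j = lookup m 2" and "k = lookup m 3"
  define x where "x = (var 2 + single 0 \<alpha> * var 0 :: 'k hpoly) ^ j"
  define y where "y = (var 3 + single 0 \<beta> * var 1 :: 'k hpoly) ^ k"
  define x1 where "x1 = (of_nat j * (single 0 \<alpha> * var 0) ^ (j - 1) * var 2 :: 'k hpoly)"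
  define y1 where "y1 = (of_nat k * (single 0 \<beta> * var 1) ^ (k - 1) * var 3 :: 'k hpoly)"
  define x0 where "x0 = (single 0 \<alpha> * var 0 :: 'k hpoly) ^ j"
  define y0 where "y0 = (single 0 \<beta> * var 1 :: 'k hpoly) ^ k"
  define w where "w = single 0 c * var 0 ^ h * (var 1 :: 'k hpoly) ^ i"
  have sq: "var a * var b \<in> (ord23 2 :: 'k hpoly set)" if "a = 2 \<or> a = 3" "b = 2 \<or> b = 3" for a b
    using that by (auto simp: ord23_def var_def mult_single lookup_add lookup_single when_def)
  have x: "x - (x0 + x1) \<in> ord23 2" unfolding x_def x0_def x1_def
    by (rule binomial_mod_square[OF I sq]) auto
  have y: "y - (y0 + y1) \<in> ord23 2" unfolding y_def y0_def y1_def
    by (rule binomial_mod_square[OF I sq]) auto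
  have "x1 * y1 = (of_nat j * (single 0 \<alpha> * var 0) ^ (j - 1)) * (of_nat k * (single 0 \<beta> * var 1) ^ (k - 1)) * (var 2 * var 3)"
    by (simp only: x1_def y1_def mult_ac)
  also have "\<dots> \<in> ord23 2" by (intro ideal_mult_left[OF I] sq) auto
  finally have xy: "x1 * y1 \<in> ord23 2" .
  have "(x * y - (x0 + x1) * (y0 + y1)) + x1 * y1 \<in> ord23 2"
    by (intro self.subspace_add[OF I] mult_mod_ideal[OF I] x y xy)
  then have "w * ((x * y - (x0 + x1) * (y0 + y1)) + x1 * y1) \<in> ord23 2" by (rule ideal_mult_left[OF I])
  then have "w * x * y - (w * (x0 * y0) + w * (x1 * y0) + w * (x0 * y1)) \<in> ord23 2"
    unfolding expand_mod_product .
  moreover have "w * x * y = subst (skew_mat \<alpha> \<beta>) (single m c)"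
    unfolding subst_single mon_eval_UNIV prod_four skew_mat_rows w_def x_def y_def h_def i_def j_def k_def
    by (simp only: mult.assoc)
  moreover have "w * (x0 * y0) + w * (x1 * y0) + w * (x0 * y1) = skew_nf \<alpha> \<beta> m c"
  proof -
    have "w * (x0 * y0) = single (mon (h + j) (i + k) 0 0) (\<alpha> ^ j * \<beta> ^ k * c)"
      unfolding w_def x0_def y0_def const_var_power var_power mult_single
      by (rule arg_cong2[where f = single]) (auto intro!: mon_eqI simp: lookup_add lookup_single when_def)
    moreover have "w * (x1 * y0) = single (mon (h + j - 1) (i + k) 1 0) (of_nat j * \<alpha> ^ (j - 1) * \<beta> ^ k * c)"
    proof (cases "j = 0")
      case False
      then show ?thesis
        unfolding w_def x1_def y0_def const_var_power var_power var_def[of 2] of_nat_hpoly mult_single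
        by (intro arg_cong2[where f = single]) (auto intro!: mon_eqI simp: lookup_add lookup_single when_def)
    qed (simp add: x1_def)
    moreover have "w * (x0 * y1) = single (mon (h + j) (i + k - 1) 0 1) (of_nat k * \<alpha> ^ j * \<beta> ^ (k - 1) * c)"
    proof (cases "k = 0")
      case False
      then show ?thesis
        unfolding w_def x0_def y1_def const_var_power var_power var_def[of 3] of_nat_hpoly mult_single
        by (intro arg_cong2[where f = single]) (auto intro!: mon_eqI simp: lookup_add lookup_single when_def)
    qed (simp add: y1_def)
    ultimately show ?thesis by (simp add: skew_nf_def h_def i_def j_def k_def)
  qed
  ultimately show ?thesis by simp
qed

text \<open>The monomial \<open>\<alpha> ^ i * \<beta> ^ k\<close> and its partial derivatives by
  \<alpha> and by \<beta>. The equations built from it express that an affine plane curve is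
  singular at (\<alpha>, \<beta>).\<close>

definition wt :: "'k \<Rightarrow> 'k \<Rightarrow> nat \<Rightarrow> nat \<Rightarrow> nat \<Rightarrow> 'k::field" where
  "wt \<alpha> \<beta> e i k = (if e = 0 then \<alpha> ^ i * \<beta> ^ k
     else if e = 1 then of_nat i * \<alpha> ^ (i - 1) * \<beta> ^ k
     else of_nat k * \<alpha> ^ i * \<beta> ^ (k - 1))"

text \<open>The values, \<open>\<partial>\<^sub>2\<close> and \<open>\<partial>\<^sub>3\<close> (for \<open>e = 0, 1, 2\<close>) along the line of the part of bidegree
  \<open>(P, d - P)\<close> in \<open>(x\<^sub>0, x\<^sub>2), (x\<^sub>1, x\<^sub>3)\<close>.\<close>

definition eqn :: "nat \<Rightarrow> 'k \<Rightarrow> 'k \<Rightarrow> nat \<Rightarrow> nat \<Rightarrow> 'k::field hpoly \<Rightarrow> 'k" where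
  "eqn d \<alpha> \<beta> e P p = (\<Sum>i\<le>P. \<Sum>k\<le>d - P. wt \<alpha> \<beta> e i k * lookup p (mon (P - i) (d - P - k) i k))"

lemma sum_bidegree:
  assumes p: "homog d p" and "P \<le> d"
  shows "(\<Sum>m\<in>keys p. if lookup m 0 + lookup m 2 = P \<and> lookup m 1 + lookup m 3 = d - P
      then wt \<alpha> \<beta> e (lookup m 2) (lookup m 3) * lookup p m else 0) = eqn d \<alpha> \<beta> e P p"
proof -
  let ?f = "\<lambda>(i, k). mon (P - i) (d - P - k) i k"
  let ?g = "\<lambda>m. wt \<alpha> \<beta> e (lookup m 2) (lookup m 3) * lookup p m"
  have inj: "inj_on ?f ({..P} \<times> {..d - P})" by (auto simp: inj_on_def mon_eq_iff)
  have "eqn d \<alpha> \<beta> e P p = (\<Sum>x\<in>{..P} \<times> {..d - P}. ?g (?f x))"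
    unfolding eqn_def sum.cartesian_product by (rule sum.cong) auto
  also have "\<dots> = (\<Sum>m\<in>?f ` ({..P} \<times> {..d - P}). ?g m)"
    using sum.reindex[OF inj, of ?g] by simp
  finally have e0: "eqn d \<alpha> \<beta> e P p = (\<Sum>m\<in>?f ` ({..P} \<times> {..d - P}). ?g m)" .
  have LR: "?f ` ({..P} \<times> {..d - P}) = {m. lookup m 0 + lookup m 2 = P \<and> lookup m 1 + lookup m 3 = d - P}"
    (is "?L = ?R")
  proof
    show "?L \<subseteq> ?R" by auto
    show "?R \<subseteq> ?L"
    proof
      fix m assume m: "m \<in> ?R"
      then have "m = ?f (lookup m 2, lookup m 3)" by (auto intro!: mon_eqI)
      then show "m \<in> ?L" using m by (intro rev_image_eqI[of "(lookup m 2, lookup m 3)"]) auto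
    qed
  qed
  have "finite ?L" by simp
  then have e: "eqn d \<alpha> \<beta> e P p = sum ?g ?R" "finite ?R"
    using e0 unfolding LR by simp_all
  have "(\<Sum>m\<in>keys p. if m \<in> ?R then ?g m else 0) = (\<Sum>m\<in>keys p \<inter> ?R. ?g m)"
    by (simp add: sum.inter_restrict)
  also have "\<dots> = sum ?g ?R"
    by (rule sum.mono_neutral_left) (use e(2) in \<open>auto simp: in_keys_iff\<close>)
  finally show ?thesis using e(1) by simp
qed

text \<open>Restricting to the line replaces x_2 by \<alpha> x_0 and x_3 by \<beta> x_1, which
  preserves the bidegree in (x_0, x_2) and (x_1, x_3). A coefficient of the jet therefore sees only
  one bidegree of \<open>p\<close>, and the conditions decouple over \<open>P\<close>.\<close>

lemma sq_skew_iff: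
  fixes p :: "'k::field_char_0 hpoly"
  assumes p: "homog d p"
  shows "p \<in> sq (skew_line \<alpha> \<beta>) \<longleftrightarrow> (\<forall>P\<le>d. \<forall>e<3. eqn d \<alpha> \<beta> e P p = 0)"
proof -
  define N where "N = (\<Sum>m\<in>keys p. skew_nf \<alpha> \<beta> m (lookup p m))"
  note I = is_ideal_ord23[of 2]
  have "p = (\<Sum>m\<in>keys p. single m (lookup p m))" by (rule poly_mapping_sum_single) auto
  then have "subst (skew_mat \<alpha> \<beta>) p = (\<Sum>m\<in>keys p. subst (skew_mat \<alpha> \<beta>) (single m (lookup p m)))"
    by (metis subst_simps(7))
  then have "subst (skew_mat \<alpha> \<beta>) p - N =
      (\<Sum>m\<in>keys p. subst (skew_mat \<alpha> \<beta>) (single m (lookup p m)) - skew_nf \<alpha> \<beta> m (lookup p m))"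
    by (simp add: N_def sum_subtractf)
  also have "\<dots> \<in> ord23 2" by (intro self.subspace_sum[OF I] subst_skew_mod)
  finally have N: "subst (skew_mat \<alpha> \<beta>) p - N \<in> ord23 2" .
  have lk: "lookup (subst (skew_mat \<alpha> \<beta>) p) m = lookup N m" if "lookup m 2 + lookup m 3 \<le> 1" for m
  proof -
    have "m \<notin> keys (subst (skew_mat \<alpha> \<beta>) p - N)" using N that by (auto simp: ord23_def)
    then show ?thesis by (simp add: in_keys_iff lookup_minus)
  qed
  have dm: "lookup m 0 + lookup m 1 + lookup m 2 + lookup m 3 = d" if "m \<in> keys p" for m
    using p that by (simp add: homog_def sum_four)
  have lk0: "lookup N (mon P (d - P) 0 0) = eqn d \<alpha> \<beta> 0 P p" if "P \<le> d" for P
    unfolding N_def lookup_sum skew_nf_def lookup_add lookup_single sum_bidegree[OF p that, symmetric]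
    by (rule sum.cong) (auto simp: when_def mon_eq_iff wt_def)
  have lk1: "lookup N (mon (P - 1) (d - P) 1 0) = eqn d \<alpha> \<beta> 1 P p" if "P \<le> d" "1 \<le> P" for P
    unfolding N_def lookup_sum skew_nf_def lookup_add lookup_single sum_bidegree[OF p that(1), symmetric]
    by (rule sum.cong) (use that dm in \<open>auto simp: when_def mon_eq_iff wt_def\<close>)
  have lk2: "lookup N (mon P (d - P - 1) 0 1) = eqn d \<alpha> \<beta> 2 P p" if "P < d" for P
    unfolding N_def lookup_sum skew_nf_def lookup_add lookup_single sum_bidegree[OF p less_imp_le[OF that], symmetric]
    by (rule sum.cong) (use that dm in \<open>auto simp: when_def mon_eq_iff wt_def\<close>)
  \<comment> \<open>No jet monomial belongs to these two equations; they hold because a part of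
    degree 0 in one pair of variables has zero derivative there.\<close>
  have triv: "eqn d \<alpha> \<beta> 1 0 p = 0" "eqn d \<alpha> \<beta> 2 d p = 0" by (simp_all add: eqn_def wt_def)
  have "p \<in> sq (skew_line \<alpha> \<beta>) \<longleftrightarrow> (\<forall>m\<in>small_mons d. lookup (subst (skew_mat \<alpha> \<beta>) p) m = 0)"
    using sq_iff_jet[OF skew_mat_inverse _ p, of \<alpha> \<beta>] skew_mat_inverse[of "- \<alpha>" "- \<beta>"]
    by (simp add: skew_mat_image)
  also have "\<dots> \<longleftrightarrow> (\<forall>m\<in>small_mons d. lookup N m = 0)" by (auto simp: small_mons_def lk)
  also have "\<dots> \<longleftrightarrow> (\<forall>P\<le>d. \<forall>e<3. eqn d \<alpha> \<beta> e P p = 0)"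
  proof
    assume z: "\<forall>m\<in>small_mons d. lookup N m = 0"
    show "\<forall>P\<le>d. \<forall>e<3. eqn d \<alpha> \<beta> e P p = 0"
    proof (intro allI impI)
      fix P e :: nat assume P: "P \<le> d" and e: "e < 3"
      have "eqn d \<alpha> \<beta> 0 P p = 0"
        using lk0[OF P] z P by (simp add: small_mons_def mons_def sum_four)
      moreover have "eqn d \<alpha> \<beta> 1 P p = 0"
      proof (cases "P = 0")
        case False
        then show ?thesis using lk1[OF P] z P by (simp add: small_mons_def mons_def sum_four)
      qed (use triv in simp)
      moreover have "eqn d \<alpha> \<beta> 2 P p = 0"
      proof (cases "P = d")
        case False
        then show ?thesis using lk2[of P] z P by (simp add: small_mons_def mons_def sum_four)
      qed (use triv in simp)
      moreover have "e = 0 \<or> e = 1 \<or> e = 2" using e by linarith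
      ultimately show "eqn d \<alpha> \<beta> e P p = 0" by auto
    qed
  next
    assume z: "\<forall>P\<le>d. \<forall>e<3. eqn d \<alpha> \<beta> e P p = 0"
    show "\<forall>m\<in>small_mons d. lookup N m = 0"
    proof
      fix m assume m: "m \<in> small_mons d"
      then have d: "lookup m 0 + lookup m 1 + lookup m 2 + lookup m 3 = d"
        by (simp add: small_mons_def mons_def sum_four)
      have "lookup m 2 + lookup m 3 \<le> 1" using m by (simp add: small_mons_def)
      then consider "lookup m 2 = 0" "lookup m 3 = 0" | "lookup m 2 = 1" "lookup m 3 = 0"
        | "lookup m 2 = 0" "lookup m 3 = 1" by linarith
      then show "lookup N m = 0"
      proof cases
        case 1
        then have "m = mon (lookup m 0) (d - lookup m 0) 0 0" using d by (intro mon_eqI) auto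
        then show ?thesis using lk0[of "lookup m 0"] z d by fastforce
      next
        case 2
        then have "m = mon (Suc (lookup m 0) - 1) (d - Suc (lookup m 0)) 1 0" using d by (intro mon_eqI) auto
        then show ?thesis using lk1[of "Suc (lookup m 0)"] z d 2 by fastforce
      next
        case 3
        then have "m = mon (lookup m 0) (d - lookup m 0 - 1) 0 1" using d by (intro mon_eqI) auto
        then show ?thesis using lk2[of "lookup m 0"] z d 3 by fastforce
      qed
    qed
  qed
  finally show ?thesis .
qed

definition swap_mat :: "'k::field ^ 4 ^ 4" where
  "swap_mat = frame (vec4 0 0 1 0) (vec4 0 0 0 1) (vec4 1 0 0 0) (vec4 0 1 0 0)"

lemma swap_mat_mult: "swap_mat *v x = vec4 (x$2) (x$3) (x$0) (x$1)"
  by (simp add: swap_mat_def frame_mult vec_eq_four)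

lemma swap_mat_inverse: "swap_mat ** swap_mat = mat 1"
  by (simp add: matrix_eq swap_mat_mult vec_eq_four flip: matrix_vector_mul_assoc)

lemma swap_mat_image: "(*v) swap_mat ` std_line = (opp_line :: ('k::field ^ 4) set)"
proof
  show "(*v) swap_mat ` std_line \<subseteq> opp_line"
    by (auto simp: std_line_def opp_line_def swap_mat_mult)
  show "(opp_line :: ('k ^ 4) set) \<subseteq> (*v) swap_mat ` std_line"
  proof
    fix x :: "'k ^ 4" assume "x \<in> opp_line"
    then have "x = swap_mat *v vec4 (x$2) (x$3) 0 0" "vec4 (x$2) (x$3) 0 0 \<in> std_line"
      by (auto simp: std_line_def opp_line_def swap_mat_mult vec_eq_four)
    then show "x \<in> (*v) swap_mat ` std_line" by blast
  qed
qed

lemma sq_opp_line_iff: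
  fixes p :: "'k::field_char_0 hpoly"
  shows "p \<in> sq opp_line \<longleftrightarrow> (\<forall>m\<in>keys p. 2 \<le> lookup m 0 + lookup m 1)"
proof -
  have rows: "lin (swap_mat $ 0) = (var 2 :: 'k hpoly)" "lin (swap_mat $ 1) = (var 3 :: 'k hpoly)"
    "lin (swap_mat $ 2) = (var 0 :: 'k hpoly)" "lin (swap_mat $ 3) = (var 1 :: 'k hpoly)"
    by (simp_all add: lin_def sum_four swap_mat_def frame_def)
  define sw where "sw m = mon (lookup m 2) (lookup m 3) (lookup m 0) (lookup m 1)" for m :: "4 \<Rightarrow>\<^sub>0 nat"
  have swsw: "sw (sw m) = m" for m by (simp add: sw_def mon_lookup)
  have "subst swap_mat p = (\<Sum>m\<in>keys p. single (sw m) (lookup p m))"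
  proof -
    have sg: "subst swap_mat (single m c) = single (sw m) c" for m and c :: 'k
      unfolding subst_single mon_eval_UNIV prod_four rows single_mon[of "sw m"]
      unfolding sw_def lookup_mon by (simp only: mult_ac)
    have p: "p = (\<Sum>m\<in>keys p. single m (lookup p m))" by (rule poly_mapping_sum_single) auto
    have "subst swap_mat p = subst swap_mat (\<Sum>m\<in>keys p. single m (lookup p m))"
      by (rule arg_cong[OF p])
    also have "\<dots> = (\<Sum>m\<in>keys p. single (sw m) (lookup p m))" by (simp only: subst_simps(7) sg)
    finally show ?thesis .
  qed
  then have "lookup (subst swap_mat p) n = (\<Sum>m\<in>keys p. lookup (single (sw m) (lookup p m)) n)" for n
    by (simp only: lookup_sum)
  moreover have "lookup (single (sw m) c) n = (if m = sw n then c else 0)" for m n and c :: 'k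
    using swsw[of m] swsw[of n] by (auto simp: lookup_single when_def)
  ultimately have "lookup (subst swap_mat p) n = (\<Sum>m\<in>keys p. if m = sw n then lookup p m else 0)" for n
    by (simp only:)
  then have "lookup (subst swap_mat p) n = lookup p (sw n)" for n
    by (simp add: in_keys_iff)
  then have lk: "n \<in> keys (subst swap_mat p) \<longleftrightarrow> sw n \<in> keys p" for n
    by (simp add: in_keys_iff)
  have "p \<in> sq opp_line \<longleftrightarrow> subst swap_mat p \<in> ord23 2"
    using subst_in_sq_iff[OF swap_mat_inverse swap_mat_inverse, of p std_line]
    by (simp add: sq_std_line swap_mat_image)
  also have "\<dots> \<longleftrightarrow> (\<forall>m\<in>keys p. 2 \<le> lookup m 0 + lookup m 1)"
  proof
    assume a: "subst swap_mat p \<in> ord23 2"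
    show "\<forall>m\<in>keys p. 2 \<le> lookup m 0 + lookup m 1"
    proof
      fix m assume "m \<in> keys p"
      then have "sw m \<in> keys (subst swap_mat p)" by (simp add: lk swsw)
      then have "2 \<le> lookup (sw m) 2 + lookup (sw m) 3" using a by (simp add: ord23_def)
      then show "2 \<le> lookup m 0 + lookup m 1" by (simp add: sw_def)
    qed
  next
    assume a: "\<forall>m\<in>keys p. 2 \<le> lookup m 0 + lookup m 1"
    show "subst swap_mat p \<in> ord23 2"
      unfolding ord23_def mem_Collect_eq
    proof
      fix m assume "m \<in> keys (subst swap_mat p)"
      then have "2 \<le> lookup (sw m) 0 + lookup (sw m) 1" using a by (simp add: lk)
      then show "2 \<le> lookup m 2 + lookup m 3" by (simp add: sw_def)
    qed
  qed
  finally show ?thesis .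
qed

text \<open>The forms \<open>x\<^sup>2 a(x) + x z b(x)\<close>, with \<open>a\<close> and \<open>b\<close> quadratic, that are singular at \<open>(1, 1)\<close> and
  at \<open>(\<alpha>, \<beta>)\<close>: both \<open>a\<close> and \<open>b\<close> are multiples of \<open>(x - 1) (x - \<alpha>)\<close>.\<close>

lemma singular_block_linear:
  fixes \<alpha> \<beta> :: "'k::field"
  assumes ab: "\<alpha> \<noteq> 0" "\<alpha> \<noteq> 1" "\<alpha> \<noteq> \<beta>"
    and 1: "a2 + a3 + a4 + (b1 + b2 + b3) = 0" "2*a2 + 3*a3 + 4*a4 + (b1 + 2*b2 + 3*b3) = 0"
      "b1 + b2 + b3 = 0"
    and 2: "\<alpha>^2*a2 + \<alpha>^3*a3 + \<alpha>^4*a4 + \<beta>*(\<alpha>*b1 + \<alpha>^2*b2 + \<alpha>^3*b3) = 0"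
      "2*\<alpha>*a2 + 3*\<alpha>^2*a3 + 4*\<alpha>^3*a4 + \<beta>*(b1 + 2*\<alpha>*b2 + 3*\<alpha>^2*b3) = 0"
      "\<alpha>*b1 + \<alpha>^2*b2 + \<alpha>^3*b3 = 0"
  shows "a2 = 0 \<and> a3 = 0 \<and> a4 = 0 \<and> b1 = 0 \<and> b2 = 0 \<and> b3 = 0"
proof -
  \<comment> \<open>A quadratic polynomial with the distinct roots 1 and \<alpha> is determined by
    its leading coefficient, first for b, then for a.\<close>
  have "\<alpha> * (1 - \<alpha>) * (b2 + (1 + \<alpha>) * b3) = 0" using 1(3) 2(3) by algebra
  then have b2: "b2 = - ((1 + \<alpha>) * b3)" using ab by (simp add: eq_neg_iff_add_eq_0)
  then have b1: "b1 = \<alpha> * b3" using 1(3) by algebra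
  have "\<alpha>^2 * (1 - \<alpha>) * (a3 + (1 + \<alpha>) * a4) = 0" using 1(1,3) 2(1,3) by algebra
  then have a3: "a3 = - ((1 + \<alpha>) * a4)" using ab by (simp add: eq_neg_iff_add_eq_0)
  then have a2: "a2 = \<alpha> * a4" using 1(1,3) by algebra
  \<comment> \<open>The derivatives by x at the two points relate the two leading coefficients by a4
    = - b3 and \<alpha> a4 = - \<beta> b3, which are incompatible unless both vanish.\<close>
  have "(1 - \<alpha>) * (a4 + b3) = 0" using 1(2) unfolding a2 a3 b1 b2 by algebra
  then have a4: "a4 = - b3" using ab by (simp add: eq_neg_iff_add_eq_0)
  have "\<alpha> * (\<alpha> - 1) * (\<alpha> * a4 + \<beta> * b3) = 0" using 2(2) unfolding a2 a3 b1 b2 by algebra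
  then have "\<alpha> * a4 + \<beta> * b3 = 0" using ab by simp
  then have "(\<beta> - \<alpha>) * b3 = 0" unfolding a4 by algebra
  then have "b3 = 0" using ab by simp
  then show ?thesis using a2 a3 a4 b1 b2 by simp
qed

text \<open>The form is \<open>x\<^sup>2 a(x) + x z b(x) + z\<^sup>2 c(x)\<close>-like, with linear
  a, quadratic b as before and quadratic c. The two extra conditions make c vanish at 1 and
  \<alpha>; the derivatives by z then do the same for b, and the values for a, which is therefore 0.
  The derivatives by x compare the leading coefficients of b and c.\<close>

lemma singular_block_quadratic:
  fixes \<alpha> \<beta> :: "'k::field"
  assumes ab: "\<alpha> \<noteq> 0" "\<alpha> \<noteq> 1" "\<alpha> \<noteq> \<beta>" "\<beta> \<noteq> 0"
    and 1: "a2 + a3 + (b1 + b2 + b3) + (c0 + c1 + c2) = 0"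
      "2*a2 + 3*a3 + (b1 + 2*b2 + 3*b3) + (c1 + 2*c2) = 0"
      "b1 + b2 + b3 + 2*(c0 + c1 + c2) = 0"
    and 2: "\<alpha>^2*a2 + \<alpha>^3*a3 + \<beta>*(\<alpha>*b1 + \<alpha>^2*b2 + \<alpha>^3*b3) + \<beta>^2*(c0 + \<alpha>*c1 + \<alpha>^2*c2) = 0"
      "2*\<alpha>*a2 + 3*\<alpha>^2*a3 + \<beta>*(b1 + 2*\<alpha>*b2 + 3*\<alpha>^2*b3) + \<beta>^2*(c1 + 2*\<alpha>*c2) = 0"
      "\<alpha>*b1 + \<alpha>^2*b2 + \<alpha>^3*b3 + 2*\<beta>*(c0 + \<alpha>*c1 + \<alpha>^2*c2) = 0"
    and 3: "c0 + c1 + c2 = 0" "c0 + \<alpha>*c1 + \<alpha>^2*c2 = 0"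
  shows "a2 = 0 \<and> a3 = 0 \<and> b1 = 0 \<and> b2 = 0 \<and> b3 = 0 \<and> c0 = 0 \<and> c1 = 0 \<and> c2 = 0"
proof -
  have "(1 - \<alpha>) * (c1 + (1 + \<alpha>) * c2) = 0" using 3 by algebra
  then have c1: "c1 = - ((1 + \<alpha>) * c2)" using ab by (simp add: eq_neg_iff_add_eq_0)
  then have c0: "c0 = \<alpha> * c2" using 3(1) by algebra
  have bsum: "b1 + b2 + b3 = 0" "\<alpha>*b1 + \<alpha>^2*b2 + \<alpha>^3*b3 = 0" using 1(3) 2(3) 3 by simp_all
  then have "\<alpha> * (1 - \<alpha>) * (b2 + (1 + \<alpha>) * b3) = 0" by algebra
  then have b2: "b2 = - ((1 + \<alpha>) * b3)" using ab by (simp add: eq_neg_iff_add_eq_0)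
  then have b1: "b1 = \<alpha> * b3" using bsum(1) by algebra
  have asum: "a2 + a3 = 0" "\<alpha>^2*a2 + \<alpha>^3*a3 = 0" using 1(1) 2(1) bsum 3 by simp_all
  then have "\<alpha>^2 * (1 - \<alpha>) * a3 = 0" by algebra
  then have a3: "a3 = 0" using ab by simp
  then have a2: "a2 = 0" using asum(1) by simp
  have "(1 - \<alpha>) * (b3 + c2) = 0" using 1(2) unfolding a2 a3 b1 b2 c1 by algebra
  then have b3: "b3 = - c2" using ab by (simp add: eq_neg_iff_add_eq_0)
  have "\<beta> * (\<alpha> - 1) * (\<alpha> * b3 + \<beta> * c2) = 0" using 2(2) unfolding a2 a3 b1 b2 c1 by algebra
  then have "\<alpha> * b3 + \<beta> * c2 = 0" using ab by simp
  then have "(\<beta> - \<alpha>) * c2 = 0" unfolding b3 by algebra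
  then have "c2 = 0" using ab by simp
  then show ?thesis using a2 a3 b1 b2 b3 c0 c1 by simp
qed

section \<open>Sextics singular along four lines in normal form\<close>

definition normal_lines :: "'k \<Rightarrow> 'k \<Rightarrow> nat \<Rightarrow> ('k::field ^ 4) set" where
  "normal_lines \<alpha> \<beta> l = (if l = 0 then std_line else if l = 1 then opp_line
     else if l = 2 then skew_line 1 1 else skew_line \<alpha> \<beta>)"

lemma less_4_cases: "(l::nat) < 4 \<longleftrightarrow> l = 0 \<or> l = 1 \<or> l = 2 \<or> l = 3"
  by auto

text \<open>In degree 6, order two along the line x_0 = x_1 = 0 means degree at most 4 in x_2, x_3;
  so the first two lines only restrict the monomials, and the other two give linear
  equations.\<close>

lemma normal_sextics_iff:
  fixes p :: "'k::field_char_0 hpoly"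
  shows "p \<in> (\<Inter>l<4. sq (normal_lines \<alpha> \<beta> l)) \<and> homog 6 p \<longleftrightarrow> homog 6 p \<and>
    (\<forall>m\<in>keys p. 2 \<le> lookup m 2 + lookup m 3 \<and> lookup m 2 + lookup m 3 \<le> 4) \<and>
    (\<forall>P\<le>6. \<forall>e<3. eqn 6 1 1 e P p = 0 \<and> eqn 6 \<alpha> \<beta> e P p = 0)"
proof (cases "homog 6 p")
  case True
  have dm: "lookup m 0 + lookup m 1 + lookup m 2 + lookup m 3 = 6" if "m \<in> keys p" for m
    using True that by (simp add: homog_def sum_four)
  have "{..<4::nat} = {0, 1, 2, 3}" by auto
  then have "p \<in> (\<Inter>l<4. sq (normal_lines \<alpha> \<beta> l)) \<longleftrightarrow>
      p \<in> sq std_line \<and> p \<in> sq opp_line \<and> p \<in> sq (skew_line 1 1) \<and> p \<in> sq (skew_line \<alpha> \<beta>)"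
    by (simp add: normal_lines_def)
  moreover have "p \<in> sq std_line \<and> p \<in> sq opp_line \<longleftrightarrow>
      (\<forall>m\<in>keys p. 2 \<le> lookup m 2 + lookup m 3 \<and> lookup m 2 + lookup m 3 \<le> 4)"
  proof -
    have "2 \<le> lookup m 0 + lookup m 1 \<longleftrightarrow> lookup m 2 + lookup m 3 \<le> 4" if "m \<in> keys p" for m
      using dm[OF that] by linarith
    then show ?thesis unfolding sq_opp_line_iff sq_std_line ord23_def by blast
  qed
  ultimately show ?thesis using True sq_skew_iff[OF True, of 1 1] sq_skew_iff[OF True, of \<alpha> \<beta>] by blast
qed simp

text \<open>The monomials that the first two lines leave in the bidegrees (P, 6 - P) with P = 2, 3,
  4. Their numbers are 9, 10 and 9.\<close>

definition mid_mons :: "(4 \<Rightarrow>\<^sub>0 nat) set" where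
  "mid_mons = (\<lambda>(P, i, k). mon (P - i) (6 - P - k) i k) `
     (SIGMA P:{2..4}. SIGMA i:{..P}. {2 - i..min (6 - P) (4 - i)})"

lemma mid_mons: "m \<in> mid_mons \<longleftrightarrow> m \<in> mons 6 \<and> 2 \<le> lookup m 2 + lookup m 3 \<and> lookup m 2 + lookup m 3 \<le> 4 \<and>
    2 \<le> lookup m 0 + lookup m 2 \<and> lookup m 0 + lookup m 2 \<le> 4"
proof
  assume "m \<in> mid_mons"
  then show "m \<in> mons 6 \<and> 2 \<le> lookup m 2 + lookup m 3 \<and> lookup m 2 + lookup m 3 \<le> 4 \<and>
    2 \<le> lookup m 0 + lookup m 2 \<and> lookup m 0 + lookup m 2 \<le> 4"
    by (auto simp: mid_mons_def mons_def sum_four)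
next
  assume m: "m \<in> mons 6 \<and> 2 \<le> lookup m 2 + lookup m 3 \<and> lookup m 2 + lookup m 3 \<le> 4 \<and>
    2 \<le> lookup m 0 + lookup m 2 \<and> lookup m 0 + lookup m 2 \<le> 4"
  define P where "P = lookup m 0 + lookup m 2"
  have "m = mon (P - lookup m 2) (6 - P - lookup m 3) (lookup m 2) (lookup m 3)"
    using m by (intro mon_eqI) (auto simp: P_def mons_def sum_four)
  then show "m \<in> mid_mons" unfolding mid_mons_def
    by (intro rev_image_eqI[of "(P, lookup m 2, lookup m 3)"])
       (use m in \<open>auto simp: P_def mons_def sum_four\<close>)
qed

lemma finite_mid_mons: "finite mid_mons"
  by (simp add: mid_mons_def)

lemma card_mid_mons: "card mid_mons = 28"
proof -
  have "{2..4::nat} = {2, 3, 4}" by auto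
  then have "card (SIGMA P:{2..4::nat}. SIGMA i:{..P}. {2 - i..min (6 - P) (4 - i)}) = 28"
    by (simp add: eval_nat_numeral)
  moreover have "inj_on (\<lambda>(P, i, k). mon (P - i) (6 - P - k) i k)
      (SIGMA P:{2..4}. SIGMA i:{..P}. {2 - i..min (6 - P) (4 - i)})"
    by (auto simp: inj_on_def mon_eq_iff)
  ultimately show ?thesis unfolding mid_mons_def by (simp add: card_image)
qed

lemma eqn_add: "eqn d \<alpha> \<beta> e P (p + q) = eqn d \<alpha> \<beta> e P p + eqn d \<alpha> \<beta> e P q"
  by (simp add: eqn_def lookup_add distrib_left sum.distrib)

lemma eqn_scale: "eqn d \<alpha> \<beta> e P (hscale c p) = c * eqn d \<alpha> \<beta> e P p"
  by (simp only: eqn_def sum_distrib_left lookup_hscale mult.left_commute[of _ c])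

text \<open>28 coefficients are subject to three conditions at each of two points in each of three
  bidegrees, which leaves at least 28 - 18 dimensions. In the remaining bidegrees all coefficients
  are 0.\<close>

lemma dim_normal_sextics_ge:
  fixes \<alpha> \<beta> :: "'k::field_char_0"
  defines "J \<equiv> {p \<in> (\<Inter>l<4. sq (normal_lines \<alpha> \<beta> l)). homog 6 p}"
  obtains K where "hp.subspace K" "K \<subseteq> J" "10 \<le> hp.dim K"
proof -
  \<comment> \<open>The index \<open>e\<close> runs through the three conditions at (1, 1) and then,
    shifted by 3, through those at (\<alpha>, \<beta>).\<close>
  define T :: "'k hpoly \<Rightarrow> nat \<times> nat \<Rightarrow> 'k" where
    "T p = (\<lambda>(P, e). if P \<in> {2..4} \<and> e < 6 then
       (if e < 3 then eqn 6 1 1 e P p else eqn 6 \<alpha> \<beta> (e - 3) P p) else 0)" for p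
  have lin: "Vector_Spaces.linear hscale fscale T"
    by unfold_locales (auto simp: T_def fun_eq_iff fscale_def eqn_add eqn_scale)
  let ?S = "supp_in mid_mons :: 'k hpoly set"
  let ?I = "{2..4::nat} \<times> {..<6::nat}"
  define K where "K = {p \<in> ?S. T p = 0}"
  note basis = supp_in_basis[OF finite_mid_mons, where 'k = 'k]
  have "hp.dim ?S = hp.dim K + fn.dim (T ` ?S)"
    unfolding K_def
    by (rule rank_nullity_on[OF lin subspace_supp_in _ basis(1)]) (simp add: finite_mid_mons)
  moreover have "T ` ?S \<subseteq> coords ?I" by (auto simp: T_def coords_def)
  then have "T ` ?S \<subseteq> fn.span ((\<lambda>i j. if j = i then 1 else 0) ` ?I)"
    using coords_basis(1)[of ?I] by auto
  then have "fn.dim (T ` ?S) \<le> card ((\<lambda>i j. if j = i then 1 else 0 :: 'k) ` ?I)"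
    by (rule fn.dim_le_card) simp
  moreover have "card ((\<lambda>i j. if j = i then 1 else 0 :: 'k) ` ?I) \<le> 18"
    by (rule order_trans[OF card_image_le]) simp_all
  ultimately have dim: "10 \<le> hp.dim K" using basis(2) by (simp add: card_mid_mons)
  have "K \<subseteq> J"
  proof
    fix p assume p: "p \<in> K"
    then have keys: "keys p \<subseteq> mid_mons" and T: "T p = 0" by (auto simp: K_def supp_in_def)
    have "eqn 6 1 1 e P p = 0 \<and> eqn 6 \<alpha> \<beta> e P p = 0" if "P \<le> 6" "e < 3" for P e
    proof (cases "P \<in> {2..4}")
      case True
      have "T p (P, e) = 0" "T p (P, e + 3) = 0" using T by simp_all
      then show ?thesis using True that by (simp add: T_def)
    next
      case False
      have "lookup p (mon (P - i) (6 - P - k) i k) = 0" if "i \<le> P" for i k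
      proof -
        have "mon (P - i) (6 - P - k) i k \<notin> mid_mons" using False that by (auto simp: mid_mons)
        then show ?thesis using keys by (auto simp flip: not_in_keys_iff_lookup_eq_zero)
      qed
      then show ?thesis by (simp add: eqn_def)
    qed
    moreover have "homog 6 p" using keys by (auto simp: homog_def mid_mons mons_def)
    moreover have "\<forall>m\<in>keys p. 2 \<le> lookup m 2 + lookup m 3 \<and> lookup m 2 + lookup m 3 \<le> 4"
      using keys by (auto simp: mid_mons)
    ultimately show "p \<in> J" unfolding J_def mem_Collect_eq normal_sextics_iff by blast
  qed
  moreover have "hp.subspace K"
    unfolding K_def
  proof -
    interpret T: Vector_Spaces.linear hscale fscale T by (rule lin)
    show "hp.subspace {p \<in> ?S. T p = 0}"
      using subspace_supp_in[of mid_mons, where 'a = 'k]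
      by (auto simp: hp.subspace_def T.add T.scale T.zero)
  qed
  ultimately show ?thesis using that dim by blast
qed

text \<open>The ten extra conditions are chosen to reduce each bidegree to a block already solved.
  For P = 4 three of them remove the terms quadratic in x_3, for P = 2 three remove those quadratic
  in x_2. For P = 3 two remove the cubic terms in x_3 and two make the part quadratic in x_3 vanish
  at 1 and \<alpha>. In the outer bidegrees one of x_2, x_3 has degree at most one anyway.\<close>

lemma normal_sextic_eq_0:
  fixes p :: "'k::field_char_0 hpoly"
  assumes ab: "\<alpha> \<noteq> 0" "\<alpha> \<noteq> 1" "\<beta> \<noteq> 0" "\<beta> \<noteq> 1" "\<alpha> \<noteq> \<beta>"
    and p: "p \<in> (\<Inter>l<4. sq (normal_lines \<alpha> \<beta> l)) \<and> homog 6 p"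
    and C_def: "\<And>P i k. C P i k = lookup p (mon (P - i) (6 - P - k) i k)"
    and P4: "C 4 0 2 = 0" "C 4 1 2 = 0" "C 4 2 2 = 0"
    and P2: "C 2 2 0 = 0" "C 2 2 1 = 0" "C 2 2 2 = 0"
    and P3: "C 3 0 3 = 0" "C 3 1 3 = 0" "C 3 0 2 + C 3 1 2 + C 3 2 2 = 0"
      "C 3 0 2 + \<alpha> * C 3 1 2 + \<alpha>^2 * C 3 2 2 = 0"
  shows "p = 0"
proof -
  have homog: "homog 6 p" and mid: "\<And>m. m \<in> keys p \<Longrightarrow> 2 \<le> lookup m 2 + lookup m 3 \<and> lookup m 2 + lookup m 3 \<le> 4"
    and E: "\<And>P e. P \<le> 6 \<Longrightarrow> e < 3 \<Longrightarrow> eqn 6 1 1 e P p = 0 \<and> eqn 6 \<alpha> \<beta> e P p = 0"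
    using p unfolding normal_sextics_iff by blast+
  have z: "C P i k = 0" if "i + k < 2 \<or> 4 < i + k" for P i k
  proof (rule ccontr)
    assume "C P i k \<noteq> 0"
    then have "mon (P - i) (6 - P - k) i k \<in> keys p" by (simp add: C_def in_keys_iff)
    from mid[OF this] show False using that by simp
  qed
  have eC: "eqn 6 a b e P p = (\<Sum>i\<le>P. \<Sum>k\<le>6 - P. wt a b e i k * C P i k)" for a b e P
    by (simp add: eqn_def C_def)
  note sums = eC atMost_nat_numeral z wt_def P2[simplified] P3(1,2)[simplified] P4[simplified]
  have E1: "eqn 6 1 1 e P p = 0" and E2: "eqn 6 \<alpha> \<beta> e P p = 0" if "P \<le> 6" "e < 3" for e P
    using E[OF that] by simp_all
  have c6: "C 6 2 0 = 0 \<and> C 6 3 0 = 0 \<and> C 6 4 0 = 0 \<and> (0::'k) = 0 \<and> (0::'k) = 0 \<and> (0::'k) = 0"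
  proof (rule singular_block_linear[OF ab(1,2,5)])
    show "C 6 2 0 + C 6 3 0 + C 6 4 0 + ((0::'k) + (0::'k) + (0::'k)) = 0"
      using E1[of 6 0] by (simp add: sums; algebra)
    show "2*C 6 2 0 + 3*C 6 3 0 + 4*C 6 4 0 + ((0::'k) + 2*(0::'k) + 3*(0::'k)) = 0"
      using E1[of 6 1] by (simp add: sums; algebra)
    show "(0::'k) + (0::'k) + (0::'k) = 0"
      using E1[of 6 2] by (simp add: sums; algebra)
    show "\<alpha>^2*C 6 2 0 + \<alpha>^3*C 6 3 0 + \<alpha>^4*C 6 4 0 + \<beta>*(\<alpha>*(0::'k) + \<alpha>^2*(0::'k) + \<alpha>^3*(0::'k)) = 0"
      using E2[of 6 0] by (simp add: sums; algebra)
    show "2*\<alpha>*C 6 2 0 + 3*\<alpha>^2*C 6 3 0 + 4*\<alpha>^3*C 6 4 0 + \<beta>*((0::'k) + 2*\<alpha>*(0::'k) + 3*\<alpha>^2*(0::'k)) = 0"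
      using E2[of 6 1] by (simp add: sums; algebra)
    show "\<alpha>*(0::'k) + \<alpha>^2*(0::'k) + \<alpha>^3*(0::'k) = 0"
      using E2[of 6 2] by (simp add: sums; algebra)
  qed
  have c5: "C 5 2 0 = 0 \<and> C 5 3 0 = 0 \<and> C 5 4 0 = 0 \<and> C 5 1 1 = 0 \<and> C 5 2 1 = 0 \<and> C 5 3 1 = 0"
  proof (rule singular_block_linear[OF ab(1,2,5)])
    show "C 5 2 0 + C 5 3 0 + C 5 4 0 + (C 5 1 1 + C 5 2 1 + C 5 3 1) = 0"
      using E1[of 5 0] by (simp add: sums; algebra)
    show "2*C 5 2 0 + 3*C 5 3 0 + 4*C 5 4 0 + (C 5 1 1 + 2*C 5 2 1 + 3*C 5 3 1) = 0"
      using E1[of 5 1] by (simp add: sums; algebra)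
    show "C 5 1 1 + C 5 2 1 + C 5 3 1 = 0"
      using E1[of 5 2] by (simp add: sums; algebra)
    show "\<alpha>^2*C 5 2 0 + \<alpha>^3*C 5 3 0 + \<alpha>^4*C 5 4 0 + \<beta>*(\<alpha>*C 5 1 1 + \<alpha>^2*C 5 2 1 + \<alpha>^3*C 5 3 1) = 0"
      using E2[of 5 0] by (simp add: sums; algebra)
    show "2*\<alpha>*C 5 2 0 + 3*\<alpha>^2*C 5 3 0 + 4*\<alpha>^3*C 5 4 0 + \<beta>*(C 5 1 1 + 2*\<alpha>*C 5 2 1 + 3*\<alpha>^2*C 5 3 1) = 0"
      using E2[of 5 1] by (simp add: sums; algebra)
    show "\<alpha>*C 5 1 1 + \<alpha>^2*C 5 2 1 + \<alpha>^3*C 5 3 1 = 0"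
      using E2[of 5 2] by (simp add: sums; algebra)
  qed
  have c4: "C 4 2 0 = 0 \<and> C 4 3 0 = 0 \<and> C 4 4 0 = 0 \<and> C 4 1 1 = 0 \<and> C 4 2 1 = 0 \<and> C 4 3 1 = 0"
  proof (rule singular_block_linear[OF ab(1,2,5)])
    show "C 4 2 0 + C 4 3 0 + C 4 4 0 + (C 4 1 1 + C 4 2 1 + C 4 3 1) = 0"
      using E1[of 4 0] by (simp add: sums; algebra)
    show "2*C 4 2 0 + 3*C 4 3 0 + 4*C 4 4 0 + (C 4 1 1 + 2*C 4 2 1 + 3*C 4 3 1) = 0"
      using E1[of 4 1] by (simp add: sums; algebra)
    show "C 4 1 1 + C 4 2 1 + C 4 3 1 = 0"
      using E1[of 4 2] by (simp add: sums; algebra)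
    show "\<alpha>^2*C 4 2 0 + \<alpha>^3*C 4 3 0 + \<alpha>^4*C 4 4 0 + \<beta>*(\<alpha>*C 4 1 1 + \<alpha>^2*C 4 2 1 + \<alpha>^3*C 4 3 1) = 0"
      using E2[of 4 0] by (simp add: sums; algebra)
    show "2*\<alpha>*C 4 2 0 + 3*\<alpha>^2*C 4 3 0 + 4*\<alpha>^3*C 4 4 0 + \<beta>*(C 4 1 1 + 2*\<alpha>*C 4 2 1 + 3*\<alpha>^2*C 4 3 1) = 0"
      using E2[of 4 1] by (simp add: sums; algebra)
    show "\<alpha>*C 4 1 1 + \<alpha>^2*C 4 2 1 + \<alpha>^3*C 4 3 1 = 0"
      using E2[of 4 2] by (simp add: sums; algebra)
  qed
  \<comment> \<open>For P \<le> 2 the two pairs of variables exchange roles: \<alpha> and \<beta>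
    are swapped, and so are the derivatives \<open>e = 1\<close> and \<open>e = 2\<close>.\<close>
  have c2: "C 2 0 2 = 0 \<and> C 2 0 3 = 0 \<and> C 2 0 4 = 0 \<and> C 2 1 1 = 0 \<and> C 2 1 2 = 0 \<and> C 2 1 3 = 0"
  proof (rule singular_block_linear[OF ab(3,4) ab(5)[symmetric]])
    show "C 2 0 2 + C 2 0 3 + C 2 0 4 + (C 2 1 1 + C 2 1 2 + C 2 1 3) = 0"
      using E1[of 2 0] by (simp add: sums; algebra)
    show "2*C 2 0 2 + 3*C 2 0 3 + 4*C 2 0 4 + (C 2 1 1 + 2*C 2 1 2 + 3*C 2 1 3) = 0"
      using E1[of 2 2] by (simp add: sums; algebra)
    show "C 2 1 1 + C 2 1 2 + C 2 1 3 = 0"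
      using E1[of 2 1] by (simp add: sums; algebra)
    show "\<beta>^2*C 2 0 2 + \<beta>^3*C 2 0 3 + \<beta>^4*C 2 0 4 + \<alpha>*(\<beta>*C 2 1 1 + \<beta>^2*C 2 1 2 + \<beta>^3*C 2 1 3) = 0"
      using E2[of 2 0] by (simp add: sums; algebra)
    show "2*\<beta>*C 2 0 2 + 3*\<beta>^2*C 2 0 3 + 4*\<beta>^3*C 2 0 4 + \<alpha>*(C 2 1 1 + 2*\<beta>*C 2 1 2 + 3*\<beta>^2*C 2 1 3) = 0"
      using E2[of 2 2] by (simp add: sums; algebra)
    show "\<beta>*C 2 1 1 + \<beta>^2*C 2 1 2 + \<beta>^3*C 2 1 3 = 0"
      using E2[of 2 1] by (simp add: sums; algebra)
  qed
  have c1: "C 1 0 2 = 0 \<and> C 1 0 3 = 0 \<and> C 1 0 4 = 0 \<and> C 1 1 1 = 0 \<and> C 1 1 2 = 0 \<and> C 1 1 3 = 0"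
  proof (rule singular_block_linear[OF ab(3,4) ab(5)[symmetric]])
    show "C 1 0 2 + C 1 0 3 + C 1 0 4 + (C 1 1 1 + C 1 1 2 + C 1 1 3) = 0"
      using E1[of 1 0] by (simp add: sums; algebra)
    show "2*C 1 0 2 + 3*C 1 0 3 + 4*C 1 0 4 + (C 1 1 1 + 2*C 1 1 2 + 3*C 1 1 3) = 0"
      using E1[of 1 2] by (simp add: sums; algebra)
    show "C 1 1 1 + C 1 1 2 + C 1 1 3 = 0"
      using E1[of 1 1] by (simp add: sums; algebra)
    show "\<beta>^2*C 1 0 2 + \<beta>^3*C 1 0 3 + \<beta>^4*C 1 0 4 + \<alpha>*(\<beta>*C 1 1 1 + \<beta>^2*C 1 1 2 + \<beta>^3*C 1 1 3) = 0"
      using E2[of 1 0] by (simp add: sums; algebra)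
    show "2*\<beta>*C 1 0 2 + 3*\<beta>^2*C 1 0 3 + 4*\<beta>^3*C 1 0 4 + \<alpha>*(C 1 1 1 + 2*\<beta>*C 1 1 2 + 3*\<beta>^2*C 1 1 3) = 0"
      using E2[of 1 2] by (simp add: sums; algebra)
    show "\<beta>*C 1 1 1 + \<beta>^2*C 1 1 2 + \<beta>^3*C 1 1 3 = 0"
      using E2[of 1 1] by (simp add: sums; algebra)
  qed
  have c0: "C 0 0 2 = 0 \<and> C 0 0 3 = 0 \<and> C 0 0 4 = 0 \<and> (0::'k) = 0 \<and> (0::'k) = 0 \<and> (0::'k) = 0"
  proof (rule singular_block_linear[OF ab(3,4) ab(5)[symmetric]])
    show "C 0 0 2 + C 0 0 3 + C 0 0 4 + ((0::'k) + (0::'k) + (0::'k)) = 0"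
      using E1[of 0 0] by (simp add: sums; algebra)
    show "2*C 0 0 2 + 3*C 0 0 3 + 4*C 0 0 4 + ((0::'k) + 2*(0::'k) + 3*(0::'k)) = 0"
      using E1[of 0 2] by (simp add: sums; algebra)
    show "(0::'k) + (0::'k) + (0::'k) = 0"
      using E1[of 0 1] by (simp add: sums; algebra)
    show "\<beta>^2*C 0 0 2 + \<beta>^3*C 0 0 3 + \<beta>^4*C 0 0 4 + \<alpha>*(\<beta>*(0::'k) + \<beta>^2*(0::'k) + \<beta>^3*(0::'k)) = 0"
      using E2[of 0 0] by (simp add: sums; algebra)
    show "2*\<beta>*C 0 0 2 + 3*\<beta>^2*C 0 0 3 + 4*\<beta>^3*C 0 0 4 + \<alpha>*((0::'k) + 2*\<beta>*(0::'k) + 3*\<beta>^2*(0::'k)) = 0"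
      using E2[of 0 2] by (simp add: sums; algebra)
    show "\<beta>*(0::'k) + \<beta>^2*(0::'k) + \<beta>^3*(0::'k) = 0"
      using E2[of 0 1] by (simp add: sums; algebra)
  qed
  have c3: "C 3 2 0 = 0 \<and> C 3 3 0 = 0 \<and> C 3 1 1 = 0 \<and> C 3 2 1 = 0 \<and> C 3 3 1 = 0 \<and> C 3 0 2 = 0 \<and> C 3 1 2 = 0 \<and> C 3 2 2 = 0"
  proof (rule singular_block_quadratic[OF ab(1,2,5,3)])
    show "C 3 2 0 + C 3 3 0 + (C 3 1 1 + C 3 2 1 + C 3 3 1) + (C 3 0 2 + C 3 1 2 + C 3 2 2) = 0"
      using E1[of 3 0] by (simp add: sums; algebra)
    show "2*C 3 2 0 + 3*C 3 3 0 + (C 3 1 1 + 2*C 3 2 1 + 3*C 3 3 1) + (C 3 1 2 + 2*C 3 2 2) = 0"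
      using E1[of 3 1] by (simp add: sums; algebra)
    show "C 3 1 1 + C 3 2 1 + C 3 3 1 + 2*(C 3 0 2 + C 3 1 2 + C 3 2 2) = 0"
      using E1[of 3 2] by (simp add: sums; algebra)
    show "\<alpha>^2*C 3 2 0 + \<alpha>^3*C 3 3 0 + \<beta>*(\<alpha>*C 3 1 1 + \<alpha>^2*C 3 2 1 + \<alpha>^3*C 3 3 1) + \<beta>^2*(C 3 0 2 + \<alpha>*C 3 1 2 + \<alpha>^2*C 3 2 2) = 0"
      using E2[of 3 0] by (simp add: sums; algebra)
    show "2*\<alpha>*C 3 2 0 + 3*\<alpha>^2*C 3 3 0 + \<beta>*(C 3 1 1 + 2*\<alpha>*C 3 2 1 + 3*\<alpha>^2*C 3 3 1) + \<beta>^2*(C 3 1 2 + 2*\<alpha>*C 3 2 2) = 0"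
      using E2[of 3 1] by (simp add: sums; algebra)
    show "\<alpha>*C 3 1 1 + \<alpha>^2*C 3 2 1 + \<alpha>^3*C 3 3 1 + 2*\<beta>*(C 3 0 2 + \<alpha>*C 3 1 2 + \<alpha>^2*C 3 2 2) = 0"
      using E2[of 3 2] by (simp add: sums; algebra)
  qed (use P3(3,4) in simp_all)
  have all: "\<forall>P\<in>{..6}. \<forall>i\<in>{..P}. \<forall>k\<in>{..6 - P}. C P i k = 0"
    using c0 c1 c2 c3 c4 c5 c6 P2 P3 P4 by (simp add: atMost_nat_numeral atMost_Suc z)
  show "p = 0"
  proof (rule ccontr)
    assume "p \<noteq> 0"
    then obtain m where m: "m \<in> keys p" by (metis keys_eq_empty ex_in_conv)
    define P where "P = lookup m 0 + lookup m 2"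
    have d: "lookup m 0 + lookup m 1 + lookup m 2 + lookup m 3 = 6"
      using homog m by (simp add: homog_def sum_four)
    then have "m = mon (P - lookup m 2) (6 - P - lookup m 3) (lookup m 2) (lookup m 3)"
      by (intro mon_eqI) (auto simp: P_def)
    then have "lookup p m = C P (lookup m 2) (lookup m 3)" by (simp add: C_def)
    also have "\<dots> = 0" using all d by (auto simp: P_def)
    finally show False using m by (simp add: in_keys_iff)
  qed
qed

text \<open>The ten functionals collected in \<phi> have no common zero on the sextics except 0,
  which bounds the dimension by 10 from above; the subspace \<open>K\<close> bounds it from
  below.\<close>

lemma dim_normal_sextics:
  fixes \<alpha> \<beta> :: "'k::field_char_0"
  assumes ab: "\<alpha> \<noteq> 0" "\<alpha> \<noteq> 1" "\<beta> \<noteq> 0" "\<beta> \<noteq> 1" "\<alpha> \<noteq> \<beta>"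
  shows "hp.dim {p \<in> (\<Inter>l<4. sq (normal_lines \<alpha> \<beta> l)). homog 6 p} = 10"
proof -
  define J where "J = {p \<in> (\<Inter>l<4. sq (normal_lines \<alpha> \<beta> l)). homog 6 p}"
  have J: "hp.subspace J" unfolding J_def by (rule subspace_forms) (intro is_ideal_INT is_ideal_sq)
  have JS: "J \<subseteq> supp_in (mons 6)" by (auto simp: J_def homog_iff_supp)
  note basis = supp_in_basis[OF finite_mons, where 'k = 'k]
  define C :: "'k hpoly \<Rightarrow> nat \<Rightarrow> nat \<Rightarrow> nat \<Rightarrow> 'k" where
    "C p P i k = lookup p (mon (P - i) (6 - P - k) i k)" for p P i k
  define \<phi> :: "'k hpoly \<Rightarrow> nat \<Rightarrow> 'k" where
    "\<phi> p n = (if n < 10 then [C p 4 0 2, C p 4 1 2, C p 4 2 2, C p 2 2 0, C p 2 2 1, C p 2 2 2,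
       C p 3 0 3, C p 3 1 3, C p 3 0 2 + C p 3 1 2 + C p 3 2 2,
       C p 3 0 2 + \<alpha> * C p 3 1 2 + \<alpha>^2 * C p 3 2 2] ! n else 0)" for p n
  have less_10: "n < 10 \<longleftrightarrow> n \<in> {0,1,2,3,4,5,6,7,8,9}" for n :: nat by auto
  have lin: "Vector_Spaces.linear hscale fscale \<phi>"
  proof unfold_locales
    fix p q :: "'k hpoly"
    show "\<phi> (p + q) = \<phi> p + \<phi> q"
    proof
      fix n show "\<phi> (p + q) n = (\<phi> p + \<phi> q) n"
        by (cases "n < 10") (auto simp: \<phi>_def less_10 C_def lookup_add distrib_left)
    qed
  next
    fix c and p :: "'k hpoly"
    show "\<phi> (hscale c p) = fscale c (\<phi> p)"
    proof
      fix n show "\<phi> (hscale c p) n = fscale c (\<phi> p) n"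
        by (cases "n < 10") (auto simp: \<phi>_def less_10 C_def fscale_def distrib_left mult.left_commute)
    qed
  qed
  have inj: "p = 0" if "p \<in> J" "\<phi> p = 0" for p
  proof -
    have "\<phi> p n = 0" for n using that(2) by simp
    from this[of 0] this[of 1] this[of 2] this[of 3] this[of 4] this[of 5] this[of 6] this[of 7]
      this[of 8] this[of 9]
    show ?thesis
      using that(1) by (intro normal_sextic_eq_0[OF ab, of p "C p"]) (simp_all add: \<phi>_def C_def J_def)
  qed
  have "hp.dim J = hp.dim {p \<in> J. \<phi> p = 0} + fn.dim (\<phi> ` J)"
    by (rule rank_nullity_on[OF lin J, of "(\<lambda>m. single m 1) ` mons 6"])
       (use JS basis(1)[of 6] finite_mons in auto)
  moreover have "{p \<in> J. \<phi> p = 0} = {0}"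
    using inj hp.subspace_0[OF J] by (auto simp: \<phi>_def C_def fun_eq_iff less_10)
  moreover have "hp.dim {0 :: 'k hpoly} = 0"
    using hp.dim_unique[of "{}" "{0 :: 'k hpoly}" 0] by (simp add: hp.independent_empty)
  moreover have "fn.dim (\<phi> ` J) \<le> 10"
  proof -
    have "\<phi> ` J \<subseteq> coords {..<10}" by (auto simp: \<phi>_def coords_def)
    then have "\<phi> ` J \<subseteq> fn.span ((\<lambda>i j. if j = i then 1 else 0) ` {..<10})"
      using coords_basis(1)[of "{..<10::nat}"] by auto
    then have "fn.dim (\<phi> ` J) \<le> card ((\<lambda>i j. if j = i then 1 else 0 :: 'k) ` {..<10::nat})"
      by (rule fn.dim_le_card) simp
    also have "\<dots> \<le> 10" by (rule order_trans[OF card_image_le]) simp_all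
    finally show ?thesis .
  qed
  ultimately have le: "hp.dim J \<le> 10" by simp
  obtain K where K: "hp.subspace K" "K \<subseteq> J" "10 \<le> hp.dim K"
    using dim_normal_sextics_ge[of \<alpha> \<beta>] unfolding J_def by blast
  have fin: "finite ((\<lambda>m. single m (1::'k)) ` mons 6)" using finite_mons by simp
  have "has_quotient_dim hscale J K (hp.dim J - hp.dim K)"
    by (rule hp.has_quotient_dim_diff[OF J K(1,2) fin]) (use JS basis(1)[of 6] in auto)
  then have "hp.dim J = hp.dim K + (hp.dim J - hp.dim K)"
    by (intro hp.dim_eq_add_quotient_dim[OF J K(1,2) fin]) (use K(2) JS basis(1)[of 6] in auto)
  then show ?thesis using le K(3) unfolding J_def[symmetric] by linarith
qed

section \<open>Four lines with two distinct transversals\<close>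

lemma det_four:
  "det (A::'a::comm_ring_1^4^4) =
    A$0$0*A$1$1*A$2$2*A$3$3 - A$0$0*A$1$1*A$2$3*A$3$2
  - A$0$0*A$1$2*A$2$1*A$3$3 + A$0$0*A$1$2*A$2$3*A$3$1
  + A$0$0*A$1$3*A$2$1*A$3$2 - A$0$0*A$1$3*A$2$2*A$3$1
  - A$0$1*A$1$0*A$2$2*A$3$3 + A$0$1*A$1$0*A$2$3*A$3$2
  + A$0$1*A$1$2*A$2$0*A$3$3 - A$0$1*A$1$2*A$2$3*A$3$0
  - A$0$1*A$1$3*A$2$0*A$3$2 + A$0$1*A$1$3*A$2$2*A$3$0
  + A$0$2*A$1$0*A$2$1*A$3$3 - A$0$2*A$1$0*A$2$3*A$3$1
  - A$0$2*A$1$1*A$2$0*A$3$3 + A$0$2*A$1$1*A$2$3*A$3$0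
  + A$0$2*A$1$3*A$2$0*A$3$1 - A$0$2*A$1$3*A$2$1*A$3$0
  - A$0$3*A$1$0*A$2$1*A$3$2 + A$0$3*A$1$0*A$2$2*A$3$1
  + A$0$3*A$1$1*A$2$0*A$3$2 - A$0$3*A$1$1*A$2$2*A$3$0
  - A$0$3*A$1$2*A$2$0*A$3$1 + A$0$3*A$1$2*A$2$1*A$3$0"
proof -
  have f: "finite {1::4,2,3}" "0 \<notin> {1::4,2,3}" "finite {2::4,3}" "1 \<notin> {2::4,3}" "finite {3::4}" "2 \<notin> {3::4}"
    by auto
  show ?thesis
    unfolding det_def UNIV_four
    unfolding sum_over_permutations_insert[OF f(1,2)]
    unfolding sum_over_permutations_insert[OF f(3,4)]
    unfolding sum_over_permutations_insert[OF f(5,6)]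
    unfolding permutes_sing
    by (simp add: sign_swap_id permutation_swap_id sign_compose sign_id permutation_compose transpose_def)
qed

lemma frame_nth [simp]:
  "frame a b c d $ i $ 0 = a $ i" "frame a b c d $ i $ 1 = b $ i"
  "frame a b c d $ i $ 2 = c $ i" "frame a b c d $ i $ 3 = d $ i"
  by (simp_all add: frame_def)

text \<open>The symmetric pairing of the Pluecker vectors of two lines given by spanning pairs; it
  vanishes when two lines meet.\<close>

definition br :: "'k ^ 4 \<Rightarrow> 'k ^ 4 \<Rightarrow> 'k ^ 4 \<Rightarrow> 'k ^ 4 \<Rightarrow> 'k::field" where
  "br a b c d = det (frame a b c d)"

lemma br_image: "br (M *v a) (M *v b) (M *v c) (M *v d) = det M * br a b c d"
proof -
  have "frame (M *v a) (M *v b) (M *v c) (M *v d) = M ** frame a b c d"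
    by (simp add: matrix_eq frame_mult matrix_vector_right_distrib matrix_vector_mult_scaleR
        vector_scalar_commute flip: matrix_vector_mul_assoc)
  then show ?thesis by (simp add: br_def det_mul)
qed

lemma br_vec4:
  "br (vec4 a0 a1 a2 a3) (vec4 b0 b1 b2 b3) (vec4 c0 c1 c2 c3) (vec4 d0 d1 d2 d3) =
    (a0*b1 - a1*b0)*(c2*d3 - c3*d2) - (a0*b2 - a2*b0)*(c1*d3 - c3*d1) + (a0*b3 - a3*b0)*(c1*d2 - c2*d1)
    + (a1*b2 - a2*b1)*(c0*d3 - c3*d0) - (a1*b3 - a3*b1)*(c0*d2 - c2*d0) + (a2*b3 - a3*b2)*(c0*d1 - c1*d0)"
  unfolding br_def det_four frame_nth vec4_nth by algebra

lemma vec4_eta: "vec4 (x$0) (x$1) (x$2) (x$3) = x"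
  by (simp add: vec_eq_four)

lemma br_commute: "br c d a b = br a b c d"
  using br_vec4[of "a$0" "a$1" "a$2" "a$3" "b$0" "b$1" "b$2" "b$3" "c$0" "c$1" "c$2" "c$3" "d$0" "d$1" "d$2" "d$3"]
    br_vec4[of "c$0" "c$1" "c$2" "c$3" "d$0" "d$1" "d$2" "d$3" "a$0" "a$1" "a$2" "a$3" "b$0" "b$1" "b$2" "b$3"]
  unfolding vec4_eta by (simp only: mult_ac) (simp only: add_ac diff_conv_add_uminus)

text \<open>The two pairs change independently, so the determinant of the change is that of a block
  diagonal matrix.\<close>

lemma br_change:
  "br (s *s a + t *s b) (s' *s a + t' *s b) (x *s c + y *s d) (x' *s c + y' *s d)
    = (s * t' - t * s') * (x * y' - y * x') * br a b c d"
proof -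
  let ?M = "frame a b c d"
  have "br (s *s a + t *s b) (s' *s a + t' *s b) (x *s c + y *s d) (x' *s c + y' *s d)
     = br (?M *v vec4 s t 0 0) (?M *v vec4 s' t' 0 0) (?M *v vec4 0 0 x y) (?M *v vec4 0 0 x' y')"
    by (simp add: frame_mult)
  also have "\<dots> = det ?M * br (vec4 s t 0 0) (vec4 s' t' 0 0) (vec4 0 0 x y) (vec4 0 0 x' y')"
    by (rule br_image)
  also have "br (vec4 s t 0 0) (vec4 s' t' 0 0) (vec4 0 0 x y) (vec4 0 0 x' y')
      = (s * t' - t * s') * (x * y' - y * x')"
    by (simp add: br_vec4)
  finally show ?thesis by (simp add: br_def)
qed

lemma br_nonzero_iff:
  "br a b c d \<noteq> 0 \<longleftrightarrow> indep2 a b \<and> indep2 c d \<and> vec.span {a, b} \<inter> vec.span {c, d} = {0}"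
proof
  assume "br a b c d \<noteq> 0"
  then have "invertible (frame a b c d)" by (simp add: br_def invertible_det_nz)
  then obtain B where "B ** frame a b c d = mat 1" by (auto simp: invertible_def)
  then have inj: "x = 0" if "frame a b c d *v x = 0" for x
    using that by (metis matrix_vector_mul_assoc matrix_vector_mul_lid matrix_vector_mult_0_right)
  have z: "x0 = 0 \<and> x1 = 0 \<and> x2 = 0 \<and> x3 = 0"
    if "x0 *s a + x1 *s b + x2 *s c + x3 *s d = 0" for x0 x1 x2 x3
    using inj[of "vec4 x0 x1 x2 x3"] that by (simp add: frame_mult vec_eq_four)
  have "indep2 a b"
    unfolding indep2_def
  proof (intro allI impI)
    fix s t assume "s *s a + t *s b = 0"
    then show "s = 0 \<and> t = 0" using z[of s t 0 0] by simp
  qed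
  moreover have "indep2 c d"
    unfolding indep2_def
  proof (intro allI impI)
    fix s t assume "s *s c + t *s d = 0"
    then show "s = 0 \<and> t = 0" using z[of 0 0 s t] by simp
  qed
  moreover have "vec.span {a, b} \<inter> vec.span {c, d} \<subseteq> {0}"
  proof
    fix x assume "x \<in> vec.span {a, b} \<inter> vec.span {c, d}"
    then obtain s t s' t' where x: "x = s *s a + t *s b" "x = s' *s c + t' *s d"
      unfolding span_pair by blast
    have "s *s a + t *s b + (- s') *s c + (- t') *s d = (s *s a + t *s b) - (s' *s c + t' *s d)"
      by (simp add: algebra_simps)
    then have "s *s a + t *s b + (- s') *s c + (- t') *s d = 0" unfolding x[symmetric] by simp
    then have "s = 0 \<and> t = 0" using z by blast
    then show "x \<in> {0}" using x(1) by simp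
  qed
  ultimately show "indep2 a b \<and> indep2 c d \<and> vec.span {a, b} \<inter> vec.span {c, d} = {0}"
    using vec.span_zero by blast
next
  assume a: "indep2 a b \<and> indep2 c d \<and> vec.span {a, b} \<inter> vec.span {c, d} = {0}"
  then obtain B where "frame a b c d ** B = mat 1" "B ** frame a b c d = mat 1"
    using frame_invertible[of a b c d] disjoint_spans_independent[of a b c d] by metis
  then have "invertible (frame a b c d)" unfolding invertible_def by blast
  then show "br a b c d \<noteq> 0" by (simp add: br_def invertible_det_nz)
qed

lemma span_change:
  assumes "p * s - q * r \<noteq> 0"
  shows "vec.span {p *s a + q *s b, r *s a + s *s b} = vec.span {a, b :: 'k::field ^ 4}"
proof
  have "p *s a + q *s b \<in> vec.span {a, b}" "r *s a + s *s b \<in> vec.span {a, b}"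
    unfolding span_pair by blast+
  then show "vec.span {p *s a + q *s b, r *s a + s *s b} \<subseteq> vec.span {a, b}"
    by (intro vec.span_minimal vec.subspace_span) auto
  let ?D = "p * s - q * r" and ?S = "vec.span {p *s a + q *s b, r *s a + s *s b}"
  have "s *s (p *s a + q *s b) + (- q) *s (r *s a + s *s b) = ?D *s a"
    "(- r) *s (p *s a + q *s b) + p *s (r *s a + s *s b) = ?D *s b"
    by (simp_all add: vec_eq_four algebra_simps)
  then have "?D *s a \<in> ?S" "?D *s b \<in> ?S"
    unfolding span_pair by (metis (mono_tags, lifting) mem_Collect_eq)+
  then have "inverse ?D *s (?D *s a) \<in> ?S" "inverse ?D *s (?D *s b) \<in> ?S"
    by (simp_all only: vec.span_scale)
  then have "a \<in> ?S" "b \<in> ?S"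
    unfolding vector_smult_assoc left_inverse[OF assms] vector_smult_lid .
  then show "vec.span {a, b} \<subseteq> vec.span {p *s a + q *s b, r *s a + s *s b}"
    by (intro vec.span_minimal vec.subspace_span) auto
qed

section \<open>A discriminant of four lines, independent of order and spanning vectors\<close>

definition gram :: "(nat \<Rightarrow> 'k ^ 4) \<Rightarrow> (nat \<Rightarrow> 'k ^ 4) \<Rightarrow> nat \<Rightarrow> nat \<Rightarrow> 'k::field" where
  "gram v w i j = br (v i) (w i) (v j) (w j)"

lemma gram_commute: "gram v w i j = gram v w j i"
  by (simp add: gram_def br_commute)

text \<open>The symmetric form of a quadratic discriminant: it equals (B + C - A)^2 - 4 B C, also
  known as the Kallen triangle function.\<close>

definition disc3 :: "'k \<Rightarrow> 'k \<Rightarrow> 'k \<Rightarrow> 'k::comm_ring_1" where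
  "disc3 A B C = A^2 + B^2 + C^2 - 2 * (A * B + A * C + B * C)"

lemma disc3_commute: "disc3 A B C = disc3 B A C" "disc3 A B C = disc3 A C B"
  by (simp_all only: disc3_def mult_ac add_ac)

lemma disc3_quadratic:
  fixes k d :: "'k::field"
  shows "disc3 k 1 d = (1 + d - k)^2 - 4 * d"
proof -
  have "k^2 + 1 + d^2 - 2 * (k + k * d + d) = (1 + d - k)^2 - 4 * d" by algebra
  then show ?thesis by (simp add: disc3_def)
qed

lemma disc3_scale: "disc3 (c * A) (c * B) (c * C) = c^2 * disc3 A B C"
  by (simp only: disc3_def power2_eq_square distrib_left right_diff_distrib mult_ac)

text \<open>The Gram determinant of the four Pluecker vectors, up to sign: it vanishes exactly if the lines
  fail to have two distinct transversals.\<close>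

definition discr :: "(nat \<Rightarrow> nat \<Rightarrow> 'k) \<Rightarrow> 'k::comm_ring_1" where
  "discr g = disc3 (g 0 1 * g 2 3) (g 0 2 * g 1 3) (g 0 3 * g 1 2)"

text \<open>The arguments of \<open>disc3\<close> belong to the three ways to split four indices
  into two pairs. A permutation of the indices permutes these, and \<open>disc3\<close> is
  symmetric.\<close>

lemma discr_permute:
  assumes sym: "\<And>i j. g i j = g j i" and \<pi>: "inj_on \<pi> {..<4::nat}" "\<pi> ` {..<4} \<subseteq> {..<4}"
  shows "discr (\<lambda>i j. g (\<pi> i) (\<pi> j)) = discr g"
proof -
  have s: "g (Suc 0) 0 = g 0 (Suc 0)" "g 2 0 = g 0 2" "g 3 0 = g 0 3" "g 2 (Suc 0) = g (Suc 0) 2"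
    "g 3 (Suc 0) = g (Suc 0) 3" "g 3 2 = g 2 3"
    by (rule sym)+
  have r: "\<pi> i = 0 \<or> \<pi> i = 1 \<or> \<pi> i = 2 \<or> \<pi> i = 3" if "i < 4" for i
    using \<pi>(2) that less_4_cases[of "\<pi> i"] by auto
  have d': "\<pi> i \<noteq> \<pi> j" if "i < 4" "j < 4" "i \<noteq> j" for i j
    using \<pi>(1) that by (auto dest: inj_onD)
  have d: "\<pi> 0 \<noteq> \<pi> 1" "\<pi> 0 \<noteq> \<pi> 2" "\<pi> 0 \<noteq> \<pi> 3" "\<pi> 1 \<noteq> \<pi> 2" "\<pi> 1 \<noteq> \<pi> 3" "\<pi> 2 \<noteq> \<pi> 3"
    by (rule d'; simp)+
  show ?thesis
    using r[of 0, simplified] r[of 1, simplified] r[of 2, simplified] r[of 3, simplified] d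
    by (elim disjE) (simp_all add: discr_def s disc3_commute mult.commute)
qed

definition good_family :: "(nat \<Rightarrow> 'k ^ 4) \<Rightarrow> (nat \<Rightarrow> 'k::field ^ 4) \<Rightarrow> bool" where
  "good_family v w \<longleftrightarrow> (\<forall>i<4. \<forall>j<4. i \<noteq> j \<longrightarrow> gram v w i j \<noteq> 0) \<and> discr (gram v w) \<noteq> 0"

lemma other_index: "\<exists>j<4. (i::nat) \<noteq> j"
  by (rule exI[of _ "if i = 0 then 1 else 0"]) simp

lemma gram_disjoint_iff:
  "(\<forall>i<4. \<forall>j<4. i \<noteq> j \<longrightarrow> gram v w i j \<noteq> 0) \<longleftrightarrow> disjoint_lines 4 (\<lambda>i. vec.span {v i, w i})"
proof
  assume g: "\<forall>i<4. \<forall>j<4. i \<noteq> j \<longrightarrow> gram v w i j \<noteq> 0"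
  have iff: "indep2 (v i) (w i) \<and> indep2 (v j) (w j) \<and> vec.span {v i, w i} \<inter> vec.span {v j, w j} = {0}"
    if "i < 4" "j < 4" "i \<noteq> j" for i j
    using br_nonzero_iff[of "v i" "w i" "v j" "w j"] g that by (simp add: gram_def)
  have "indep2 (v i) (w i)" if "i < 4" for i
  proof -
    obtain j where "j < 4" "i \<noteq> j" using other_index by blast
    then show ?thesis using iff[of i j] that by simp
  qed
  then show "disjoint_lines 4 (\<lambda>i. vec.span {v i, w i})"
    using iff by (simp add: disjoint_lines_def is_line_span_pair)
next
  assume d: "disjoint_lines 4 (\<lambda>i. vec.span {v i, w i})"
  show "\<forall>i<4. \<forall>j<4. i \<noteq> j \<longrightarrow> gram v w i j \<noteq> 0"
  proof (intro allI impI)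
    fix i j :: nat assume "i < 4" "j < 4" "i \<noteq> j"
    then show "gram v w i j \<noteq> 0"
      using br_nonzero_iff[of "v i" "w i" "v j" "w j"] d
      by (simp add: gram_def disjoint_lines_def is_line_span_pair)
  qed
qed

text \<open>A change of spanning vectors multiplies \<open>gram\<close> at \<open>i\<close>,
  \<open>j\<close> by the determinants \<open>c i\<close> and \<open>c j\<close>. Each of the three
  products in \<open>discr\<close> uses every index once, so all acquire the same factor and
  \<open>discr\<close> is multiplied by its square. Being good is thus a property of the unordered
  set of lines.\<close>

lemma good_family_transfer:
  fixes v w v' w' :: "nat \<Rightarrow> 'k::field ^ 4"
  assumes good: "good_family v w"
    and disj: "disjoint_lines 4 (\<lambda>i. vec.span {v' i, w' i})"
    and \<pi>: "inj_on \<pi> {..<4::nat}" "\<pi> ` {..<4} \<subseteq> {..<4}"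
    and span: "\<And>i. i < 4 \<Longrightarrow> vec.span {v' i, w' i} = vec.span {v (\<pi> i), w (\<pi> i)}"
  shows "good_family v' w'"
proof -
  have g': "\<forall>i<4. \<forall>j<4. i \<noteq> j \<longrightarrow> gram v' w' i j \<noteq> 0" using disj gram_disjoint_iff by blast
  have "\<exists>s t s' t'. v' i = s *s v (\<pi> i) + t *s w (\<pi> i) \<and> w' i = s' *s v (\<pi> i) + t' *s w (\<pi> i)"
    if "i < 4" for i
  proof -
    have "v' i \<in> vec.span {v (\<pi> i), w (\<pi> i)}" "w' i \<in> vec.span {v (\<pi> i), w (\<pi> i)}"
      unfolding span[OF that, symmetric] by (auto intro: vec.span_base)
    then show ?thesis unfolding span_pair by blast
  qed
  then obtain s t s' t' where st: "\<And>i. i < 4 \<Longrightarrow> v' i = s i *s v (\<pi> i) + t i *s w (\<pi> i)"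
    "\<And>i. i < 4 \<Longrightarrow> w' i = s' i *s v (\<pi> i) + t' i *s w (\<pi> i)" by metis
  define c where "c i = s i * t' i - t i * s' i" for i
  have gram: "gram v' w' i j = c i * c j * gram v w (\<pi> i) (\<pi> j)" if "i < 4" "j < 4" for i j
    unfolding gram_def c_def st(1)[OF that(1)] st(2)[OF that(1)] st(1)[OF that(2)] st(2)[OF that(2)]
    by (rule br_change)
  \<comment> \<open>A vanishing determinant would make the bracket with any other line vanish,
    against disjointness.\<close>
  have c: "c i \<noteq> 0" if i: "i < 4" for i
  proof -
    obtain j where "j < 4" "i \<noteq> j" using other_index by blast
    then show ?thesis using g' gram[OF i] i by auto
  qed
  have "discr (gram v' w') = disc3
     (c 0 * c 1 * c 2 * c 3 * (gram v w (\<pi> 0) (\<pi> 1) * gram v w (\<pi> 2) (\<pi> 3)))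
     (c 0 * c 1 * c 2 * c 3 * (gram v w (\<pi> 0) (\<pi> 2) * gram v w (\<pi> 1) (\<pi> 3)))
     (c 0 * c 1 * c 2 * c 3 * (gram v w (\<pi> 0) (\<pi> 3) * gram v w (\<pi> 1) (\<pi> 2)))"
  proof -
    have l: "(0::nat) < 4" "(1::nat) < 4" "(2::nat) < 4" "(3::nat) < 4" by simp_all
    show ?thesis
      unfolding discr_def gram[OF l(1,2)] gram[OF l(3,4)] gram[OF l(1,3)] gram[OF l(2,4)]
        gram[OF l(1,4)] gram[OF l(2,3)]
      by (simp only: mult_ac)
  qed
  also have "\<dots> = (c 0 * c 1 * c 2 * c 3)^2 * discr (\<lambda>i j. gram v w (\<pi> i) (\<pi> j))"
    unfolding disc3_scale discr_def ..
  also have "discr (\<lambda>i j. gram v w (\<pi> i) (\<pi> j)) = discr (gram v w)"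
    by (rule discr_permute[OF gram_commute \<pi>])
  finally have "discr (gram v' w') \<noteq> 0" using good c by (simp add: good_family_def)
  then show ?thesis using g' by (simp add: good_family_def)
qed

section \<open>Diagonalising the relative position of four lines\<close>

lemma singular_2x2:
  fixes p q r s :: "'k::field"
  assumes "p * s = q * r"
  obtains x y where "x \<noteq> 0 \<or> y \<noteq> 0" "p * x + q * y = 0" "r * x + s * y = 0"
proof (cases "p = 0 \<and> q = 0")
  case True
  show ?thesis
  proof (cases "r = 0 \<and> s = 0")
    case True
    then show ?thesis using that[of 1 0] \<open>p = 0 \<and> q = 0\<close> by simp
  next
    case False
    then show ?thesis using that[of s "- r"] \<open>p = 0 \<and> q = 0\<close> by (auto simp: mult.commute)
  qed
next
  case False
  then show ?thesis using that[of q "- p"] assms by (auto simp: mult.commute)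
qed

lemma power2_diff_eq: "(a - b)^2 = (a + b)^2 - 4 * (a * b)" for a b :: "'k::field"
  by algebra

text \<open>\<alpha> and \<beta> have the product and sum of the eigenvalues of the matrix with rows
  (m11, m12) and (m21, m22). The eigenvectors (x, y) and (z, u) are independent because \<alpha>
  \<noteq> \<beta>.\<close>

lemma eigenbasis_2x2:
  fixes m11 m12 m21 m22 :: "'k::field"
  assumes prod: "\<alpha> * \<beta> = m11 * m22 - m12 * m21" and sum: "\<alpha> + \<beta> = m11 + m22" and ne: "\<alpha> \<noteq> \<beta>"
  obtains x y z u where "x * u - y * z \<noteq> 0"
    "\<alpha> * x = m11 * x + m12 * y" "\<alpha> * y = m21 * x + m22 * y"
    "\<beta> * z = m11 * z + m12 * u" "\<beta> * u = m21 * z + m22 * u"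
proof -
  have sing: "(m11 - \<alpha>) * (m22 - \<alpha>) = m12 * m21" "(m11 - \<beta>) * (m22 - \<beta>) = m12 * m21"
    using prod sum by algebra+
  obtain x y where xy: "x \<noteq> 0 \<or> y \<noteq> 0" "(m11 - \<alpha>) * x + m12 * y = 0" "m21 * x + (m22 - \<alpha>) * y = 0"
    using singular_2x2[OF sing(1)] .
  obtain z u where zu: "z \<noteq> 0 \<or> u \<noteq> 0" "(m11 - \<beta>) * z + m12 * u = 0" "m21 * z + (m22 - \<beta>) * u = 0"
    using singular_2x2[OF sing(2)] .
  have "x * u - y * z \<noteq> 0"
  proof
    assume D0: "x * u - y * z = 0"
    have "(\<alpha> - \<beta>) * (x * z) = 0" "(\<alpha> - \<beta>) * (y * u) = 0" "(\<alpha> - \<beta>) * (x * u) = 0" "(\<alpha> - \<beta>) * (y * z) = 0"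
      using D0 xy(2,3) zu(2,3) by algebra+
    then show False using ne xy(1) zu(1) by auto
  qed
  moreover have "\<alpha> * x = m11 * x + m12 * y" "\<alpha> * y = m21 * x + m22 * y"
    "\<beta> * z = m11 * z + m12 * u" "\<beta> * u = m21 * z + m22 * u"
    using xy(2,3) zu(2,3) by algebra+
  ultimately show ?thesis using that by blast
qed

text \<open>\<open>V 2\<close> and \<open>V 3\<close> are the graphs of isomorphisms \<open>V 0 \<rightarrow> V 1\<close>; an eigenbasis of the quotient of
  the two isomorphisms gives the coordinates. The discriminant of its characteristic polynomial is
  \<open>discr\<close> up to a nonzero factor.\<close>

lemma good_family_normal_form:
  fixes v w :: "nat \<Rightarrow> 'k::{alg_closed_field, field_char_0} ^ 4"
  assumes good: "good_family v w"
  obtains A B \<alpha> \<beta> where "A ** B = mat 1" "B ** A = mat 1"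
    "\<alpha> \<noteq> 0" "\<alpha> \<noteq> 1" "\<beta> \<noteq> 0" "\<beta> \<noteq> 1" "\<alpha> \<noteq> \<beta>"
    "\<And>l. l < 4 \<Longrightarrow> vec.span {v l, w l} = (*v) A ` normal_lines \<alpha> \<beta> l"
proof -
  define V where "V l = vec.span {v l, w l}" for l
  have disj: "disjoint_lines 4 V" unfolding V_def using good gram_disjoint_iff[of v w] by (simp add: good_family_def)
  have indep: "indep2 (v l) (w l)" if "l < 4" for l
    using disj that by (simp add: disjoint_lines_def V_def is_line_span_pair)
  have meet: "V i \<inter> V j = {0}" if "i < 4" "j < 4" "i \<noteq> j" for i j
    using disj that by (simp add: disjoint_lines_def)
  have sub: "vec.subspace (V l)" for l by (simp add: V_def)
  have ind01: "x0 = 0 \<and> x1 = 0 \<and> x2 = 0 \<and> x3 = 0"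
    if "x0 *s v 0 + x1 *s w 0 + x2 *s v 1 + x3 *s w 1 = 0" for x0 x1 x2 x3
    by (rule disjoint_spans_independent[OF indep indep _ that]) (use meet[of 0 1] in \<open>simp_all add: V_def\<close>)
  obtain F where F: "frame (v 0) (w 0) (v 1) (w 1) ** F = mat 1"
    using frame_invertible[OF ind01] by blast
  have decomp: "\<exists>y\<in>V 0. \<exists>z\<in>V 1. x = y + z" for x
  proof -
    have "x = frame (v 0) (w 0) (v 1) (w 1) *v (F *v x)" using F by (simp add: matrix_vector_mul_assoc)
    then show ?thesis unfolding frame_mult V_def span_pair by (metis (mono_tags, lifting) add.assoc mem_Collect_eq)
  qed
  obtain a a' where a: "a \<in> V 0" "a' \<in> V 1" "v 2 = a + a'" using decomp by blast
  obtain b b' where b: "b \<in> V 0" "b' \<in> V 1" "w 2 = b + b'" using decomp by blast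
  have in2: "s *s v 2 + t *s w 2 \<in> V 2" for s t unfolding V_def span_pair by blast
  \<comment> \<open>If the \<open>V i\<close> components of two spanning vectors were dependent, a
    nonzero point of \<open>V k\<close> would lie in \<open>V j\<close>.\<close>
  have indep_part: "indep2 x y" if x: "x \<in> V i" "x' \<in> V j" "v k = x + x'" and y: "y \<in> V i" "y' \<in> V j" "w k = y + y'"
    and ij: "i < 4" "j < 4" "k < 4" "j \<noteq> k" for i j k x x' y y'
    unfolding indep2_def
  proof (intro allI impI)
    fix s t assume z: "s *s x + t *s y = 0"
    have "s *s v k + t *s w k = (s *s x + t *s y) + (s *s x' + t *s y')"
      unfolding x(3) y(3) by (simp add: vector_add_ldistrib)
    also have "\<dots> \<in> V j" unfolding z using x(2) y(2) by (simp add: vec.subspace_add vec.subspace_scale sub)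
    finally have "s *s v k + t *s w k \<in> V j \<inter> V k" unfolding V_def span_pair by blast
    then have "s *s v k + t *s w k = 0" using meet[of j k] ij by simp
    then show "s = 0 \<and> t = 0" using indep[OF ij(3)] unfolding indep2_def by blast
  qed
  have span_eq: "V l = vec.span {x, y}" if "x \<in> V l" "y \<in> V l" "indep2 x y" "l < 4" for x y l
    using line_subset_eq[of "vec.span {x, y}" "V l"] that vec.span_minimal[of "{x, y}" "V l"] sub disj
    by (auto simp: is_line_span_pair disjoint_lines_def)
  have ab: "indep2 a b" by (rule indep_part[of a 0 a' 1 2 b b']) (use a b in auto)
  have ab': "indep2 a' b'" by (rule indep_part[of a' 1 a 0 2 b' b]) (use a b in \<open>auto simp: add.commute\<close>)
  have V0: "V 0 = vec.span {a, b}" by (rule span_eq) (use a b ab in auto)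
  have V1: "V 1 = vec.span {a', b'}" by (rule span_eq) (use a b ab' in auto)
  obtain p p' where p: "p \<in> V 0" "p' \<in> V 1" "v 3 = p + p'" using decomp by blast
  obtain q q' where q: "q \<in> V 0" "q' \<in> V 1" "w 3 = q + q'" using decomp by blast
  have pq: "indep2 p q" by (rule indep_part[of p 0 p' 1 3 q q']) (use p q in auto)
  have V0': "V 0 = vec.span {p, q}" by (rule span_eq) (use p q pq in auto)
  have lift: "\<exists>y\<in>V 1. x + y \<in> V 3" if x: "x \<in> V 0" for x
  proof -
    obtain s t where st: "x = s *s p + t *s q" using x unfolding V0' span_pair by blast
    have "x + (s *s p' + t *s q') = s *s v 3 + t *s w 3" unfolding p(3) q(3) st by (simp add: vector_add_ldistrib)
    also have "\<dots> \<in> V 3" unfolding V_def span_pair by blast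
    finally show ?thesis using p(2) q(2) vec.subspace_add[OF sub] vec.subspace_scale[OF sub] by blast
  qed
  \<comment> \<open>In the bases \<open>a\<close>, \<open>b\<close> of \<open>V 0\<close> and
    \<open>a'\<close>, \<open>b'\<close> of \<open>V 1\<close> the line \<open>V 2\<close> is the
    graph of the identity; the columns (m11, m21) and (m12, m22) describe \<open>V 3\<close> as a
    graph.\<close>
  obtain m11 m21 where m1: "a + (m11 *s a' + m21 *s b') \<in> V 3"
    using lift[OF a(1)] unfolding V1 span_pair by blast
  obtain m12 m22 where m2: "b + (m12 *s a' + m22 *s b') \<in> V 3"
    using lift[OF b(1)] unfolding V1 span_pair by blast
  define v3 where "v3 = a + (m11 *s a' + m21 *s b')"
  define w3 where "w3 = b + (m12 *s a' + m22 *s b')"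
  have M_indep: "x0 = 0 \<and> x1 = 0 \<and> x2 = 0 \<and> x3 = 0"
    if "x0 *s a + x1 *s b + x2 *s a' + x3 *s b' = 0" for x0 x1 x2 x3
    by (rule disjoint_spans_independent[OF ab ab' _ that]) (use meet[of 0 1] V0 V1 in simp)
  have "indep2 v3 w3"
    unfolding indep2_def
  proof (intro allI impI)
    fix s t assume "s *s v3 + t *s w3 = 0"
    moreover have "s *s v3 + t *s w3
        = s *s a + t *s b + (s * m11 + t * m12) *s a' + (s * m21 + t * m22) *s b'"
      by (simp add: v3_def w3_def vec_eq_four distrib_left distrib_right mult.assoc add_ac)
    ultimately have "s *s a + t *s b + (s * m11 + t * m12) *s a' + (s * m21 + t * m22) *s b' = 0"
      by simp
    then show "s = 0 \<and> t = 0" using M_indep by blast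
  qed
  then have V3: "V 3 = vec.span {v3, w3}" using m1 m2 by (intro span_eq) (auto simp: v3_def w3_def)
  have V2: "V 2 = vec.span {a + a', b + b'}" by (simp add: V_def a(3) b(3))
  define M where "M = frame a b a' b'"
  define vc :: "nat \<Rightarrow> 'k ^ 4" where "vc l = (if l = 0 then vec4 1 0 0 0 else if l = 1 then vec4 0 0 1 0
     else if l = 2 then vec4 1 0 1 0 else vec4 1 0 m11 m21)" for l
  define wc :: "nat \<Rightarrow> 'k ^ 4" where "wc l = (if l = 0 then vec4 0 1 0 0 else if l = 1 then vec4 0 0 0 1
     else if l = 2 then vec4 0 1 0 1 else vec4 0 1 m12 m22)" for l
  have spans: "vec.span {M *v vc l, M *v wc l} = V l" if "l < 4" for l
    using that unfolding less_4_cases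
    by (elim disjE) (simp_all add: M_def vc_def wc_def frame_mult V0 V1[unfolded One_nat_def] V2 V3 v3_def w3_def add.assoc)
  \<comment> \<open>The generic condition does not depend on the spanning vectors, so it may be
    computed with the simplest ones.\<close>
  have good': "good_family (\<lambda>l. M *v vc l) (\<lambda>l. M *v wc l)"
  proof (rule good_family_transfer[OF good, of _ _ id])
    have "disjoint_lines 4 (\<lambda>i. vec.span {M *v vc i, M *v wc i}) \<longleftrightarrow> disjoint_lines 4 V"
      unfolding disjoint_lines_def by (simp add: spans)
    then show "disjoint_lines 4 (\<lambda>i. vec.span {M *v vc i, M *v wc i})" using disj by blast
  qed (use spans in \<open>auto simp: V_def\<close>)
  have gram': "gram (\<lambda>l. M *v vc l) (\<lambda>l. M *v wc l) i j = det M * br (vc i) (wc i) (vc j) (wc j)" for i j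
    by (simp add: gram_def br_image)
  define \<delta> where "\<delta> = m11 * m22 - m12 * m21"
  \<comment> \<open>\<delta> is the determinant of the matrix m, and the last bracket is its
    characteristic polynomial at 1.\<close>
  have G: "br (vc 0) (wc 0) (vc 1) (wc 1) = 1" "br (vc 0) (wc 0) (vc 2) (wc 2) = 1"
    "br (vc 0) (wc 0) (vc 3) (wc 3) = \<delta>" "br (vc 1) (wc 1) (vc 2) (wc 2) = 1"
    "br (vc 1) (wc 1) (vc 3) (wc 3) = 1" "br (vc 2) (wc 2) (vc 3) (wc 3) = \<delta> - (m11 + m22) + 1"
    by (simp_all add: vc_def wc_def br_vec4 \<delta>_def algebra_simps)
  have "discr (gram (\<lambda>l. M *v vc l) (\<lambda>l. M *v wc l)) = disc3 (det M ^ 2 * (\<delta> - (m11 + m22) + 1)) (det M ^ 2 * 1) (det M ^ 2 * \<delta>)"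
    unfolding discr_def gram' G by (simp only: power2_eq_square mult_ac mult_1_right mult_1_left)
  also have "\<dots> = (det M ^ 2)^2 * ((m11 + m22)^2 - 4 * \<delta>)"
  proof -
    have "disc3 (\<delta> - (m11 + m22) + 1) 1 \<delta> = (m11 + m22)^2 - 4 * \<delta>"
      unfolding disc3_quadratic by simp
    then show ?thesis unfolding disc3_scale by simp
  qed
  finally have disc: "(m11 + m22)^2 - 4 * \<delta> \<noteq> 0" using good' by (auto simp: good_family_def)
  have nz: "gram (\<lambda>l. M *v vc l) (\<lambda>l. M *v wc l) 0 3 \<noteq> 0" "gram (\<lambda>l. M *v vc l) (\<lambda>l. M *v wc l) 2 3 \<noteq> 0"
    using good' by (auto simp: good_family_def)
  then have \<delta>: "\<delta> \<noteq> 0" "\<delta> - (m11 + m22) + 1 \<noteq> 0" unfolding gram' G by auto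
  obtain \<alpha> where "poly [:\<delta>, - (m11 + m22), 1:] \<alpha> = 0"
    using alg_closed_imp_poly_has_root[of "[:\<delta>, - (m11 + m22), 1:]"] by auto
  then have root: "\<alpha> * \<alpha> = (m11 + m22) * \<alpha> - \<delta>" by (simp add: algebra_simps)
  define \<beta> where "\<beta> = m11 + m22 - \<alpha>"
  have prod: "\<alpha> * \<beta> = \<delta>" using root by (simp add: \<beta>_def algebra_simps)
  have sum: "\<alpha> + \<beta> = m11 + m22" by (simp add: \<beta>_def)
  have ne: "\<alpha> \<noteq> 0" "\<beta> \<noteq> 0" using prod \<delta>(1) by auto
  \<comment> \<open>Disjointness of \<open>V 2\<close> and \<open>V 3\<close> excludes the
    eigenvalue 1, just as that of \<open>V 0\<close> and \<open>V 3\<close> excluded 0.\<close>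
  have "(1 - \<alpha>) * (1 - \<beta>) = \<delta> - (m11 + m22) + 1"
    unfolding prod[symmetric] sum[symmetric] by (simp add: algebra_simps)
  then have ne1: "\<alpha> \<noteq> 1" "\<beta> \<noteq> 1" using \<delta>(2) by auto
  have "(\<alpha> - \<beta>)^2 = (m11 + m22)^2 - 4 * \<delta>"
    unfolding prod[symmetric] sum[symmetric] by (rule power2_diff_eq)
  then have ab_ne: "\<alpha> \<noteq> \<beta>" using disc by auto
  obtain x y z u where D: "x * u - y * z \<noteq> 0"
    and eig: "\<alpha> * x = m11 * x + m12 * y" "\<alpha> * y = m21 * x + m22 * y"
      "\<beta> * z = m11 * z + m12 * u" "\<beta> * u = m21 * z + m22 * u"
    using eigenbasis_2x2[OF prod[unfolded \<delta>_def] sum ab_ne] .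
  \<comment> \<open>The same coefficients are used in \<open>V 0\<close> and \<open>V 1\<close>:
    this keeps \<open>V 2\<close> the graph of the identity while \<open>V 3\<close> becomes the
    graph of a diagonal map.\<close>
  define e where "e = x *s a + y *s b"
  define f where "f = z *s a + u *s b"
  define e' where "e' = x *s a' + y *s b'"
  define f' where "f' = z *s a' + u *s b'"
  define A where "A = frame e f e' f'"
  have "br e f e' f' \<noteq> 0"
  proof -
    have "br a b a' b' \<noteq> 0" using ab ab' meet[of 0 1] V0 V1 by (simp add: br_nonzero_iff)
    then show ?thesis unfolding e_def f_def e'_def f'_def br_change using D by simp
  qed
  then have "invertible A" by (simp add: A_def br_def invertible_det_nz)
  then obtain B where B: "A ** B = mat 1" "B ** A = mat 1" by (auto simp: invertible_def)
  have skew: "(*v) A ` skew_line s t = vec.span {e + s *s e', f + t *s f'}" for s t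
  proof -
    have mult: "A *v vec4 x0 x1 (s * x0) (t * x1) = x0 *s (e + s *s e') + x1 *s (f + t *s f')" for x0 x1
      by (simp add: A_def frame_mult vec_eq_four algebra_simps)
    have skew: "skew_line s t = {vec4 x0 x1 (s * x0) (t * x1) |x0 x1. True}"
      by (auto simp: skew_line_def vec_eq_four)
    show ?thesis unfolding span_pair skew mult[symmetric] by blast
  qed
  have "V 0 = vec.span {e, f}" unfolding V0 e_def f_def using span_change[of x u y z a b] D by simp
  moreover have "V 1 = vec.span {e', f'}" unfolding V1 e'_def f'_def using span_change[of x u y z a' b'] D by simp
  moreover have "V 2 = vec.span {e + 1 *s e', f + 1 *s f'}"
  proof -
    have "e + 1 *s e' = x *s (a + a') + y *s (b + b')" "f + 1 *s f' = z *s (a + a') + u *s (b + b')"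
      by (simp_all only: e_def f_def e'_def f'_def vector_smult_lid vector_add_ldistrib add_ac)
    then show ?thesis unfolding V2 using span_change[of x u y z "a + a'" "b + b'"] D by simp
  qed
  moreover have "V 3 = vec.span {e + \<alpha> *s e', f + \<beta> *s f'}"
  proof -
    have "\<alpha> *s e' = (m11 * x + m12 * y) *s a' + (m21 * x + m22 * y) *s b'"
      "\<beta> *s f' = (m11 * z + m12 * u) *s a' + (m21 * z + m22 * u) *s b'"
      by (simp_all add: e'_def f'_def vector_add_ldistrib flip: eig)
    then have "e + \<alpha> *s e' = x *s v3 + y *s w3" "f + \<beta> *s f' = z *s v3 + u *s w3"
      by (simp_all only: e_def f_def v3_def w3_def vector_add_ldistrib vector_sadd_rdistrib
          vector_smult_assoc mult.commute add_ac)
    then show ?thesis unfolding V3 using span_change[of x u y z v3 w3] D by simp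
  qed
  ultimately have "V l = (*v) A ` normal_lines \<alpha> \<beta> l" if "l < 4" for l
    using that unfolding less_4_cases
    by (elim disjE) (simp_all add: normal_lines_def skew frame_image_std_line[of e f e' f', folded A_def]
        frame_image_opp_line[of e f e' f', folded A_def])
  then show ?thesis using that[OF B ne(1) ne1(1) ne(2) ne1(2) ab_ne] by (simp add: V_def)
qed

lemma dim_sextics_good_family:
  fixes v w :: "nat \<Rightarrow> 'k::{alg_closed_field, field_char_0} ^ 4"
  assumes good: "good_family v w"
  shows "hp.dim {p \<in> (\<Inter>l<4. sq (vec.span {v l, w l})). homog 6 p} = 10" (is "hp.dim ?J = 10")
proof -
  obtain A B \<alpha> \<beta> where AB: "A ** B = mat 1" "B ** A = mat 1"
    and ab: "\<alpha> \<noteq> 0" "\<alpha> \<noteq> 1" "\<beta> \<noteq> 0" "\<beta> \<noteq> 1" "\<alpha> \<noteq> \<beta>"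
    and V: "\<And>l. l < 4 \<Longrightarrow> vec.span {v l, w l} = (*v) A ` normal_lines \<alpha> \<beta> l"
    using good_family_normal_form[OF good] by blast
  let ?N = "{p \<in> (\<Inter>l<4. sq (normal_lines \<alpha> \<beta> l)). homog 6 p}"
  have iff: "subst A p \<in> ?N \<longleftrightarrow> p \<in> ?J" for p
    using subst_in_sq_iff[OF AB] homog_subst_iff[OF AB] V by simp
  have lin: "Vector_Spaces.linear hscale hscale (subst A)"
    by unfold_locales (simp_all add: hscale_def subst_simps)
  have "subst A ` ?J = ?N"
  proof
    show "subst A ` ?J \<subseteq> ?N" using iff by blast
    show "?N \<subseteq> subst A ` ?J"
    proof
      fix q assume q: "q \<in> ?N"
      have "q = subst A (subst B q)" using AB by (simp add: subst_subst)
      then show "q \<in> subst A ` ?J" using iff[of "subst B q"] q by auto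
    qed
  qed
  moreover have "{p \<in> ?J. subst A p = 0} = {0}"
  proof -
    have "p = 0" if "subst A p = 0" for p
    proof -
      have "subst B (subst A p) = 0" using that by (simp add: subst_simps)
      then show "p = 0" using AB by (simp add: subst_subst)
    qed
    moreover have "0 \<in> ?J" by (simp add: self.subspace_0[OF is_ideal_sq])
    ultimately show ?thesis by (auto simp: subst_simps)
  qed
  moreover have "hp.subspace ?J"
    by (rule subspace_forms) (intro is_ideal_INT is_ideal_sq)
  then have "hp.dim ?J = hp.dim {p \<in> ?J. subst A p = 0} + hp.dim (subst A ` ?J)"
    by (rule rank_nullity_on[OF lin, of _ "(\<lambda>m. single m 1) ` mons 6"])
       (use supp_in_basis(1)[OF finite_mons[of 6], where 'k = 'k] finite_mons in \<open>auto simp: homog_iff_supp\<close>)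
  moreover have "hp.dim {0 :: 'k hpoly} = 0"
    using hp.dim_unique[of "{}" "{0 :: 'k hpoly}" 0] by (simp add: hp.independent_empty)
  ultimately show ?thesis using dim_normal_sextics[OF ab] by simp
qed

section \<open>Openness\<close>

text \<open>Polynomials are treated as functions of the parameters, so that openness follows from
  closure under sums and products without writing the polynomial down.\<close>

definition polynomial_on :: "'v set \<Rightarrow> (('v \<Rightarrow> 'k) \<Rightarrow> 'k::comm_ring_1) \<Rightarrow> bool" where
  "polynomial_on A f \<longleftrightarrow> (\<exists>p. vars_mpoly p \<subseteq> A \<and> (\<forall>t. eval_mpoly t p = f t))"

lemma polynomial_on_const: "polynomial_on A (\<lambda>t. c)"
  unfolding polynomial_on_def
  by (rule exI[of _ "single 0 c"]) (auto simp: vars_mpoly_def split: if_splits)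

lemma polynomial_on_var: "v \<in> A \<Longrightarrow> polynomial_on A (\<lambda>t. t v)"
  unfolding polynomial_on_def
  by (rule exI[of _ "single (single v 1) 1"]) (auto simp: vars_mpoly_def eval_mpoly_simps split: if_splits)

lemma polynomial_on_add:
  assumes "polynomial_on A f" "polynomial_on A g"
  shows "polynomial_on A (\<lambda>t. f t + g t)"
proof -
  obtain p q where "vars_mpoly p \<subseteq> A" "\<forall>t. eval_mpoly t p = f t" "vars_mpoly q \<subseteq> A" "\<forall>t. eval_mpoly t q = g t"
    using assms unfolding polynomial_on_def by blast
  moreover have "vars_mpoly (p + q) \<subseteq> vars_mpoly p \<union> vars_mpoly q"
    using keys_add[of p q] by (auto simp: vars_mpoly_def)
  ultimately show ?thesis unfolding polynomial_on_def
    by (intro exI[of _ "p + q"]) (auto simp: eval_mpoly_simps)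
qed

lemma polynomial_on_mult:
  assumes "polynomial_on A f" "polynomial_on A g"
  shows "polynomial_on A (\<lambda>t. f t * g t)"
proof -
  obtain p q where "vars_mpoly p \<subseteq> A" "\<forall>t. eval_mpoly t p = f t" "vars_mpoly q \<subseteq> A" "\<forall>t. eval_mpoly t q = g t"
    using assms unfolding polynomial_on_def by blast
  moreover have "vars_mpoly (p * q) \<subseteq> vars_mpoly p \<union> vars_mpoly q"
  proof
    fix v assume "v \<in> vars_mpoly (p * q)"
    then obtain m where m: "m \<in> keys (p * q)" "v \<in> keys m" by (auto simp: vars_mpoly_def)
    then obtain a b where "m = a + b" "a \<in> keys p" "b \<in> keys q" using keys_mult[of p q] by blast
    then show "v \<in> vars_mpoly p \<union> vars_mpoly q"
      using m(2) keys_add[of a b] by (auto simp: vars_mpoly_def)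
  qed
  ultimately show ?thesis unfolding polynomial_on_def
    by (intro exI[of _ "p * q"]) (auto simp: eval_mpoly_simps)
qed

lemma polynomial_on_diff:
  assumes "polynomial_on A f" "polynomial_on A g"
  shows "polynomial_on A (\<lambda>t. f t - g t)"
  using polynomial_on_add[OF assms(1) polynomial_on_mult[OF polynomial_on_const[of _ "- 1"] assms(2)]] by simp

lemma polynomial_on_sum: "(\<And>x. x \<in> X \<Longrightarrow> polynomial_on A (f x)) \<Longrightarrow> polynomial_on A (\<lambda>t. \<Sum>x\<in>X. f x t)"
  by (induction X rule: infinite_finite_induct) (auto intro: polynomial_on_const polynomial_on_add)

lemma polynomial_on_prod: "(\<And>x. x \<in> X \<Longrightarrow> polynomial_on A (f x)) \<Longrightarrow> polynomial_on A (\<lambda>t. \<Prod>x\<in>X. f x t)"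
  by (induction X rule: infinite_finite_induct) (auto intro: polynomial_on_const polynomial_on_mult)

lemma zariski_open_nonzero:
  assumes "polynomial_on A f"
  shows "zariski_open A {t \<in> affine_space A. f t \<noteq> 0}"
proof -
  obtain p where "vars_mpoly p \<subseteq> A" "\<forall>t. eval_mpoly t p = f t"
    using assms unfolding polynomial_on_def by blast
  then show ?thesis unfolding zariski_open_def by (intro exI[of _ "{p}"]) auto
qed

section \<open>The open set of good parameters\<close>

definition pt :: "2 \<Rightarrow> (nat \<times> 2 \<times> 4 \<Rightarrow> 'k) \<Rightarrow> nat \<Rightarrow> 'k::field ^ 4" where
  "pt s t i = (\<chi> m. t (i, s, m))"

lemma spanned_line_pt: "spanned_line t i = vec.span {pt 0 t i, pt 1 t i}"
  by (simp add: spanned_line_def pt_def)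

lemma polynomial_on_gram:
  assumes "i < n" "j < n"
  shows "polynomial_on ({..<n} \<times> UNIV) (\<lambda>t. gram (pt 0 t) (pt 1 t) i j)"
proof -
  have "polynomial_on ({..<n} \<times> UNIV) (\<lambda>t. frame (pt 0 t i) (pt 1 t i) (pt 0 t j) (pt 1 t j) $ k $ l)" for k l
    using exhaust_four[of l] assms by (auto simp: pt_def intro!: polynomial_on_var)
  then show ?thesis
    unfolding gram_def br_def det_def
    by (intro polynomial_on_sum polynomial_on_mult polynomial_on_const polynomial_on_prod)
qed

definition good_poly :: "(nat \<times> 2 \<times> 4 \<Rightarrow> 'k) \<Rightarrow> 'k::field" where
  "good_poly t = (\<Prod>i<4. \<Prod>j\<in>{..<4} - {i}. gram (pt 0 t) (pt 1 t) i j) * discr (gram (pt 0 t) (pt 1 t))"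

lemma good_poly_nonzero_iff: "good_poly t \<noteq> 0 \<longleftrightarrow> good_family (pt 0 t) (pt 1 t)"
  by (auto simp: good_poly_def good_family_def)

lemma polynomial_on_good_poly: "polynomial_on ({..<4} \<times> UNIV) (good_poly :: _ \<Rightarrow> 'k::field)"
proof -
  have "polynomial_on ({..<4} \<times> UNIV) (\<lambda>t :: _ \<Rightarrow> 'k. discr (gram (pt 0 t) (pt 1 t)))"
    unfolding discr_def disc3_def power2_eq_square
    by (intro polynomial_on_diff polynomial_on_add polynomial_on_mult polynomial_on_gram polynomial_on_const)
       simp_all
  then have "polynomial_on ({..<4} \<times> UNIV) (\<lambda>t :: _ \<Rightarrow> 'k. good_poly t)"
    unfolding good_poly_def
    by (intro polynomial_on_mult polynomial_on_prod polynomial_on_gram) simp_all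
  then show ?thesis by simp
qed

text \<open>The normal form with \<alpha> = 2 and \<beta> = 3: the brackets are 1, 2 and 6, nonzero
  in characteristic 0, and the discriminant is (\<alpha> - \<beta>)^2 = 1.\<close>

lemma ex_good_family: "\<exists>t \<in> affine_space ({..<4} \<times> UNIV). good_family (pt 0 t) (pt 1 t :: nat \<Rightarrow> 'k::field_char_0 ^ 4)"
proof -
  define v :: "nat \<Rightarrow> 'k ^ 4" where "v l = (if l = 0 then vec4 1 0 0 0 else if l = 1 then vec4 0 0 1 0
     else if l = 2 then vec4 1 0 1 0 else vec4 1 0 2 0)" for l
  define w :: "nat \<Rightarrow> 'k ^ 4" where "w l = (if l = 0 then vec4 0 1 0 0 else if l = 1 then vec4 0 0 0 1
     else if l = 2 then vec4 0 1 0 1 else vec4 0 1 0 3)" for l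
  \<comment> \<open>Points of \<open>affine_space\<close> are extensional functions, hence
    \<open>undefined\<close> outside the index set.\<close>
  define t :: "nat \<times> 2 \<times> 4 \<Rightarrow> 'k" where
    "t = (\<lambda>(l, s, m). if l < 4 then if s = 0 then v l $ m else w l $ m else undefined)"
  have pt: "pt 0 t l = v l" "pt 1 t l = w l" if "l < 4" for l
    using that by (simp_all add: pt_def t_def vec_eq_iff)
  have g: "gram (pt 0 t) (pt 1 t) i j = br (v i) (w i) (v j) (w j)" if "i < 4" "j < 4" for i j
    using that by (simp add: gram_def pt)
  have G: "gram (pt 0 t) (pt 1 t) 0 1 = 1" "gram (pt 0 t) (pt 1 t) 0 2 = 1" "gram (pt 0 t) (pt 1 t) 0 3 = 6"
    "gram (pt 0 t) (pt 1 t) 1 2 = 1" "gram (pt 0 t) (pt 1 t) 1 3 = 1" "gram (pt 0 t) (pt 1 t) 2 3 = 2"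
    by (subst g; simp add: v_def w_def br_vec4)+
  have G': "gram (pt 0 t) (pt 1 t) 1 0 = 1" "gram (pt 0 t) (pt 1 t) 2 0 = 1" "gram (pt 0 t) (pt 1 t) 3 0 = 6"
    "gram (pt 0 t) (pt 1 t) 2 1 = 1" "gram (pt 0 t) (pt 1 t) 3 1 = 1" "gram (pt 0 t) (pt 1 t) 3 2 = 2"
    by (subst gram_commute, rule G)+
  have "gram (pt 0 t) (pt 1 t) i j \<noteq> 0" if "i < 4" "j < 4" "i \<noteq> j" for i j
    using that G G' unfolding less_4_cases by (elim disjE) simp_all
  moreover have "discr (gram (pt 0 t) (pt 1 t)) = 1"
    unfolding discr_def G by (simp add: disc3_def)
  ultimately have "good_family (pt 0 t) (pt 1 t)" by (simp add: good_family_def)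
  moreover have "t \<in> affine_space ({..<4} \<times> UNIV)"
    by (auto simp: affine_space_def t_def PiE_def extensional_def)
  ultimately show ?thesis by blast
qed

theorem lemma3p11:
  shows "holds_for_general 4 0
    (\<lambda>X :: 'k::{alg_closed_field, field_char_0} hpoly set. has_h 0 X 6 10 \<and> has_h 1 X 6 2)"
proof -
  define T where "T = {t \<in> affine_space ({..<4} \<times> UNIV). good_family (pt 0 t) (pt 1 t :: nat \<Rightarrow> 'k ^ 4)}"
  define U where "U = (\<lambda>t. union_ideal 4 0 (spanned_line t)) ` T"
  have disj: "disjoint_lines 4 (spanned_line t)" if "t \<in> T" for t
    using that gram_disjoint_iff[of "pt 0 t" "pt 1 t"]
    by (simp add: T_def good_family_def spanned_line_pt[abs_def])
  have "U \<subseteq> Zset 4 0" using disj by (auto simp: U_def Zset_def)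
  \<comment> \<open>\<open>T\<close> is the full preimage of \<open>U\<close>: parameters with the
    same ideal give the same lines up to order, and goodness does not see the order or the spanning
    vectors.\<close>
  moreover have "{t \<in> affine_space ({..<4 + 0} \<times> UNIV).
      disjoint_lines (4 + 0) (spanned_line t) \<and> union_ideal 4 0 (spanned_line t) \<in> U} = T"
    (is "?L = T")
  proof
    show "T \<subseteq> ?L" using disj by (auto simp: T_def U_def)
    show "?L \<subseteq> T"
    proof
      fix t assume t: "t \<in> ?L"
      then obtain t' where t': "t' \<in> T" "union_ideal 4 0 (spanned_line t) = union_ideal 4 0 (spanned_line t')"
        by (auto simp: U_def)
      have dt: "disjoint_lines 4 (spanned_line t)" using t by simp
      obtain \<pi> where \<pi>: "inj_on \<pi> {..<4}" "\<pi> ` {..<4} \<subseteq> {..<4}"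
        "\<And>i. i < 4 \<Longrightarrow> spanned_line t i = spanned_line t' (\<pi> i)"
        using union_ideal_lines_unique[OF dt disj[OF t'(1)] t'(2)] by blast
      have "good_family (pt 0 t) (pt 1 t)"
        by (rule good_family_transfer[OF _ _ \<pi>(1,2), of "pt 0 t'" "pt 1 t'"])
           (use t'(1) dt \<pi>(3) in \<open>simp_all add: T_def spanned_line_pt[abs_def]\<close>)
      then show "t \<in> T" using t by (simp add: T_def)
    qed
  qed
  moreover have "zariski_open ({..<4} \<times> UNIV) T"
    using zariski_open_nonzero[OF polynomial_on_good_poly[where 'k = 'k]]
    by (simp add: T_def good_poly_nonzero_iff)
  ultimately have "Zset_open 4 0 U" by (simp add: Zset_open_def)
  moreover have "U \<noteq> {}" using ex_good_family[where 'k = 'k] by (auto simp: U_def T_def)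
  moreover have "has_h 0 X 6 10 \<and> has_h 1 X 6 2" if "X \<in> U" for X
  proof -
    obtain t where t: "t \<in> T" "X = union_ideal 4 0 (spanned_line t)" using \<open>X \<in> U\<close> by (auto simp: U_def)
    have "hp.dim {p \<in> (\<Inter>l<4. sq (spanned_line t l)). homog 6 p} = 10"
      using dim_sextics_good_family[of "pt 0 t" "pt 1 t"] t(1) by (simp add: T_def spanned_line_pt)
    then show ?thesis
      using cohomology_if_dim_10[OF disj[OF t(1)]] t(2) by (simp add: union_ideal_doubled)
  qed
  ultimately show ?thesis unfolding holds_for_general_def by blast
qed

end
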